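(* Fix an integer $k\ge3$, let $r:=\frac{4k-4}{4k-5}$, and for each positive integer $n$ define $$l^*(n):=\min\Big\{j\in\mathbb{N}:\ \sum_{l=0}^{j}4\,\mathrm{ex}\big(4(k-1)\lceil r^{l}\rceil,2k\big)\ge n\Big\},\qquad U_k(n):=\sum_{l=0}^{l^*(n)}\frac{4\,\mathrm{ex}\big(4(k-1)\lceil r^{l}\rceil,2k\big)}{r^{l}}.$$ Then $\alpha_k(n)\le U_k(n)$ for all $n$, and there is a constant $c_k>0$ such that $\alpha_k(n)\ge c_k\,U_k(n)/\log n$ for all sufficiently large $n$; i.e. the upper bound $U_k(n)$ is tight up to a factor $O(\log n)$.
   Context: A \textsc{Metric TSP} instance on $n$ vertices is the complete graph $K_n$ with edge costs $c:E(K_n)\to\mathbb{R}_{\ge0}$ satisfying the triangle inequality. A tour is a Hamiltonian cycle, with length $c(T)=\sum_{e\in T}c(e)$; $\mathrm{OPT}(I)$ is the minimum tour length. A $k$-move replaces at most $k$ edges of a tour by other edges so that the result is again a tour; it is improving if the new tour is strictly shorter. A tour is $k$-optimal if no improving $k$-move exists. $\alpha_k(n)$ is the supremum of $c(T)/\mathrm{OPT}(I)$ over all \textsc{Metric TSP} instances $I$ on $n$ vertices with $\mathrm{OPT}(I)>0$ and all $k$-optimal tours $T$ of $I$. The girth of a graph is the length of its shortest cycle ($\infty$ if none). $\mathrm{ex}(n,2k)$ is the maximum number of edges of a simple graph on $n$ vertices with girth at least $2k$. *)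

theory Defs
  imports "HOL-Analysis.Analysis" "HOL-Library.Extended_Real"
begin

definition Kedges :: "nat \<Rightarrow> nat set set" where
  "Kedges n = {{u, v} | u v. u < n \<and> v < n \<and> u \<noteq> v}"

definition metric_inst :: "nat \<Rightarrow> (nat set \<Rightarrow> real) \<Rightarrow> bool" where
  "metric_inst n c \<longleftrightarrow>
     (\<forall>e\<in>Kedges n. c e \<ge> 0) \<and>
     (\<forall>u v w. u < n \<longrightarrow> v < n \<longrightarrow> w < n \<longrightarrow> u \<noteq> v \<longrightarrow> v \<noteq> w \<longrightarrow> u \<noteq> w \<longrightarrow>
        c {u, w} \<le> c {u, v} + c {v, w})"

definition is_tour :: "nat \<Rightarrow> nat set set \<Rightarrow> bool" where
  "is_tour n T \<longleftrightarrow> n \<ge> 3 \<and>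
     (\<exists>p. distinct p \<and> set p = {..<n} \<and>
          T = {{p ! i, p ! ((i + 1) mod n)} | i. i < n})"

definition tour_cost :: "(nat set \<Rightarrow> real) \<Rightarrow> nat set set \<Rightarrow> real" where
  "tour_cost c T = (\<Sum>e\<in>T. c e)"

definition OPT :: "nat \<Rightarrow> (nat set \<Rightarrow> real) \<Rightarrow> real" where
  "OPT n c = Min (tour_cost c ` {T. is_tour n T})"

definition k_optimal :: "nat \<Rightarrow> nat \<Rightarrow> (nat set \<Rightarrow> real) \<Rightarrow> nat set set \<Rightarrow> bool" where
  "k_optimal k n c T \<longleftrightarrow> is_tour n T \<and>
     (\<forall>T'. is_tour n T' \<longrightarrow> card (T - T') \<le> k \<longrightarrow> \<not> tour_cost c T' < tour_cost c T)"

text \<open>alpha_k(n), as a supremum in the extended reals (Sup of the empty set is -infinity).\<close>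
definition alpha :: "nat \<Rightarrow> nat \<Rightarrow> ereal" where
  "alpha k n = Sup {ereal (tour_cost c T / OPT n c) | c T.
       metric_inst n c \<and> OPT n c > 0 \<and> k_optimal k n c T}"

definition has_cycle_len :: "nat set set \<Rightarrow> nat \<Rightarrow> bool" where
  "has_cycle_len E m \<longleftrightarrow> m \<ge> 3 \<and>
     (\<exists>vs. distinct vs \<and> length vs = m \<and> (\<forall>i<m. {vs ! i, vs ! ((i + 1) mod m)} \<in> E))"

definition girth_ge :: "nat set set \<Rightarrow> nat \<Rightarrow> bool" where
  "girth_ge E g \<longleftrightarrow> (\<forall>m. has_cycle_len E m \<longrightarrow> m \<ge> g)"

definition ex :: "nat \<Rightarrow> nat \<Rightarrow> nat" where
  "ex n g = Max {card E | E. E \<subseteq> Kedges n \<and> girth_ge E g}"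

definition rk :: "nat \<Rightarrow> real" where
  "rk k = (4 * real k - 4) / (4 * real k - 5)"

definition term_k :: "nat \<Rightarrow> nat \<Rightarrow> nat" where
  "term_k k l = 4 * ex (4 * (k - 1) * nat \<lceil>rk k ^ l\<rceil>) (2 * k)"

definition lstar :: "nat \<Rightarrow> nat \<Rightarrow> nat" where
  "lstar k n = (LEAST j. (\<Sum>l\<le>j. term_k k l) \<ge> n)"

definition U :: "nat \<Rightarrow> nat \<Rightarrow> real" where
  "U k n = (\<Sum>l\<le>lstar k n. real (term_k k l) / rk k ^ l)"

end

theory Submission
  imports Defs
begin

text \<open>Upper bound. Normalise the optimum to 1 and let \<open>r = rk k\<close>. Cut an optimal tour into
  \<open>4 (k - 1) \<lceil>r^l\<rceil>\<close> short clusters and consider the edges of a \<open>k\<close>-optimal tour \<open>T\<close> of length in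
  \<open>(r^-(l+1), r^-l]\<close>. Orient \<open>T\<close>; for a suitable set \<open>A\<close> of clusters at least a quarter of these edges
  lead from \<open>A\<close> to its complement. They form a graph of girth at least \<open>2k\<close> on the clusters:
  otherwise \<open>2h < 2k\<close> of them have their tails paired up within clusters, and likewise their heads.
  Replacing them by the short edges of the pairing gives a 2-factor with at most \<open>h\<close> cycles, as each
  cycle contains a tail--tail edge. A removed edge \<open>ab\<close> can be restored at additional cost at most
  \<open>2 c(ab)\<close> by exchanging \<open>au, bv\<close> for \<open>ab, uv\<close>. Doing this \<open>h - 1\<close> times, first merging cycles and then
  keeping a single cycle (possible while a tail--tail edge is left), yields an improving \<open>(h+1)\<close>-move.
  Hence every length class has at most \<open>term_k k l\<close> edges, and the length of \<open>T\<close> is largest when the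
  long classes are filled first.

  Lower bound. An extremal graph of girth \<open>2k\<close> has a large even subgraph, one of whose closed
  trails has at least the same ratio of edges to vertices. Blowing up its vertices turns the trail into a
  \<open>k\<close>-optimal tour, by parity and girth, whereas twice the number of vertices bounds the optimum.
  Since \<open>lstar k n = O(log n)\<close>, some summand of \<open>U k n\<close> is within a factor \<open>O(log n)\<close> of the whole sum.\<close>

section \<open>Cycles as lists\<close>

text \<open>A cycle in the cluster graph may have up to \<open>2 * k - 2\<close> edges, too many for
  one \<open>k\<close>-move; this is why all but \<open>h + 1\<close> of the \<open>2 * h\<close>
  removed edges have to come back. A restored edge enters the new tour at twice its length, so the
  \<open>h + 1\<close> missing edges must outweigh the \<open>h - 1\<close> restored ones plus the
  short edges. This requires nearly equal lengths and fixes \<open>rk k\<close>: a class reaches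
  from \<open>W - W / (4 * k - 4)\<close> to \<open>W\<close>, and with cluster distances of at most
  \<open>W / (4 * k - 4)\<close> the surplus of two edges beats all errors. The orientation and the
  cut keep tails and heads of removed edges in different clusters. Hence no vertex loses both its
  tour edges: a tail keeps the edge from its predecessor, a head the edge to its successor, and
  restoring never gives these up. In the lower bound the new edges of an exchange need not project
  to edges of the trail; measuring distance by edge sets modulo 2 still lets parity produce a short
  cycle. The logarithm stems only from the number of summands of \<open>U\<close>.\<close>

definition dpath :: "'a list \<Rightarrow> ('a \<times> 'a) set" where
  "dpath xs = set (zip xs (tl xs))"

definition dcyc :: "'a list \<Rightarrow> ('a \<times> 'a) set" where
  "dcyc xs = set (zip xs (rotate1 xs))"

definition cyc_edges :: "'a list \<Rightarrow> 'a set set" where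
  "cyc_edges xs = (\<lambda>(x, y). {x, y}) ` dcyc xs"

definition path_edges :: "'a list \<Rightarrow> 'a set set" where
  "path_edges xs = (\<lambda>(x, y). {x, y}) ` dpath xs"

fun pcost :: "('a set \<Rightarrow> real) \<Rightarrow> 'a list \<Rightarrow> real" where
  "pcost c (x # y # xs) = c {x, y} + pcost c (y # xs)"
| "pcost c _ = 0"

text \<open>A one-vertex list has a loop as its closing edge and a two-vertex list counts its edge
  twice; \<open>ex_cheap_tour\<close> builds its tour up from such lists.\<close>

definition ccost :: "('a set \<Rightarrow> real) \<Rightarrow> 'a list \<Rightarrow> real" where
  "ccost c xs = pcost c xs + c {last xs, hd xs}"

lemma dpath_simps [simp]: "dpath [] = {}" "dpath [x] = {}"
  "dpath (x # y # xs) = insert (x, y) (dpath (y # xs))"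
  by (auto simp: dpath_def)

lemma dpath_append:
  "xs \<noteq> [] \<Longrightarrow> ys \<noteq> [] \<Longrightarrow> dpath (xs @ ys) = insert (last xs, hd ys) (dpath xs \<union> dpath ys)"
proof (induction xs rule: induct_list012)
  case (2 x)
  then show ?case by (cases ys) auto
qed auto

lemma dpath_rev: "dpath (rev xs) = (dpath xs)\<inverse>"
proof (induction xs rule: induct_list012)
  case (3 x y zs)
  have "dpath (rev (x # y # zs)) = dpath (rev (y # zs) @ [x])" by simp
  also have "\<dots> = insert (y, x) (dpath (rev (y # zs)))"
    by (subst dpath_append) auto
  finally show ?case using 3 by auto
qed auto

lemma dcyc_eq: "xs \<noteq> [] \<Longrightarrow> dcyc xs = insert (last xs, hd xs) (dpath xs)"
proof -
  assume "xs \<noteq> []"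
  have *: "zip (x # xs) (xs @ [y]) = zip (x # xs) xs @ [(last (x # xs), y)]" for x y :: 'a and xs
    by (induction xs arbitrary: x) auto
  obtain x ys where "xs = x # ys" using \<open>xs \<noteq> []\<close> by (cases xs) auto
  then show ?thesis using *[of x ys x] by (auto simp: dcyc_def dpath_def)
qed

lemma dcyc_append:
  "xs \<noteq> [] \<Longrightarrow> ys \<noteq> [] \<Longrightarrow>
    dcyc (xs @ ys) = {(last xs, hd ys), (last ys, hd xs)} \<union> dpath xs \<union> dpath ys"
  by (auto simp: dcyc_eq dpath_append)

lemma dcyc_append_commute: "dcyc (xs @ ys) = dcyc (ys @ xs)"
  by (cases "xs = []"; cases "ys = []") (auto simp: dcyc_append)

lemma dcyc_rev: "dcyc (rev xs) = (dcyc xs)\<inverse>"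
proof (cases "xs = []")
  case True
  then show ?thesis by (simp add: dcyc_def)
qed (auto simp: dcyc_eq dpath_rev hd_rev last_rev)

lemma dcyc_conv: "dcyc xs = {(xs ! i, xs ! (Suc i mod length xs)) | i. i < length xs}"
  by (auto simp: dcyc_def set_zip nth_rotate1)

lemma cyc_edges_conv: "cyc_edges xs = {{xs ! i, xs ! (Suc i mod length xs)} | i. i < length xs}"
  unfolding cyc_edges_def dcyc_conv by (auto simp: image_iff)

lemma cyc_edges_rev: "cyc_edges (rev xs) = cyc_edges xs"
  by (force simp: cyc_edges_def dcyc_rev insert_commute image_iff)

lemma cyc_edges_cut:
  assumes "xs \<noteq> []" shows "cyc_edges xs = insert {last xs, hd xs} (path_edges xs)"
  using assms by (auto simp: cyc_edges_def path_edges_def dcyc_eq)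

lemma cyc_edges_append:
  "xs \<noteq> [] \<Longrightarrow> ys \<noteq> [] \<Longrightarrow>
    cyc_edges (xs @ ys) = {{last xs, hd ys}, {last ys, hd xs}} \<union> path_edges xs \<union> path_edges ys"
  by (auto simp: cyc_edges_def path_edges_def dcyc_append)

lemma path_edges_rev: "path_edges (rev xs) = path_edges xs"
  by (force simp: path_edges_def dpath_rev insert_commute image_iff)

lemma pcost_append:
  "xs \<noteq> [] \<Longrightarrow> ys \<noteq> [] \<Longrightarrow> pcost c (xs @ ys) = pcost c xs + c {last xs, hd ys} + pcost c ys"
proof (induction xs rule: induct_list012)
  case (2 x)
  then show ?case by (cases ys) auto
qed auto

lemma pcost_rev: "pcost c (rev xs) = pcost c xs"
proof (induction xs rule: induct_list012)
  case (3 x y zs)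
  have "pcost c (rev (x # y # zs)) = pcost c (rev (y # zs) @ [x])" by simp
  also have "\<dots> = pcost c (rev (y # zs)) + c {last (rev (y # zs)), x} + pcost c [x]"
    by (subst pcost_append) auto
  finally show ?case using 3 by (simp add: insert_commute)
qed auto

lemma ccost_append:
  "xs \<noteq> [] \<Longrightarrow> ys \<noteq> [] \<Longrightarrow>
    ccost c (xs @ ys) = pcost c xs + pcost c ys + c {last xs, hd ys} + c {last ys, hd xs}"
  by (simp add: ccost_def pcost_append)

lemma ccost_append_commute: "ccost c (xs @ ys) = ccost c (ys @ xs)"
  by (cases "xs = []"; cases "ys = []") (auto simp: ccost_append insert_commute)

lemma ccost_rev: "ccost c (rev xs) = ccost c xs"
  by (cases "xs = []") (simp_all add: ccost_def pcost_rev hd_rev last_rev insert_commute)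

lemma dcyc_in_set: "(x, y) \<in> dcyc xs \<Longrightarrow> x \<in> set xs \<and> y \<in> set xs"
  by (auto simp: dcyc_def dest: set_zip_leftD set_zip_rightD)

lemma dpath_in_set: "(x, y) \<in> dpath xs \<Longrightarrow> x \<in> set xs \<and> y \<in> set xs"
  by (cases xs) (auto simp: dpath_def dest: set_zip_leftD set_zip_rightD)

lemma cyc_edges_subset: "e \<in> cyc_edges xs \<Longrightarrow> e \<subseteq> set xs"
  by (auto simp: cyc_edges_def dest: dcyc_in_set)

lemma dcyc_ex_succ: "x \<in> set xs \<Longrightarrow> \<exists>y. (x, y) \<in> dcyc xs"
  by (fastforce simp: dcyc_conv in_set_conv_nth)

lemma dcyc_ex_pred: "x \<in> set xs \<Longrightarrow> \<exists>y. (y, x) \<in> dcyc xs"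
  using dcyc_ex_succ[of x "rev xs"] by (auto simp: dcyc_rev)

lemma dcyc_succ_unique:
  "distinct xs \<Longrightarrow> (x, y) \<in> dcyc xs \<Longrightarrow> (x, y') \<in> dcyc xs \<Longrightarrow> y = y'"
  by (auto simp: dcyc_conv nth_eq_iff_index_eq)

lemma dcyc_pred_unique:
  "distinct xs \<Longrightarrow> (y, x) \<in> dcyc xs \<Longrightarrow> (y', x) \<in> dcyc xs \<Longrightarrow> y = y'"
  using dcyc_succ_unique[of "rev xs" x y y'] by (auto simp: dcyc_rev)

lemma cyc_edges_finite [simp]: "finite (cyc_edges xs)"
  by (simp add: cyc_edges_def dcyc_def)

lemma dpath_split: "(x, y) \<in> dpath xs \<Longrightarrow> \<exists>as bs. xs = as @ x # y # bs"
proof (induction xs rule: induct_list012)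
  case (3 z w zs)
  from 3(3) consider "x = z" "y = w" | "(x, y) \<in> dpath (w # zs)" by auto
  then show ?case
  proof cases
    case 1
    then have "z # w # zs = [] @ x # y # zs" by simp
    then show ?thesis by blast
  next
    case 2
    then obtain as bs where "w # zs = as @ x # y # bs" using 3(2) by auto
    then have "z # w # zs = (z # as) @ x # y # bs" by simp
    then show ?thesis by blast
  qed
qed auto

text \<open>Exchanges are carried out at the closing edge of a list, from its last entry to its
  head; a rotation brings any chosen edge there.\<close>

lemma cycle_cut:
  assumes "(x, y) \<in> dcyc xs" "distinct xs"
  obtains ys where "distinct ys" "set ys = set xs" "length ys = length xs" "dcyc ys = dcyc xs"
    "\<And>c. ccost c ys = ccost c xs" "last ys = x" "hd ys = y" "ys \<noteq> []"
proof -
  have ne: "xs \<noteq> []" using assms by (auto simp: dcyc_def)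
  consider "x = last xs" "y = hd xs" | "(x, y) \<in> dpath xs"
    using assms(1) ne by (auto simp: dcyc_eq)
  then show ?thesis
  proof cases
    case 1 then show ?thesis using that[of xs] ne assms(2) by auto
  next
    case 2
    then obtain as bs where xs: "xs = as @ x # y # bs" using dpath_split by metis
    have eq: "xs = (as @ [x]) @ (y # bs)" by (simp add: xs)
    show ?thesis
    proof (rule that[of "(y # bs) @ (as @ [x])"])
      show "dcyc ((y # bs) @ (as @ [x])) = dcyc xs" unfolding eq by (rule dcyc_append_commute)
      show "ccost c ((y # bs) @ (as @ [x])) = ccost c xs" for c
        unfolding eq by (rule ccost_append_commute)
    qed (use assms(2) xs in auto)
  qed
qed

text \<open>After a rotation that makes \<open>(y, x)\<close> the closing edge, the successor of
  \<open>x\<close> is the second entry, which with three or more entries differs from the last entry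
  \<open>y\<close>.\<close>

lemma dcyc_asym:
  assumes "distinct xs" "3 \<le> length xs" "(x, y) \<in> dcyc xs" shows "(y, x) \<notin> dcyc xs"
proof
  assume a: "(y, x) \<in> dcyc xs"
  from a assms obtain ys where ys: "distinct ys" "length ys = length xs" "dcyc ys = dcyc xs"
    "last ys = y" "hd ys = x" "ys \<noteq> []" by (metis cycle_cut)
  obtain z w zs where zs: "ys = z # w # zs" "zs \<noteq> []"
    using ys assms(2) by (cases ys; cases "tl ys"; cases "tl (tl ys)") auto
  then have "(x, w) \<in> dcyc ys" using ys(5) by (simp add: dcyc_eq)
  then have "w = y" using dcyc_succ_unique[OF assms(1)] assms(3) ys(3) by metis
  then show False using ys zs by (metis distinct.simps(2) last_ConsR last_in_set list.discI)
qed

lemma dcyc_neq: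
  assumes "distinct xs" "2 \<le> length xs" "(x, y) \<in> dcyc xs" shows "x \<noteq> y"
proof -
  from assms obtain i where i: "i < length xs" "x = xs ! i" "y = xs ! (Suc i mod length xs)"
    by (auto simp: dcyc_conv)
  have "Suc i mod length xs \<noteq> i" using i(1) assms(2) by (cases "Suc i = length xs") auto
  moreover have "Suc i mod length xs < length xs" using i(1) by (intro mod_less_divisor) auto
  ultimately show ?thesis using i assms(1) by (simp add: nth_eq_iff_index_eq)
qed

lemma cyc_edges_at:
  assumes "distinct xs" "(p, x) \<in> dcyc xs" "(x, y) \<in> dcyc xs"
  shows "{e \<in> cyc_edges xs. x \<in> e} = {{p, x}, {x, y}}"
proof -
  have "{e \<in> cyc_edges xs. x \<in> e} \<subseteq> {{p, x}, {x, y}}"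
    using assms dcyc_succ_unique[OF assms(1)] dcyc_pred_unique[OF assms(1)]
    unfolding cyc_edges_def by blast
  then show ?thesis using assms by (auto simp: cyc_edges_def)
qed

lemma card_cyc_edges_at:
  assumes "distinct xs" "3 \<le> length xs" "x \<in> set xs"
  shows "card {e \<in> cyc_edges xs. x \<in> e} = 2"
proof -
  obtain p y where py: "(p, x) \<in> dcyc xs" "(x, y) \<in> dcyc xs"
    using assms dcyc_ex_succ dcyc_ex_pred by metis
  have "p \<noteq> y" using dcyc_asym[OF assms(1,2)] py by blast
  then have "{p, x} \<noteq> {x, y}" by (auto simp: doubleton_eq_iff)
  then show ?thesis unfolding cyc_edges_at[OF assms(1) py] by simp
qed

lemma finite_dcyc [simp]: "finite (dcyc xs)" by (simp add: dcyc_def)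

lemma ccost_sum_dcyc:
  assumes "distinct xs" "xs \<noteq> []"
  shows "ccost c xs = (\<Sum>(x, y)\<in>dcyc xs. c {x, y})"
proof -
  have p: "pcost c zs = (\<Sum>(x, y)\<in>dpath zs. c {x, y})" if "distinct zs" for zs
    using that
  proof (induction zs rule: induct_list012)
    case (3 x y zs)
    have "(x, y) \<notin> dpath (y # zs)" using 3 dpath_in_set[of x y "y # zs"] by auto
    moreover have "finite (dpath (y # zs))" by (simp add: dpath_def)
    ultimately show ?case using 3 by simp
  qed auto
  have "(last xs, hd xs) \<notin> dpath xs"
  proof
    assume "(last xs, hd xs) \<in> dpath xs"
    then obtain as bs where "xs = as @ last xs # hd xs # bs" using dpath_split by metis
    then show False using assms
      by (metis append_is_Nil_conv distinct_append distinct.simps(2) last.simps last_appendR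
          last_in_set list.distinct(1) list.set_intros(1))
  qed
  moreover have "finite (dpath xs)" by (simp add: dpath_def)
  ultimately show ?thesis using assms by (simp add: ccost_def p dcyc_eq)
qed

lemma sum_cyc_edges:
  assumes "distinct xs" "3 \<le> length xs"
  shows "sum c (cyc_edges xs) = ccost c xs"
proof -
  have "inj_on (\<lambda>(x, y). {x, y}) (dcyc xs)"
    using dcyc_asym[OF assms] by (auto simp: inj_on_def doubleton_eq_iff)
  moreover have "xs \<noteq> []" using assms by auto
  ultimately show ?thesis
    by (simp add: cyc_edges_def sum.reindex ccost_sum_dcyc assms(1) case_prod_beta' comp_def)
qed

lemma cycle_cut_edge:
  assumes "{x, y} \<in> cyc_edges xs" "distinct xs"
  obtains ys where "distinct ys" "set ys = set xs" "length ys = length xs"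
    "cyc_edges ys = cyc_edges xs" "\<And>c. ccost c ys = ccost c xs" "last ys = x" "hd ys = y" "ys \<noteq> []"
proof -
  consider "(x, y) \<in> dcyc xs" | "(x, y) \<in> dcyc (rev xs)"
    using assms(1) by (auto simp: cyc_edges_def dcyc_rev doubleton_eq_iff)
  then show ?thesis
  proof cases
    case 1
    then show ?thesis
      using that assms(2) by (elim cycle_cut) (auto simp: cyc_edges_def)
  next
    case 2
    have "cyc_edges ys = cyc_edges xs" if "dcyc ys = dcyc (rev xs)" for ys
      using that cyc_edges_rev[of xs] by (simp add: cyc_edges_def)
    with 2 show ?thesis
      using that assms(2) by (elim cycle_cut) (auto simp: ccost_rev)
  qed
qed

section \<open>Cycles in graphs of minimum degree two\<close>

lemma ex_cycle_if_min_degree_2: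
  assumes "finite E" "E \<noteq> {}" "\<And>e. e \<in> E \<Longrightarrow> card e = 2"
    and deg: "\<And>v. v \<in> \<Union>E \<Longrightarrow> 2 \<le> card {e \<in> E. v \<in> e}"
  shows "\<exists>q. distinct q \<and> 3 \<le> length q \<and> cyc_edges q \<subseteq> E"
proof -
  have finU: "finite (\<Union>E)"
    using assms by (metis card.infinite finite_Union zero_neq_numeral)
  define P where "P q \<longleftrightarrow> distinct q \<and> 2 \<le> length q \<and> set q \<subseteq> \<Union>E \<and> path_edges q \<subseteq> E" for q
  obtain e where e: "e \<in> E" using assms(2) by auto
  then obtain x y where xy: "e = {x, y}" "x \<noteq> y" using assms(3) by (meson card_2_iff)
  have "P [x, y]" using e xy by (auto simp: P_def path_edges_def)
  moreover have "length q < Suc (card (\<Union>E))" if "P q" for q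
    using that finU by (metis P_def card_mono distinct_card le_imp_less_Suc)
  \<comment> \<open>A longest path: its end \<open>a\<close> has a second edge besides
    \<open>{a, b}\<close>, whose other end \<open>z\<close> must lie on the path by maximality. This
    closes a cycle, and as \<open>z\<close> comes after \<open>b\<close> it has at least three
    vertices.\<close>
  ultimately obtain q where q: "P q" and mx: "\<And>q'. P q' \<Longrightarrow> length q' \<le> length q"
    using ex_has_greatest_nat[of P _ length] by metis
  obtain a b zs where ab: "q = a # b # zs"
    using q by (cases q; cases "tl q") (auto simp: P_def)
  have aU: "a \<in> \<Union>E" "b \<in> \<Union>E" using q ab by (auto simp: P_def)
  have "\<not> {e \<in> E. a \<in> e} \<subseteq> {{a, b}}"
  proof
    assume "{e \<in> E. a \<in> e} \<subseteq> {{a, b}}"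
    then have "card {e \<in> E. a \<in> e} \<le> card {{a, b}}" by (intro card_mono) auto
    with deg[OF aU(1)] show False by simp
  qed
  then obtain e' where e': "e' \<in> E" "a \<in> e'" "e' \<noteq> {a, b}" by blast
  obtain z where z: "e' = {a, z}" "z \<noteq> a"
    using assms(3)[OF e'(1)] e'(2) by (auto simp: card_2_iff)
  have zb: "z \<noteq> b" using e' z by auto
  have "z \<in> set q"
  proof (rule ccontr)
    assume "z \<notin> set q"
    then have "P (z # q)"
      using q e' z ab by (auto simp: P_def path_edges_def insert_commute)
    from mx[OF this] show False by simp
  qed
  then obtain us vs where uv: "zs = us @ z # vs"
    using ab z zb by (auto dest: split_list)
  let ?q = "a # b # us @ [z]"
  have "q = ?q @ vs" by (simp add: ab uv)
  then have "path_edges ?q \<subseteq> path_edges q"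
    by (cases "vs = []") (auto simp: path_edges_def dpath_append[of ?q vs, simplified])
  then have "cyc_edges ?q \<subseteq> E"
    using q e' z by (subst cyc_edges_cut) (auto simp: P_def insert_commute)
  moreover have "distinct ?q" using q ab uv by (auto simp: P_def)
  ultimately show ?thesis by (intro exI[of _ ?q]) auto
qed

text \<open>A cycle in \<open>E\<close> uses up both edges at each of its vertices, so what remains
  after its removal is again 2-regular and avoids these vertices.\<close>

lemma two_regular_cycle_decomposition:
  assumes "finite E" "\<And>e. e \<in> E \<Longrightarrow> card e = 2"
    and "\<And>v. v \<in> \<Union>E \<Longrightarrow> card {e \<in> E. v \<in> e} = 2"
  shows "\<exists>Q. finite Q \<and> (\<forall>q\<in>Q. distinct q \<and> 3 \<le> length q)
    \<and> pairwise (\<lambda>p q. set p \<inter> set q = {}) Q \<and> (\<Union>q\<in>Q. set q) = \<Union>E \<and> (\<Union>q\<in>Q. cyc_edges q) = E"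
  using assms
proof (induction "card E" arbitrary: E rule: less_induct)
  case less
  show ?case
  proof (cases "E = {}")
    case True
    then show ?thesis by (intro exI[of _ "{}"]) auto
  next
    case False
    obtain q where q: "distinct q" "3 \<le> length q" "cyc_edges q \<subseteq> E"
      using ex_cycle_if_min_degree_2[OF less.prems(1) False less.prems(2)] less.prems(3)
      by (metis order_refl)
    define E' where "E' = E - cyc_edges q"
    have setq: "set q = \<Union>(cyc_edges q)"
      using dcyc_ex_succ[of _ q] by (force simp: cyc_edges_def dest: dcyc_in_set)
    have at: "{e \<in> E. v \<in> e} = {e \<in> cyc_edges q. v \<in> e}" if "v \<in> set q" for v
    proof (rule sym, rule card_seteq)
      have "v \<in> \<Union>E" using setq that q(3) by auto
      then show "card {e \<in> E. v \<in> e} \<le> card {e \<in> cyc_edges q. v \<in> e}"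
        using card_cyc_edges_at[OF q(1,2) that] less.prems(3) by simp
    qed (use q(3) less.prems(1) in auto)
    have E'v: "v \<notin> set q" if "v \<in> \<Union>E'" for v
      using at that unfolding E'_def by blast
    have "card E' < card E"
    proof (rule psubset_card_mono)
      have "cyc_edges q \<noteq> {}" using q(2) setq by (cases q) auto
      then show "E' \<subset> E" using q(3) by (auto simp: E'_def)
    qed (use less.prems in auto)
    moreover have "card {e \<in> E'. v \<in> e} = 2" if "v \<in> \<Union>E'" for v
    proof -
      have "{e \<in> E'. v \<in> e} = {e \<in> E. v \<in> e}"
        using E'v[OF that] cyc_edges_subset unfolding E'_def by blast
      then show ?thesis using less.prems(3) that by (auto simp: E'_def)
    qed
    ultimately obtain Q where Q: "finite Q" "\<forall>q\<in>Q. distinct q \<and> 3 \<le> length q"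
        "pairwise (\<lambda>p q. set p \<inter> set q = {}) Q" "(\<Union>q\<in>Q. set q) = \<Union>E'"
        "(\<Union>q\<in>Q. cyc_edges q) = E'"
      using less.hyps[of E'] less.prems by (auto simp: E'_def)
    have disj: "set p \<inter> set q = {}" if "p \<in> Q" for p
      using Q(4) E'v that by blast
    show ?thesis
    proof (intro exI[of _ "insert q Q"] conjI)
      show "pairwise (\<lambda>p q. set p \<inter> set q = {}) (insert q Q)"
        using Q(3) disj by (auto simp: pairwise_insert)
      show "(\<Union>q\<in>insert q Q. cyc_edges q) = E" using Q(5) q(3) by (auto simp: E'_def)
      have "\<Union>E = \<Union>E' \<union> set q" unfolding setq E'_def using q(3) by blast
      then show "(\<Union>q\<in>insert q Q. set q) = \<Union>E" using Q(4) by auto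
    qed (use Q q in auto)
  qed
qed

section \<open>Restoring edges of a tour\<close>

text \<open>The tour is kept as its successor map because tails and heads of removed edges are
  treated separately. \<open>s_conn\<close> says that this permutation is a single cycle, in the
  form in which it gets applied: a nonempty set that no tour edge leaves is everything.\<close>

locale directed_tour =
  fixes V :: "'a set" and s :: "'a \<Rightarrow> 'a" and c :: "'a set \<Rightarrow> real"
  assumes finite_V: "finite V" and card_V: "3 \<le> card V"
    and s_bij: "bij_betw s V V"
    and s_conn: "\<And>S. S \<subseteq> V \<Longrightarrow> S \<noteq> {} \<Longrightarrow> s ` S \<subseteq> S \<Longrightarrow> S = V"
    and tri: "\<And>u v w. u \<in> V \<Longrightarrow> v \<in> V \<Longrightarrow> w \<in> V \<Longrightarrow> u \<noteq> v \<Longrightarrow> v \<noteq> w \<Longrightarrow> u \<noteq> w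
      \<Longrightarrow> c {u, w} \<le> c {u, v} + c {v, w}"
begin

lemma s_in [simp]: "x \<in> V \<Longrightarrow> s x \<in> V"
  using s_bij by (auto simp: bij_betw_def)

lemma s_inj: "x \<in> V \<Longrightarrow> y \<in> V \<Longrightarrow> s x = s y \<Longrightarrow> x = y"
  using s_bij by (auto simp: bij_betw_def inj_on_def)

lemma s_surj: "x \<in> V \<Longrightarrow> \<exists>y\<in>V. x = s y"
  using s_bij by (auto simp: bij_betw_def)

lemma s_s_neq: assumes "x \<in> V" shows "s (s x) \<noteq> x"
proof
  assume "s (s x) = x"
  then have "{x, s x} = V" using assms by (intro s_conn) auto
  moreover have "card {x, s x} \<le> 2" by (simp add: card_insert_le_m1)
  ultimately show False using card_V by simp
qed

lemma s_neq: assumes "x \<in> V" shows "s x \<noteq> x"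
  using s_s_neq[OF assms] by auto

definition tedges :: "'a set \<Rightarrow> 'a set set" where
  "tedges X = (\<lambda>x. {x, s x}) ` X"

lemma inj_on_tedge: "inj_on (\<lambda>x. {x, s x}) V"
proof (rule inj_onI)
  fix x y assume "x \<in> V" "y \<in> V" "{x, s x} = {y, s y}"
  then show "x = y" using s_s_neq[of x] by (auto simp: doubleton_eq_iff)
qed

text \<open>Compares \<open>uv\<close> with the walk \<open>u, a, b, v\<close>. Hence exchanging
  \<open>au, bv\<close> for \<open>ab, uv\<close> raises the cost by at most
  \<open>2 * c {a, b}\<close>.\<close>

lemma tri4:
  assumes "a \<in> V" "b \<in> V" "u \<in> V" "v \<in> V" "distinct [a, b, u, v]"
  shows "c {u, v} \<le> c {a, u} + c {a, b} + c {b, v}"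
  using tri[of u a v] tri[of a b v] assms by (auto simp: insert_commute)

text \<open>The edges with tails in \<open>D0\<close> have been removed and their tails and heads paired up
  separately; those with tails in \<open>D\<close> are still missing. The third condition from the end counts
  tail--tail edges. A restoring step destroys at most one of them, and one such edge suffices to
  continue when a single cycle is left.\<close>

definition repair :: "'a set \<Rightarrow> nat \<Rightarrow> real \<Rightarrow> 'a set \<Rightarrow> 'a list set \<Rightarrow> bool" where
  "repair D0 h K D Q \<longleftrightarrow> D \<subseteq> D0 \<and> D0 \<subseteq> V \<and> D0 \<inter> s ` D0 = {} \<and>
     finite Q \<and> (\<forall>q\<in>Q. distinct q \<and> 3 \<le> length q) \<and>
     pairwise (\<lambda>p q. set p \<inter> set q = {}) Q \<and> (\<Union>q\<in>Q. set q) = V \<and>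
     tedges (V - D) \<subseteq> (\<Union>q\<in>Q. cyc_edges q) \<and>
     card D \<le> card {e \<in> (\<Union>q\<in>Q. cyc_edges q). e \<subseteq> D} + h \<and>
     card Q + h \<le> card D \<and>
     (\<Sum>q\<in>Q. ccost c q) \<le> K + 2 * (\<Sum>x\<in>D0 - D. c {x, s x})"

lemma repair_s_notin: "repair D0 h K D Q \<Longrightarrow> x \<in> D \<Longrightarrow> s x \<notin> D"
  unfolding repair_def by blast

lemma repair_cycle:
  "repair D0 h K D Q \<Longrightarrow> q \<in> Q \<Longrightarrow> distinct q \<and> 3 \<le> length q \<and> set q \<noteq> {} \<and> set q \<subseteq> V"
  unfolding repair_def by fastforce

lemma repair_tedge:
  "repair D0 h K D Q \<Longrightarrow> y \<in> V \<Longrightarrow> y \<notin> D \<Longrightarrow> {y, s y} \<in> (\<Union>q\<in>Q. cyc_edges q)"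
  unfolding repair_def tedges_def by blast

text \<open>The bookkeeping shared by merging two cycles and by changing a single one.
  \<open>A\<close> and \<open>B\<close> are the paths left when \<open>au\<close> and
  \<open>bv\<close> are deleted, and \<open>R\<close> consists of the untouched cycles. The two
  alternatives for \<open>u\<close> and \<open>v\<close> are those of a merge and of a 2-opt move;
  \<open>u \<noteq> p\<close> and \<open>v \<noteq> s b\<close> protect the tour edges at
  \<open>a\<close> and \<open>b\<close>.\<close>

lemma repair_step:
  assumes rep: "repair D0 h K D Q" and a: "a \<in> D" and b: "b = s a" and p: "p \<in> V" "s p = a"
    and R: "R \<subseteq> Q" "card (insert (A @ B) R) + h < card D"
    and setAB: "set A \<union> set B = (\<Union>q\<in>Q-R. set q)" "distinct (A @ B)" "3 \<le> length (A @ B)"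
    and A: "A \<noteq> []" "last A = a" and B: "B \<noteq> []" "hd B = b"
    and uv: "(u = hd A \<and> v = last B) \<or> (u = last B \<and> v = hd A)"
    and dist: "distinct [a, b, u, v]" "u \<noteq> p" "v \<noteq> s b"
    and edges: "(\<Union>q\<in>Q-R. cyc_edges q) = path_edges A \<union> path_edges B \<union> {{a, u}, {b, v}}"
    and costs: "(\<Sum>q\<in>Q-R. ccost c q) = pcost c A + pcost c B + c {a, u} + c {b, v}"
    and at_a: "\<And>e. e \<in> (\<Union>q\<in>Q. cyc_edges q) \<Longrightarrow> a \<in> e \<Longrightarrow> e = {a, u} \<or> e = {p, a}"
  shows "repair D0 h K (D - {a}) (insert (A @ B) R)"
proof -
  let ?E = "\<Union>q\<in>Q. cyc_edges q" and ?E' = "\<Union>q\<in>insert (A @ B) R. cyc_edges q"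
  note r = rep[unfolded repair_def]
  have finD: "finite D" using r finite_V by (meson finite_subset)
  have aV: "a \<in> V" using r a by blast
  then have bV: "b \<in> V" using b by simp
  note aV = aV bV
  have uvV: "u \<in> V" "v \<in> V"
  proof -
    have "u \<in> set A \<union> set B" "v \<in> set A \<union> set B" using uv A B by auto
    then show "u \<in> V" "v \<in> V" using setAB(1) r by auto
  qed
  have finQ: "finite Q" using r by simp
  then have finR: "finite R" using R by (meson finite_subset)
  have disjR: "set q \<inter> (set A \<union> set B) = {}" if "q \<in> R" for q
  proof -
    have "set q \<inter> set q' = {}" if "q' \<in> Q - R" for q'
    proof -
      have "q \<noteq> q'" "q \<in> Q" "q' \<in> Q" using that \<open>q \<in> R\<close> R by auto
      moreover have "pairwise (\<lambda>p q. set p \<inter> set q = {}) Q" using r by simp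
      ultimately show ?thesis by (auto simp: pairwise_def)
    qed
    then show ?thesis using setAB(1) by blast
  qed
  have new_notin: "A @ B \<notin> R" using disjR A by fastforce
  have Esplit: "?E = (\<Union>q\<in>R. cyc_edges q) \<union> path_edges A \<union> path_edges B \<union> {{a, u}, {b, v}}"
    using edges R(1) by blast
  have E'split: "?E' = (\<Union>q\<in>R. cyc_edges q) \<union> path_edges A \<union> path_edges B \<union> {{a, b}, {u, v}}"
    using cyc_edges_append[OF A(1) B(1)] A B uv by (auto simp: insert_commute)
  have E': "?E - {{a, u}, {b, v}} \<subseteq> ?E'" "{a, b} \<in> ?E'"
    unfolding Esplit E'split by auto
  have bD: "b \<notin> D" using repair_s_notin[OF rep a] b by simp
  have pD: "p \<notin> D" using repair_s_notin[OF rep] a p by blast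
  have "tedges (V - (D - {a})) \<subseteq> ?E'"
  proof
    fix e assume "e \<in> tedges (V - (D - {a}))"
    then obtain y where y: "y \<in> V" "y \<notin> D \<or> y = a" "e = {y, s y}" by (auto simp: tedges_def)
    show "e \<in> ?E'"
    proof (cases "y = a")
      case True
      then show ?thesis using E'(2) y b by simp
    next
      case False
      then have "e \<in> ?E" using repair_tedge[OF rep] y by blast
      moreover have "e \<noteq> {a, u}"
      proof
        assume "e = {a, u}"
        then have "y = u \<and> s y = a" using y False by (auto simp: doubleton_eq_iff)
        then show False using s_inj p y(1) dist(2) by metis
      qed
      moreover have "e \<noteq> {b, v}"
      proof
        assume "e = {b, v}"
        then have "(y = b \<and> s y = v) \<or> (y = v \<and> s y = b)" using y by (auto simp: doubleton_eq_iff)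
        then show False using s_inj[of y a] False b y(1) dist(3) aV by metis
      qed
      ultimately show ?thesis using E'(1) by blast
    qed
  qed
  moreover have "card (D - {a}) \<le> card {e \<in> ?E'. e \<subseteq> D - {a}} + h"
  proof -
    have fin: "finite ?E'" using finR by auto
    \<comment> \<open>An edge inside \<open>D\<close> through \<open>a\<close> can only be
      \<open>au\<close>, since the other edge at \<open>a\<close> goes to \<open>p\<close>, which is
      not in \<open>D\<close>. The deleted edge \<open>bv\<close> never counted, because
      \<open>b\<close> is not in \<open>D\<close>.\<close>
    have "{e \<in> ?E. e \<subseteq> D} - {{a, u}} \<subseteq> {e \<in> ?E'. e \<subseteq> D - {a}}"
    proof
      fix e assume e: "e \<in> {e \<in> ?E. e \<subseteq> D} - {{a, u}}"
      then have "a \<notin> e" using at_a[of e] pD by blast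
      moreover have "e \<noteq> {b, v}" using e bD by blast
      ultimately show "e \<in> {e \<in> ?E'. e \<subseteq> D - {a}}" using e E'(1) by blast
    qed
    then have "card ({e \<in> ?E. e \<subseteq> D} - {{a, u}}) \<le> card {e \<in> ?E'. e \<subseteq> D - {a}}"
    proof (rule card_mono[rotated])
      show "finite {e \<in> ?E'. e \<subseteq> D - {a}}" by (rule finite_subset[OF _ fin]) blast
    qed
    moreover have "card {e \<in> ?E. e \<subseteq> D} - 1 \<le> card ({e \<in> ?E. e \<subseteq> D} - {{a, u}})"
      by (simp only: card_Diff_singleton_if) simp
    moreover have "card D \<le> card {e \<in> ?E. e \<subseteq> D} + h" using r by blast
    moreover have "card (D - {a}) = card D - 1" using a by (simp add: card_Diff_singleton)
    ultimately show ?thesis by linarith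
  qed
  moreover have "(\<Sum>q\<in>insert (A @ B) R. ccost c q) \<le> K + 2 * (\<Sum>x\<in>D0 - (D - {a}). c {x, s x})"
  proof -
    have "(\<Sum>q\<in>insert (A @ B) R. ccost c q) = ccost c (A @ B) + (\<Sum>q\<in>R. ccost c q)"
      using finR new_notin by simp
    also have "ccost c (A @ B) = pcost c A + pcost c B + c {a, b} + c {u, v}"
      using ccost_append[OF A(1) B(1)] A B uv by (auto simp: insert_commute)
    also have "\<dots> \<le> pcost c A + pcost c B + c {a, u} + c {b, v} + 2 * c {a, b}"
      using tri4[OF aV uvV dist(1)] by simp
    also have "\<dots> = (\<Sum>q\<in>Q-R. ccost c q) + 2 * c {a, b}" using costs by simp
    finally have "(\<Sum>q\<in>insert (A @ B) R. ccost c q) \<le>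
        (\<Sum>q\<in>Q-R. ccost c q) + (\<Sum>q\<in>R. ccost c q) + 2 * c {a, b}" by simp
    also have "(\<Sum>q\<in>Q-R. ccost c q) + (\<Sum>q\<in>R. ccost c q) = (\<Sum>q\<in>Q. ccost c q)"
      using finQ R(1) by (simp add: sum.subset_diff[of R Q])
    also have "\<dots> \<le> K + 2 * (\<Sum>x\<in>D0 - D. c {x, s x})" using r by simp
    also have "D0 - (D - {a}) = insert a (D0 - D)" using r a by auto
    moreover have "finite (D0 - D)" using r finite_V by (meson finite_Diff finite_subset)
    ultimately show ?thesis using a b by simp
  qed
  moreover have "pairwise (\<lambda>p q. set p \<inter> set q = {}) (insert (A @ B) R)"
    using r R(1) disjR pairwise_subset[of _ Q R] by (auto simp: pairwise_insert)
  moreover have "(\<Union>q\<in>insert (A @ B) R. set q) = V"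
  proof -
    have "(\<Union>q\<in>insert (A @ B) R. set q) = (\<Union>q\<in>Q-R. set q) \<union> (\<Union>q\<in>R. set q)"
      using setAB(1) by auto
    also have "\<dots> = (\<Union>q\<in>Q. set q)" using R(1) by blast
    finally show ?thesis using r by simp
  qed
  moreover have "card (insert (A @ B) R) + h \<le> card (D - {a})"
    using R(2) a finD by (simp add: card_Diff_singleton)
  ultimately show ?thesis
    unfolding repair_def using r R(1) setAB finR by auto
qed

text \<open>Both cycles are opened, at \<open>a\<close> and at \<open>s a\<close>, and joined by the
  tour edge and one further edge. One of the two edges at \<open>a\<close> is the tour edge from its
  predecessor, present because that vertex is not in \<open>D\<close>; the other one can be given
  up, and likewise at \<open>s a\<close>. \<open>Q\<close> and \<open>D\<close> each lose one
  element.\<close>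

lemma repair_merge:
  assumes rep: "repair D0 h K D Q" and a: "a \<in> D" and q: "q1 \<in> Q" "q2 \<in> Q" "q1 \<noteq> q2"
    "a \<in> set q1" "s a \<in> set q2"
  shows "\<exists>Q'. repair D0 h K (D - {a}) Q'"
proof -
  let ?b = "s a"
  note r = rep[unfolded repair_def]
  have aV: "a \<in> V" using r a by auto
  then obtain p where p: "p \<in> V" "s p = a" using s_surj by metis
  have disj: "set q \<inter> set q' = {}" if "q \<in> Q" "q' \<in> Q" "q \<noteq> q'" for q q'
    using r that by (auto simp: pairwise_def)
  have dq: "distinct q1" "3 \<le> length q1" "distinct q2" "3 \<le> length q2" using r q by auto
  have in_cyc: "{y, s y} \<in> cyc_edges q" if "y \<in> V - D" "q \<in> Q" "y \<in> set q \<or> s y \<in> set q" for y q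
  proof -
    obtain q' where q': "q' \<in> Q" "{y, s y} \<in> cyc_edges q'"
      using repair_tedge[OF rep] \<open>y \<in> V - D\<close> by blast
    then have "y \<in> set q'" "s y \<in> set q'" using cyc_edges_subset by fastforce+
    then have "q' = q" using disj[OF q'(1) \<open>q \<in> Q\<close>] that(3) by blast
    then show ?thesis using q' by simp
  qed
  have pD: "p \<notin> D" and bD: "?b \<notin> D" using repair_s_notin[OF rep] a p by blast+
  have pa: "{p, a} \<in> cyc_edges q1" using in_cyc[of p q1] p pD q by auto
  have bb: "{?b, s ?b} \<in> cyc_edges q2" using in_cyc[of ?b q2] aV bD q by auto
  obtain w where w: "w \<in> V" "w \<noteq> p" "{a, w} \<in> cyc_edges q1"
  proof -
    obtain x y where xy: "(x, a) \<in> dcyc q1" "(a, y) \<in> dcyc q1"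
      using q(4) dcyc_ex_succ dcyc_ex_pred by metis
    have "x \<noteq> y" using xy dcyc_asym[OF dq(1,2)] by blast
    have "x \<in> V" "y \<in> V" using xy[THEN dcyc_in_set] repair_cycle[OF rep q(1)] by blast+
    moreover have "{a, x} \<in> cyc_edges q1" "{a, y} \<in> cyc_edges q1"
      using xy unfolding cyc_edges_def by (force simp: insert_commute)+
    ultimately show ?thesis using that[of x] that[of y] \<open>x \<noteq> y\<close> by (cases "x = p") auto
  qed
  obtain z where z: "z \<in> V" "z \<noteq> s ?b" "{?b, z} \<in> cyc_edges q2"
  proof -
    obtain x y where xy: "(x, ?b) \<in> dcyc q2" "(?b, y) \<in> dcyc q2"
      using q(5) dcyc_ex_succ dcyc_ex_pred by metis
    have "x \<noteq> y" using xy dcyc_asym[OF dq(3,4)] by blast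
    have "x \<in> V" "y \<in> V" using xy[THEN dcyc_in_set] repair_cycle[OF rep q(2)] by blast+
    moreover have "{?b, x} \<in> cyc_edges q2" "{?b, y} \<in> cyc_edges q2"
      using xy unfolding cyc_edges_def by (force simp: insert_commute)+
    ultimately show ?thesis using that[of x] that[of y] \<open>x \<noteq> y\<close> by (cases "x = s ?b") auto
  qed
  obtain A where A: "distinct A" "set A = set q1" "length A = length q1" "cyc_edges A = cyc_edges q1"
      "\<And>c. ccost c A = ccost c q1" "last A = a" "hd A = w" "A \<noteq> []"
    using cycle_cut_edge[OF w(3) dq(1)] by metis
  have "{z, ?b} \<in> cyc_edges q2" using z by (simp add: insert_commute)
  then obtain B where B: "distinct B" "set B = set q2" "length B = length q2" "cyc_edges B = cyc_edges q2"
      "\<And>c. ccost c B = ccost c q2" "last B = z" "hd B = ?b" "B \<noteq> []"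
    using cycle_cut_edge[OF _ dq(3)] by metis
  have dAB: "set A \<inter> set B = {}" using disj q A B by auto
  have "repair D0 h K (D - {a}) (insert (A @ B) (Q - {q1, q2}))"
  proof (rule repair_step[OF rep a refl p, where u = w and v = z])
    have QQ: "Q - (Q - {q1, q2}) = {q1, q2}" using q by auto
    show "card (insert (A @ B) (Q - {q1, q2})) + h < card D"
    proof -
      have "card (Q - {q1, q2}) = card Q - 2" using q r by (simp add: card_Diff_subset)
      moreover have "card {q1, q2} \<le> card Q" using q r by (intro card_mono) auto
      moreover have "card (insert (A @ B) (Q - {q1, q2})) \<le> Suc (card (Q - {q1, q2}))"
        using r by (simp add: card_insert_le_m1 card_insert_if)
      moreover have "card Q + h \<le> card D" using r by blast
      ultimately show ?thesis using q(3) by simp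
    qed
    show "set A \<union> set B = (\<Union>q\<in>Q - (Q - {q1, q2}). set q)" unfolding QQ using A B by auto
    show "(\<Union>q\<in>Q - (Q - {q1, q2}). cyc_edges q) = path_edges A \<union> path_edges B \<union> {{a, w}, {?b, z}}"
      unfolding QQ using A B cyc_edges_cut[of A] cyc_edges_cut[of B] by (auto simp: insert_commute)
    show "(\<Sum>q\<in>Q - (Q - {q1, q2}). ccost c q) = pcost c A + pcost c B + c {a, w} + c {?b, z}"
    proof -
      have "(\<Sum>q\<in>{q1, q2}. ccost c q) = ccost c A + ccost c B" using q(3) A(5) B(5) by simp
      then show ?thesis unfolding QQ using A(6-7) B(6-7) by (simp add: ccost_def insert_commute)
    qed
    have in_sets: "a \<in> set A" "w \<in> set A" "?b \<in> set B" "z \<in> set B"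
      using A(6-8) B(6-8) hd_in_set[of B] by auto
    have "a \<noteq> w" using w(3) dq by (auto simp: cyc_edges_def dest: dcyc_neq)
    moreover have "?b \<noteq> z" using z(3) dq by (auto simp: cyc_edges_def dest: dcyc_neq)
    ultimately show "distinct [a, ?b, w, z]" using in_sets dAB by auto
    fix e assume e: "e \<in> (\<Union>q\<in>Q. cyc_edges q)" "a \<in> e"
    then obtain q' where q': "q' \<in> Q" "e \<in> cyc_edges q'" by auto
    then have "a \<in> set q'" using e(2) cyc_edges_subset by blast
    then have "q' = q1" using disj[OF q'(1) q(1)] q(4) by blast
    then have e1: "e \<in> {e \<in> cyc_edges q1. a \<in> e}" using q' e by auto
    have "{{a, w}, {p, a}} = {e \<in> cyc_edges q1. a \<in> e}"
    proof (rule card_seteq)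
      have "{a, w} \<noteq> {p, a}" using w by (auto simp: doubleton_eq_iff)
      then show "card {e \<in> cyc_edges q1. a \<in> e} \<le> card {{a, w}, {p, a}}"
        using card_cyc_edges_at[OF dq(1,2) q(4)] by simp
    qed (use w pa in auto)
    with e1 show "e = {a, w} \<or> e = {p, a}" by auto
  qed (use A B z w dAB dq in auto)
  then show ?thesis by blast
qed

text \<open>If the pieces at \<open>a\<close> and at \<open>s a\<close> are traversed in opposite directions, restoring the edge is a
  2-opt move and keeps the tour connected.\<close>

lemma repair_single_rotate:
  assumes rep: "repair D0 h K D {q}" and a: "a \<in> D" and h: "h + 2 \<le> card D"
    and p: "p \<in> V" "s p = a" and dir: "(p, a) \<in> dcyc q" "(s (s a), s a) \<in> dcyc q"
  shows "\<exists>Q'. repair D0 h K (D - {a}) Q'"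
proof -
  let ?b = "s a"
  note r = rep[unfolded repair_def]
  have aV: "a \<in> V" using r a by blast
  have dq: "distinct q" "3 \<le> length q" "set q = V" using r by auto
  have bq: "?b \<in> set q" using aV dq by simp
  obtain v where v: "(?b, v) \<in> dcyc q" using dcyc_ex_succ[OF bq] by blast
  obtain q' where q': "distinct q'" "set q' = set q" "length q' = length q" "dcyc q' = dcyc q"
      "\<And>c. ccost c q' = ccost c q" "last q' = ?b" "hd q' = v" "q' \<noteq> []"
    using cycle_cut[OF v dq(1)] by metis
  have ab: "a \<noteq> ?b" using s_neq aV by metis
  have "a \<in> set (butlast q')"
  proof -
    have "q' = butlast q' @ [?b]" using append_butlast_last_id[OF q'(8)] q'(6) by simp
    then have "set q' = insert ?b (set (butlast q'))" by (metis list.simps(15) rotate1.simps(2) set_rotate1)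
    then show ?thesis using q'(2) aV dq(3) ab by auto
  qed
  then obtain xs ys where "butlast q' = xs @ a # ys" using split_list by metis
  then have q'_eq: "q' = (xs @ [a]) @ (ys @ [?b])"
    using append_butlast_last_id[OF q'(8)] q'(6) by simp
  have asym: "(y, x) \<notin> dcyc q" if "(x, y) \<in> dcyc q" for x y using dcyc_asym[OF dq(1,2) that] .
  have pred: "y = y'" if "(y, x) \<in> dcyc q" "(y', x) \<in> dcyc q" for x y y'
    using dcyc_pred_unique[OF dq(1)] that by metis
  have dc: "dcyc q = {(a, hd (ys @ [?b])), (?b, hd (xs @ [a]))} \<union> dpath (xs @ [a]) \<union> dpath (ys @ [?b])"
    unfolding q'(4)[symmetric] q'_eq by (subst dcyc_append) auto
  have vhd: "v = hd (xs @ [a])" using q'(7) unfolding q'_eq by (cases xs) simp_all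
  have xs: "xs \<noteq> []"
  proof
    assume "xs = []"
    then have "(?b, a) \<in> dcyc q" using dc by simp
    moreover from this have "p = ?b" using pred dir(1) by blast
    ultimately show False using dir asym p by metis
  qed
  have ys: "ys \<noteq> []"
  proof
    assume "ys = []"
    then have "(a, ?b) \<in> dcyc q" using dc by simp
    moreover from this have "s ?b = a" using pred dir(2) by blast
    ultimately show False using s_s_neq aV by metis
  qed
  define u where "u = hd ys"
  have au: "(a, u) \<in> dcyc q" using dc ys by (simp add: u_def)
  \<comment> \<open>The cycle reads \<open>xs, a, ys, ?b\<close>, with \<open>u\<close> after
    \<open>a\<close> and \<open>v\<close> after \<open>?b\<close>. Reversing the second part makes
    \<open>a\<close> and \<open>?b\<close> adjacent and leaves \<open>u\<close> and \<open>v\<close>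
    to be joined.\<close>
  define A where "A = xs @ [a]"
  define B where "B = ?b # rev ys"
  have lastB: "last B = u" using ys by (simp add: B_def u_def last_rev)
  have pe: "cyc_edges q = path_edges A \<union> path_edges B \<union> {{a, u}, {?b, v}}"
  proof -
    have "cyc_edges q = cyc_edges q'" using q'(4) by (simp add: cyc_edges_def)
    also have "\<dots> = {{a, u}, {?b, v}} \<union> path_edges A \<union> path_edges (ys @ [?b])"
      unfolding q'_eq using cyc_edges_append[of A "ys @ [?b]"] ys vhd by (simp add: A_def u_def)
    also have "path_edges (ys @ [?b]) = path_edges B"
      using path_edges_rev[of B] by (simp add: B_def)
    finally show ?thesis by auto
  qed
  have cc: "ccost c q = pcost c A + pcost c B + c {a, u} + c {?b, v}"
  proof -
    have "ccost c q = ccost c q'" using q'(5) by simp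
    also have "\<dots> = pcost c A + pcost c (ys @ [?b]) + c {a, u} + c {?b, v}"
      unfolding q'_eq using ccost_append[of A "ys @ [?b]"] ys vhd by (simp add: A_def u_def)
    also have "pcost c (ys @ [?b]) = pcost c B"
      using pcost_rev[of c B] by (simp add: B_def)
    finally show ?thesis by simp
  qed
  have "repair D0 h K (D - {a}) (insert (A @ B) {})"
  proof (rule repair_step[OF rep a refl p, where u = u and v = v])
    have setq': "set q' = set A \<union> set B" unfolding q'_eq by (auto simp: A_def B_def)
    show "set A \<union> set B = (\<Union>q\<in>{q} - {}. set q)" using setq' q' by simp
    show "distinct (A @ B)" using q'(1) unfolding q'_eq by (auto simp: A_def B_def)
    have "length q' = length (A @ B)" unfolding q'_eq by (simp add: A_def B_def)
    then show "3 \<le> length (A @ B)" using q' dq by simp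
    have "u \<in> set ys" "v \<in> set xs" using ys xs vhd by (auto simp: u_def)
    then show "distinct [a, ?b, u, v]" using q'(1) unfolding q'_eq by auto
    show "u \<noteq> p" using au dir(1) asym by blast
    show "v \<noteq> s ?b" using v dir(2) asym by blast
    show "(u = hd A \<and> v = last B) \<or> (u = last B \<and> v = hd A)" using lastB vhd by (simp add: A_def)
    fix e assume "e \<in> (\<Union>q\<in>{q}. cyc_edges q)" "a \<in> e"
    then have "e \<in> {e \<in> cyc_edges q. a \<in> e}" by simp
    then show "e = {a, u} \<or> e = {p, a}" using cyc_edges_at[OF dq(1) dir(1) au] by auto
  qed (use h pe cc in \<open>auto simp: A_def B_def\<close>)
  then show ?thesis by blast
qed

text \<open>If no 2-opt move is possible, \<open>q\<close> passes the pieces at \<open>a\<close> and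
  at \<open>s a\<close> in the same direction for every \<open>a \<in> D\<close>. As
  \<open>s\<close> is a single cycle, \<open>q\<close> then follows all remaining tour edges in one
  direction. But the count guarantees a tail--tail edge, and there \<open>q\<close> arrives along a
  tour edge into one tail and departs against a tour edge into the other.\<close>

lemma repair_single:
  assumes rep: "repair D0 h K D {q}" and h: "h + 2 \<le> card D"
  shows "\<exists>a\<in>D. \<exists>Q'. repair D0 h K (D - {a}) Q'"
proof (rule ccontr)
  assume not: "\<not> ?thesis"
  note r = rep[unfolded repair_def]
  have dq: "distinct q" "3 \<le> length q" "set q = V" using r by auto
  let ?R = "dcyc q"
  \<comment> \<open>The reversed cycle serves the case that the tour edge into \<open>a\<close> is
    passed backwards.\<close>
  have rep_rev: "repair D0 h K D {rev q}"
    using rep by (simp add: repair_def cyc_edges_rev ccost_rev)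
  have DV: "D \<subseteq> V" using r by blast
  have Ds: "D \<inter> s ` D = {}" using repair_s_notin[OF rep] by blast
  have succ: "y = y'" if "(x, y) \<in> dcyc q" "(x, y') \<in> dcyc q" for x y y'
    using dcyc_succ_unique[OF dq(1)] that by metis
  have pred: "y = y'" if "(y, x) \<in> dcyc q" "(y', x) \<in> dcyc q" for x y y'
    using dcyc_pred_unique[OF dq(1)] that by metis
  have edge: "(y, s y) \<in> ?R \<or> (s y, y) \<in> ?R" if "y \<in> V" "y \<notin> D" for y
  proof -
    have "{y, s y} \<in> cyc_edges q" using repair_tedge[OF rep] that by blast
    then show ?thesis by (auto simp: cyc_edges_def doubleton_eq_iff)
  qed
  have nomix: "(p, s p) \<in> ?R \<longleftrightarrow> (s (s p), s (s (s p))) \<in> ?R" if "p \<in> V" "s p \<in> D" for p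
  proof (rule ccontr)
    let ?a = "s p" let ?b = "s ?a"
    assume neq: "\<not> ?thesis"
    have "p \<notin> D" "?b \<notin> D" using that Ds by auto
    then have "((p, ?a) \<in> ?R \<and> (s ?b, ?b) \<in> ?R) \<or> ((?a, p) \<in> ?R \<and> (?b, s ?b) \<in> ?R)"
      using edge[of p] edge[of ?b] that neq by auto
    then have "\<exists>Q'. repair D0 h K (D - {?a}) Q'"
    proof
      assume "(p, ?a) \<in> ?R \<and> (s ?b, ?b) \<in> ?R"
      then show ?thesis using repair_single_rotate[OF rep that(2) h that(1) refl] by blast
    next
      assume "(?a, p) \<in> ?R \<and> (?b, s ?b) \<in> ?R"
      then show ?thesis using repair_single_rotate[OF rep_rev that(2) h that(1) refl]
        by (simp add: dcyc_rev)
    qed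
    with not that show False by blast
  qed
  \<comment> \<open>Whether \<open>q\<close> follows the tour at \<open>y\<close> in the direction
    of \<open>s\<close>. For \<open>y \<in> D\<close> the edge leaving \<open>y\<close> is missing,
    so the edge entering it decides.\<close>
  define up where "up y \<longleftrightarrow> (if y \<in> D then (\<exists>p\<in>V. s p = y \<and> (p, y) \<in> ?R) else (y, s y) \<in> ?R)" for y
  have up_D: "up (s p) \<longleftrightarrow> (p, s p) \<in> ?R" if "p \<in> V" "s p \<in> D" for p
    using that s_inj by (auto simp: up_def)
  have up_s: "up (s y) \<longleftrightarrow> up y" if y: "y \<in> V" for y
  proof (cases "y \<in> D")
    case True
    obtain p where p: "p \<in> V" "s p = y" using s_surj y by metis
    have "s y \<notin> D" using Ds True by auto
    then have "up (s y) \<longleftrightarrow> (s y, s (s y)) \<in> ?R" by (simp add: up_def)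
    also have "\<dots> \<longleftrightarrow> (p, s p) \<in> ?R" using nomix[of p] p True by simp
    also have "\<dots> \<longleftrightarrow> up y" using up_D[of p] p True by simp
    finally show ?thesis .
  next
    case y_notin: False
    show ?thesis
    proof (cases "s y \<in> D")
      case True
      then show ?thesis using up_D[of y] y y_notin by (simp add: up_def)
    next
      case False
      have "(s y, s (s y)) \<in> ?R \<longleftrightarrow> (y, s y) \<in> ?R"
      proof
        assume a: "(s y, s (s y)) \<in> ?R"
        have "(s y, y) \<notin> ?R" using succ[OF a] s_s_neq[OF y] by blast
        then show "(y, s y) \<in> ?R" using edge y y_notin by blast
      next
        assume a: "(y, s y) \<in> ?R"
        have "(s (s y), s y) \<notin> ?R" using pred[OF a] s_s_neq[OF y] by metis
        then show "(s y, s (s y)) \<in> ?R" using edge[of "s y"] y False by auto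
      qed
      then show ?thesis using y_notin False by (simp add: up_def)
    qed
  qed
  have all_up: "{y \<in> V. up y} = {} \<or> {y \<in> V. up y} = V"
  proof (cases "{y \<in> V. up y} = {}")
    case False
    then have "{y \<in> V. up y} = V" by (intro s_conn) (auto simp: up_s)
    then show ?thesis by blast
  qed simp
  have "card D \<le> card {e \<in> cyc_edges q. e \<subseteq> D} + h" using r by simp
  then have "card {e \<in> cyc_edges q. e \<subseteq> D} \<noteq> 0" using h by linarith
  then have "{e \<in> cyc_edges q. e \<subseteq> D} \<noteq> {}" by (metis card.empty)
  then obtain e where e: "e \<in> cyc_edges q" "e \<subseteq> D" by blast
  then obtain a a' where aa: "(a, a') \<in> ?R" "a \<in> D" "a' \<in> D" by (auto simp: cyc_edges_def)
  from all_up show False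
  proof
    assume "{y \<in> V. up y} = V"
    then have "up a'" using aa DV by blast
    then obtain p where "p \<in> V" "s p = a'" "(p, a') \<in> ?R" using aa by (auto simp: up_def)
    then have "s a = a'" using pred[OF aa(1)] by blast
    then show False using aa Ds by blast
  next
    assume no: "{y \<in> V. up y} = {}"
    obtain p where p: "p \<in> V" "s p = a" using s_surj aa DV by blast
    then have "(p, a) \<notin> ?R" using up_D[of p] no aa DV by auto
    moreover have "p \<notin> D" using p Ds aa by auto
    ultimately have "(a, p) \<in> ?R" using edge[of p] p by auto
    then have "p = a'" using succ[OF aa(1)] by metis
    then show False using p aa Ds by blast
  qed
qed

text \<open>If there are several cycles, the vertex set of one of them cannot be closed under
  \<open>s\<close>. The tour edge that leaves it lies on no cycle, hence is missing, and restoring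
  it merges two cycles.\<close>

lemma repair_ex_step:
  assumes rep: "repair D0 h K D Q" and h: "h + 2 \<le> card D"
  shows "\<exists>a\<in>D. \<exists>Q'. repair D0 h K (D - {a}) Q'"
proof -
  note r = rep[unfolded repair_def]
  have Vne: "V \<noteq> {}" using card_V by auto
  then obtain q where q: "q \<in> Q" using r by blast
  show ?thesis
  proof (cases "Q = {q}")
    case True
    then show ?thesis using repair_single rep h by metis
  next
    case False
    then obtain q' where q': "q' \<in> Q" "q' \<noteq> q" using q by blast
    have disj: "set q \<inter> set q' = {}" if "q \<in> Q" "q' \<in> Q" "q \<noteq> q'" for q q'
      using r that by (auto simp: pairwise_def)
    have qV: "set q \<subseteq> V" using r q by blast
    have "\<not> s ` set q \<subseteq> set q"
    proof
      assume "s ` set q \<subseteq> set q"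
      moreover have "set q \<noteq> {}" using repair_cycle[OF rep q] by blast
      ultimately have "set q = V" using s_conn qV by blast
      moreover have "set q' \<noteq> {}" "set q' \<subseteq> V" using repair_cycle[OF rep q'(1)] by blast+
      ultimately show False using disj[OF q'(1) q q'(2)] by (metis inf.absorb1)
    qed
    then obtain y where y: "y \<in> set q" "s y \<notin> set q" by blast
    have "y \<in> D"
    proof (rule ccontr)
      assume "y \<notin> D"
      then have "{y, s y} \<in> (\<Union>q\<in>Q. cyc_edges q)" using repair_tedge[OF rep] y qV by blast
      then obtain q'' where "q'' \<in> Q" "{y, s y} \<in> cyc_edges q''" by blast
      moreover then have "y \<in> set q''" "s y \<in> set q''" using cyc_edges_subset by fastforce+
      ultimately show False using disj[of q q''] y q by blast
    qed
    moreover obtain q2 where "q2 \<in> Q" "s y \<in> set q2"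
    proof -
      have "s y \<in> V" using y qV by auto
      then show ?thesis using r that by blast
    qed
    ultimately show ?thesis using repair_merge[OF rep _ q] y by metis
  qed
qed

text \<open>At \<open>h + 1\<close> missing edges the condition
  \<open>card Q + h \<le> card D\<close> leaves room for one cycle only; as long as there are more,
  \<open>repair_ex_step\<close> applies.\<close>

lemma repair_complete:
  assumes "repair D0 h K D Q" and "h + 1 \<le> card D"
  shows "\<exists>D' q. card D' = h + 1 \<and> repair D0 h K D' {q}"
  using assms
proof (induction "card D" arbitrary: D Q rule: less_induct)
  case less
  note r = less.prems(1)[unfolded repair_def]
  have finD: "finite D" using r finite_V by (meson finite_subset)
  show ?case
  proof (cases "card D = h + 1")
    case True
    have "V \<noteq> {}" using card_V by auto
    then obtain q where q: "q \<in> Q" using r by blast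
    have "card Q \<le> 1" using r True by simp
    moreover have "finite Q" using r by simp
    ultimately have "Q = {q}" using q by (auto simp: card_le_Suc0_iff_eq)
    then show ?thesis using True less.prems by blast
  next
    case False
    then obtain a Q' where a: "a \<in> D" "repair D0 h K (D - {a}) Q'"
      using repair_ex_step less.prems by fastforce
    have "card (D - {a}) < card D" "h + 1 \<le> card (D - {a})"
      using a(1) finD False less.prems(2) by (auto simp: card_Diff_singleton)
    then show ?thesis using less.hyps a(2) by blast
  qed
qed

section \<open>The initial 2-factor and the resulting move\<close>

lemma card_paired:
  assumes "finite D" and m: "\<And>a. a \<in> D \<Longrightarrow> m a \<in> D \<and> m a \<noteq> a \<and> m (m a) = a"
    and f: "inj_on f D"
  shows "2 * card ((\<lambda>a. {f a, f (m a)}) ` D) = card D"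
proof -
  have "2 * card ((\<lambda>a. {f a, f (m a)}) ` D) = card (\<Union>((\<lambda>a. {f a, f (m a)}) ` D))"
  proof (rule card_partition)
    show "card e = 2" if e: "e \<in> (\<lambda>a. {f a, f (m a)}) ` D" for e
    proof -
      obtain a where a: "a \<in> D" "e = {f a, f (m a)}" using e by blast
      then have "f a \<noteq> f (m a)" using m[OF a(1)] f by (metis inj_onD)
      then show ?thesis using a by simp
    qed
    show "e \<inter> e' = {}"
      if ee: "e \<in> (\<lambda>a. {f a, f (m a)}) ` D" "e' \<in> (\<lambda>a. {f a, f (m a)}) ` D" "e \<noteq> e'" for e e'
    proof -
      obtain a where a: "a \<in> D" "e = {f a, f (m a)}" using ee(1) by blast
      obtain b where b: "b \<in> D" "e' = {f b, f (m b)}" using ee(2) by blast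
      note ab = a b
      have eq: "f x = f y \<longleftrightarrow> x = y" if "x \<in> D" "y \<in> D" for x y
        using f that by (metis inj_onD)
      show ?thesis
      proof (rule ccontr)
        assume "e \<inter> e' \<noteq> {}"
        then have "a = b \<or> a = m b \<or> m a = b \<or> m a = m b"
          using ab m[OF ab(1)] m[OF ab(3)] eq by auto
        then have "b = a \<or> b = m a" using m[OF ab(1)] m[OF ab(3)] by metis
        then show False using ee(3) ab m[OF ab(1)] by (auto simp: insert_commute)
      qed
    qed
  qed (use assms(1) in auto)
  also have "\<Union>((\<lambda>a. {f a, f (m a)}) ` D) = f ` D" using m by auto
  finally show ?thesis using f by (simp add: card_image)
qed

text \<open>Each vertex has one edge in place of its outgoing tour edge and one in place of its
  incoming one, so the graph is 2-regular. A cycle without a vertex of \<open>D0\<close> would be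
  closed under \<open>s\<close> and hence be everything. So each cycle contains a tail--tail edge,
  which bounds the number of cycles by \<open>h\<close>.\<close>

lemma repair_start:
  assumes D0: "D0 \<subseteq> V" "D0 \<noteq> {}" "D0 \<inter> s ` D0 = {}"
    and t: "\<And>a. a \<in> D0 \<Longrightarrow> t a \<in> D0 \<and> t a \<noteq> a \<and> t (t a) = a"
    and g: "\<And>a. a \<in> D0 \<Longrightarrow> g a \<in> D0 \<and> g a \<noteq> a \<and> g (g a) = a"
    and short: "\<And>a. a \<in> D0 \<Longrightarrow> c {a, t a} \<le> \<delta>" "\<And>a. a \<in> D0 \<Longrightarrow> c {s a, s (g a)} \<le> \<delta>"
  shows "\<exists>h Q. 1 \<le> h \<and> card D0 = 2 * h \<and>
    repair D0 h ((\<Sum>x\<in>V - D0. c {x, s x}) + 2 * real h * \<delta>) D0 Q"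
proof -
  have finD: "finite D0" using D0(1) finite_V by (rule finite_subset)
  have injs: "inj_on s V" using s_bij by (simp add: bij_betw_def)
  define TT where "TT = (\<lambda>a. {a, t a}) ` D0"
  define HH where "HH = (\<lambda>a. {s a, s (g a)}) ` D0"
  define E where "E = tedges (V - D0) \<union> TT \<union> HH"
  define h where "h = card TT"
  have cTT: "card D0 = 2 * h"
    using card_paired[OF finD t, of "\<lambda>x. x"] by (simp add: h_def TT_def)
  have cHH: "card HH = h"
    using card_paired[OF finD g, of s] inj_on_subset[OF injs D0(1)] cTT by (simp add: HH_def)
  have h1: "1 \<le> h" using cTT D0(2) finD by (cases h) auto
  have finE: "finite (tedges (V - D0))" "finite TT" "finite HH"
    using finite_V finD by (auto simp: tedges_def TT_def HH_def)
  have tD: "t a \<in> D0" "g a \<in> D0" if "a \<in> D0" for a using t[OF that] g[OF that] by simp_all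
  have dis: "tedges (V - D0) \<inter> TT = {}" "tedges (V - D0) \<inter> HH = {}" "TT \<inter> HH = {}"
  proof -
    have TTD: "e \<subseteq> D0" if "e \<in> TT" for e using that tD(1) by (auto simp: TT_def)
    have "\<not> {y, s y} \<subseteq> D0" if "y \<in> V - D0" for y using that by simp
    then show "tedges (V - D0) \<inter> TT = {}" using TTD unfolding tedges_def by blast
    have "\<not> {s a, s (g a)} \<subseteq> D0" if "a \<in> D0" for a using that D0(3) by blast
    then show "TT \<inter> HH = {}" using TTD unfolding HH_def by blast
    \<comment> \<open>One end of a common edge would be the head of a kept edge and of a removed
      one.\<close>
    show "tedges (V - D0) \<inter> HH = {}"
    proof (rule ccontr)
      assume "\<not> ?thesis"
      then obtain y a where ya: "y \<in> V" "y \<notin> D0" "a \<in> D0" "{y, s y} = {s a, s (g a)}"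
        by (auto simp: tedges_def HH_def)
      then have "s y = s a \<or> s y = s (g a)" by blast
      moreover have "a \<in> V" "g a \<in> V" "g a \<in> D0" using tD[OF ya(3)] ya(3) D0(1) by auto
      ultimately show False using ya s_inj by metis
    qed
  qed
  have sumE: "sum c E \<le> (\<Sum>x\<in>V - D0. c {x, s x}) + 2 * real h * \<delta>"
  proof -
    have "sum c E = sum c (tedges (V - D0)) + sum c TT + sum c HH"
      unfolding E_def using finE dis by (simp add: sum.union_disjoint Int_Un_distrib2)
    also have "sum c (tedges (V - D0)) = (\<Sum>x\<in>V - D0. c {x, s x})"
      unfolding tedges_def using inj_on_subset[OF inj_on_tedge, of "V - D0"] by (simp add: sum.reindex)
    also have "sum c TT \<le> real h * \<delta>"
      unfolding h_def using short(1) by (intro sum_bounded_above) (auto simp: TT_def)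
    also have "sum c HH \<le> real h * \<delta>"
      unfolding cHH[symmetric] using short(2) by (intro sum_bounded_above) (auto simp: HH_def)
    finally show ?thesis by (simp add: algebra_simps)
  qed
  have inV: "a \<in> V" "t a \<in> V" "g a \<in> V" if "a \<in> D0" for a
    using that tD[OF that] D0(1) by auto
  have UE: "\<Union>E = V"
  proof
    show "\<Union>E \<subseteq> V" using inV by (auto simp: E_def tedges_def TT_def HH_def)
    show "V \<subseteq> \<Union>E"
    proof
      fix y assume "y \<in> V"
      then show "y \<in> \<Union>E" by (cases "y \<in> D0") (auto simp: E_def tedges_def TT_def)
    qed
  qed
  have cardE: "card e = 2" if e: "e \<in> E" for e
  proof -
    have "\<exists>x y. x \<noteq> y \<and> e = {x, y}"
    proof -
      consider y where "y \<in> V" "e = {y, s y}" | a where "a \<in> D0" "e = {a, t a}"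
        | a where "a \<in> D0" "e = {s a, s (g a)}"
        using e by (auto simp: E_def tedges_def TT_def HH_def)
      then show ?thesis
      proof cases
        case 1 then show ?thesis using s_neq by metis
      next
        case 2 then show ?thesis using t by metis
      next
        case 3 then show ?thesis using g s_inj inV by metis
      qed
    qed
    then show ?thesis by auto
  qed
  have deg: "card {e \<in> E. v \<in> e} = 2" if v: "v \<in> V" for v
  proof -
    obtain y where y: "y \<in> V" "s y = v" using s_surj v by metis
    define out where "out = (if v \<in> D0 then {v, t v} else {v, s v})"
    define inn where "inn = (if y \<in> D0 then {v, s (g y)} else {y, v})"
    have "{e \<in> E. v \<in> e} \<subseteq> {out, inn}"
    proof
      fix e assume e: "e \<in> {e \<in> E. v \<in> e}"
      then consider z where "z \<in> V" "z \<notin> D0" "e = {z, s z}" | a where "a \<in> D0" "e = {a, t a}"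
        | a where "a \<in> D0" "e = {s a, s (g a)}"
        by (auto simp: E_def tedges_def TT_def HH_def)
      then show "e \<in> {out, inn}"
      proof cases
        case 1
        moreover have "v = z \<or> v = s z" using 1 e by blast
        ultimately have "z = v \<or> z = y" using y s_inj by metis
        then show ?thesis using 1 y by (auto simp: out_def inn_def)
      next
        case 2
        then have "v = a \<or> v = t a" using e by blast
        then show ?thesis using 2 t[of a] by (auto simp: out_def insert_commute)
      next
        case 3
        moreover have "v = s a \<or> v = s (g a)" using 3 e by blast
        ultimately have "y = a \<or> y = g a" using y s_inj inV by metis
        then show ?thesis using 3 g[of a] y by (auto simp: inn_def insert_commute)
      qed
    qed
    moreover have "out \<in> E" "inn \<in> E"
      using v y by (auto simp: out_def inn_def E_def tedges_def TT_def HH_def)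
    moreover have "v \<in> out" "v \<in> inn" by (auto simp: out_def inn_def)
    ultimately have "{e \<in> E. v \<in> e} = {out, inn}" by blast
    moreover have "out \<noteq> inn"
    proof (cases "v \<in> D0")
      case True
      then have "y \<notin> D0" using y D0(3) by blast
      then have "t v \<noteq> y" using t[OF True] by blast
      then show ?thesis using True \<open>y \<notin> D0\<close> t[OF True] by (auto simp: out_def inn_def doubleton_eq_iff)
    next
      case vn: False
      show ?thesis
      proof (cases "y \<in> D0")
        case True
        have "g y \<noteq> v" using vn g[OF True] by blast
        then have "s (g y) \<noteq> s v" using s_inj[OF inV(3)[OF True] v] by blast
        then show ?thesis using vn True s_neq[OF v] by (auto simp: out_def inn_def doubleton_eq_iff)
      next
        case False
        have "s v \<noteq> y" using s_s_neq[OF y(1)] y(2) by metis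
        then show ?thesis using vn False s_neq[OF v] by (auto simp: out_def inn_def doubleton_eq_iff)
      qed
    qed
    ultimately show ?thesis by simp
  qed
  obtain Q where Q: "finite Q" "\<forall>q\<in>Q. distinct q \<and> 3 \<le> length q"
      "pairwise (\<lambda>p q. set p \<inter> set q = {}) Q" "(\<Union>q\<in>Q. set q) = V" "(\<Union>q\<in>Q. cyc_edges q) = E"
  proof -
    have "finite E" using finE by (simp add: E_def)
    from two_regular_cycle_decomposition[OF this cardE, unfolded UE, OF _ deg]
    show ?thesis using that by blast
  qed
  have disj: "set q \<inter> set q' = {}" if "q \<in> Q" "q' \<in> Q" "q \<noteq> q'" for q q'
    using Q(3) that by (auto simp: pairwise_def)
  have ne: "e \<noteq> {}" if "e \<in> E" for e using cardE[OF that] by auto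
  have edisj: "cyc_edges q \<inter> cyc_edges q' = {}" if "q \<in> Q" "q' \<in> Q" "q \<noteq> q'" for q q'
  proof (rule ccontr)
    assume "\<not> ?thesis"
    then obtain e where e: "e \<in> cyc_edges q" "e \<in> cyc_edges q'" by blast
    then have "e \<noteq> {}" using ne that(1) Q(5) by blast
    then show False using disj[OF that] e cyc_edges_subset by blast
  qed
  have in_q: "e \<in> cyc_edges q" if "e \<in> E" "v \<in> e" "v \<in> set q" "q \<in> Q" for e v q
  proof -
    obtain q' where q': "q' \<in> Q" "e \<in> cyc_edges q'" using \<open>e \<in> E\<close> Q(5) by blast
    then have "v \<in> set q'" using \<open>v \<in> e\<close> cyc_edges_subset by blast
    then show ?thesis using disj[OF \<open>q \<in> Q\<close> q'(1)] that q' by blast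
  qed
  have "\<exists>e. e \<in> TT \<and> e \<in> cyc_edges q" if q: "q \<in> Q" for q
  proof -
    have "\<exists>y\<in>set q. y \<in> D0"
    proof (rule ccontr)
      assume no: "\<not> ?thesis"
      have "s ` set q \<subseteq> set q"
      proof
        fix z assume "z \<in> s ` set q"
        then obtain y where y: "y \<in> set q" "z = s y" by blast
        then have "{y, s y} \<in> E" using no q Q(4) by (auto simp: E_def tedges_def)
        then have "{y, s y} \<in> cyc_edges q" using in_q y q by blast
        then show "z \<in> set q" using cyc_edges_subset y by blast
      qed
      moreover have "set q \<noteq> {}" using q Q(2) by force
      ultimately have "set q = V" using s_conn q Q(4) by blast
      then show False using no D0 by blast
    qed
    then obtain y where y: "y \<in> set q" "y \<in> D0" by blast
    then have "{y, t y} \<in> TT" by (simp add: TT_def)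
    moreover from this have "{y, t y} \<in> cyc_edges q" using in_q y q by (auto simp: E_def)
    ultimately show ?thesis by blast
  qed
  then obtain f where f: "\<And>q. q \<in> Q \<Longrightarrow> f q \<in> TT \<and> f q \<in> cyc_edges q" by metis
  have cardQ: "card Q \<le> h"
    unfolding h_def
  proof (rule card_inj_on_le[of f])
    show "inj_on f Q"
    proof (rule inj_onI, rule ccontr)
      fix q q' assume "q \<in> Q" "q' \<in> Q" "f q = f q'" "q \<noteq> q'"
      then show False using f[of q] f[of q'] edisj[of q q'] by (metis IntI empty_iff)
    qed
  qed (use f finE in auto)
  have "h \<le> card {e \<in> E. e \<subseteq> D0}"
    unfolding h_def
  proof (rule card_mono)
    show "finite {e \<in> E. e \<subseteq> D0}" using finE by (simp add: E_def)
    show "TT \<subseteq> {e \<in> E. e \<subseteq> D0}" using tD by (auto simp: E_def TT_def)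
  qed
  moreover have "(\<Sum>q\<in>Q. ccost c q) = sum c E"
  proof -
    have "(\<Sum>q\<in>Q. ccost c q) = (\<Sum>q\<in>Q. sum c (cyc_edges q))"
      using Q(2) by (intro sum.cong) (auto simp: sum_cyc_edges)
    also have "\<dots> = sum c (\<Union>q\<in>Q. cyc_edges q)"
      using Q(1) edisj by (intro sum.UNION_disjoint[symmetric]) auto
    finally show ?thesis using Q(5) by simp
  qed
  moreover have "tedges (V - D0) \<subseteq> E" by (auto simp: E_def)
  ultimately have "repair D0 h ((\<Sum>x\<in>V - D0. c {x, s x}) + 2 * real h * \<delta>) D0 Q"
    unfolding repair_def Q(5) Q(4) using Q(1-3) D0 cTT cardQ sumE by simp
  then show ?thesis using h1 cTT by blast
qed

lemma ex_cheap_move: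
  assumes "D0 \<subseteq> V" "D0 \<noteq> {}" "D0 \<inter> s ` D0 = {}"
    and "\<And>a. a \<in> D0 \<Longrightarrow> t a \<in> D0 \<and> t a \<noteq> a \<and> t (t a) = a"
    and "\<And>a. a \<in> D0 \<Longrightarrow> g a \<in> D0 \<and> g a \<noteq> a \<and> g (g a) = a"
    and "\<And>a. a \<in> D0 \<Longrightarrow> c {a, t a} \<le> \<delta>" "\<And>a. a \<in> D0 \<Longrightarrow> c {s a, s (g a)} \<le> \<delta>"
  obtains h D q where "1 \<le> h" "card D0 = 2 * h" "D \<subseteq> D0" "card D = h + 1"
    "distinct q" "set q = V" "tedges (V - D) \<subseteq> cyc_edges q"
    "ccost c q \<le> (\<Sum>x\<in>V - D0. c {x, s x}) + 2 * real h * \<delta> + 2 * (\<Sum>x\<in>D0 - D. c {x, s x})"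
proof -
  obtain h Q where h: "1 \<le> h" "card D0 = 2 * h"
      "repair D0 h ((\<Sum>x\<in>V - D0. c {x, s x}) + 2 * real h * \<delta>) D0 Q"
    using repair_start[OF assms] by blast
  then obtain D q where "card D = h + 1"
      "repair D0 h ((\<Sum>x\<in>V - D0. c {x, s x}) + 2 * real h * \<delta>) D {q}"
    using repair_complete[OF h(3)] by auto
  then show ?thesis using that[OF h(1,2), of D q] by (auto simp: repair_def)
qed

end

section \<open>The upper bound\<close>

lemma has_cycle_len_iff:
  "has_cycle_len E m \<longleftrightarrow> 3 \<le> m \<and> (\<exists>vs. distinct vs \<and> length vs = m \<and> cyc_edges vs \<subseteq> E)"
  unfolding has_cycle_len_def cyc_edges_conv by (auto simp: subset_iff)

lemma is_tour_iff:
  "is_tour n T \<longleftrightarrow> 3 \<le> n \<and> (\<exists>p. distinct p \<and> set p = {..<n} \<and> T = cyc_edges p)"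
proof -
  have "length p = n" if "distinct p" "set p = {..<n}" for p :: "nat list"
    using distinct_card[OF that(1)] that(2) by simp
  then have "cyc_edges p = {{p ! i, p ! ((i + 1) mod n)} | i. i < n}"
    if "distinct p" "set p = {..<n}" for p :: "nat list"
    using that by (simp add: cyc_edges_conv)
  then show ?thesis unfolding is_tour_def by auto
qed

lemma finite_tours: "finite {T. is_tour n T}"
proof (rule finite_subset)
  show "{T. is_tour n T} \<subseteq> cyc_edges ` {p. set p \<subseteq> {..<n} \<and> length p = n}"
    using distinct_card unfolding is_tour_iff by fastforce
qed (simp add: finite_lists_length_eq)

lemma finite_Kedges: "finite (Kedges n)"
  by (rule finite_subset[of _ "Pow {..<n}"]) (auto simp: Kedges_def)

lemma Kedges_card: "e \<in> Kedges n \<Longrightarrow> card e = 2"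
  by (auto simp: Kedges_def)

lemma finite_ex_set: "finite {card E | E. E \<subseteq> Kedges n \<and> girth_ge E g}"
proof (rule finite_subset)
  show "{card E | E. E \<subseteq> Kedges n \<and> girth_ge E g} \<subseteq> card ` Pow (Kedges n)" by auto
qed (simp add: finite_Kedges)

lemma ex_ge: "E \<subseteq> Kedges n \<Longrightarrow> girth_ge E g \<Longrightarrow> card E \<le> ex n g"
  unfolding ex_def by (rule Max_ge[OF finite_ex_set]) blast

lemma ex_attained: "\<exists>E. E \<subseteq> Kedges n \<and> girth_ge E g \<and> card E = ex n g"
proof -
  have "girth_ge {} g"
  proof -
    have "cyc_edges vs \<noteq> {}" if "3 \<le> length vs" for vs :: "nat list"
      using that cyc_edges_cut[of vs] by (cases vs) auto
    then show ?thesis by (auto simp: girth_ge_def has_cycle_len_iff)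
  qed
  then have "{card E | E. E \<subseteq> Kedges n \<and> girth_ge E g} \<noteq> {}" by blast
  from Max_in[OF finite_ex_set this] show ?thesis unfolding ex_def by auto
qed

text \<open>A star has no cycle. This weak bound is enough to make \<open>term_k k l\<close> grow at
  least like \<open>rk k ^ l\<close>, so that \<open>lstar\<close> is attained and
  logarithmic.\<close>

lemma ex_ge_star: "N - 1 \<le> ex N g"
proof -
  let ?E = "(\<lambda>i. {0, i}) ` {1..<N}"
  have "inj_on (\<lambda>i. {0, i}) {1..<N}" by (auto simp: inj_on_def doubleton_eq_iff)
  then have "card ?E = N - 1" by (simp add: card_image)
  moreover have "?E \<subseteq> Kedges N"
  proof
    fix e assume "e \<in> ?E"
    then obtain i where "1 \<le> i" "i < N" "e = {0, i}" by auto
    then show "e \<in> Kedges N" unfolding Kedges_def by (intro CollectI exI[of _ 0] exI[of _ i]) auto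
  qed
  moreover have "girth_ge ?E g"
  proof -
    have False if vs: "distinct vs" "3 \<le> length vs" "cyc_edges vs \<subseteq> ?E" for vs
    proof -
      have "v = 0" if "v \<in> set vs" for v
      proof (rule ccontr)
        assume "v \<noteq> 0"
        then have "{e \<in> cyc_edges vs. v \<in> e} \<subseteq> {{0, v}}" using vs(3) by auto
        then have "card {e \<in> cyc_edges vs. v \<in> e} \<le> card {{0, v}}" by (intro card_mono) auto
        then show False using card_cyc_edges_at[OF vs(1,2) that] by simp
      qed
      then have "card (set vs) \<le> card {0::nat}" by (intro card_mono) auto
      then show False using vs by (simp add: distinct_card)
    qed
    then show ?thesis by (auto simp: girth_ge_def has_cycle_len_iff)
  qed
  ultimately show ?thesis using ex_ge[of ?E N g] by simp
qed

section \<open>Pairings, directed cuts and clusters\<close>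

lemma ex_partner:
  assumes "\<And>a. a \<in> D \<Longrightarrow> card {b \<in> D. f b = f a} = 2"
  shows "\<exists>t. \<forall>a\<in>D. t a \<in> D \<and> t a \<noteq> a \<and> t (t a) = a \<and> f (t a) = f a"
proof -
  have "\<exists>b. {x \<in> D. f x = f a} = {a, b} \<and> b \<noteq> a" if a: "a \<in> D" for a
  proof -
    obtain x y where xy: "{x \<in> D. f x = f a} = {x, y}" "x \<noteq> y"
      using assms[OF a] by (meson card_2_iff)
    have "a \<in> {x \<in> D. f x = f a}" using a by simp
    with xy(1) have "a = x \<or> a = y" by simp
    with xy show ?thesis by (metis insert_commute)
  qed
  then obtain t where t: "\<And>a. a \<in> D \<Longrightarrow> {x \<in> D. f x = f a} = {a, t a} \<and> t a \<noteq> a" by metis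
  have tD: "t a \<in> D \<and> f (t a) = f a" if "a \<in> D" for a using t[OF that] by blast
  have "t (t a) = a" if a: "a \<in> D" for a
  proof -
    have "{t a, t (t a)} = {x \<in> D. f x = f a}" using t[of "t a"] tD[OF a] by simp
    then have "{t a, t (t a)} = {a, t a}" using t[OF a] by simp
    then show ?thesis using t[OF a] by (auto simp: doubleton_eq_iff)
  qed
  then show ?thesis using t tD by blast
qed

text \<open>Average over all \<open>A \<subseteq> S\<close>: as \<open>f x \<noteq> g x\<close>,
  exactly a quarter of the subsets contain \<open>f x\<close> and miss \<open>g x\<close>. This is
  the factor 4 in \<open>term_k\<close>.\<close>

lemma ex_directed_cut:
  assumes "finite X" "finite S" "\<And>x. x \<in> X \<Longrightarrow> f x \<in> S \<and> g x \<in> S \<and> f x \<noteq> g x"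
  shows "\<exists>A\<subseteq>S. card X \<le> 4 * card {x \<in> X. f x \<in> A \<and> g x \<notin> A}"
proof (rule ccontr)
  assume not: "\<not> ?thesis"
  have less: "4 * card {x \<in> X. f x \<in> A \<and> g x \<notin> A} < card X" if A: "A \<in> Pow S" for A
  proof (rule ccontr)
    assume "\<not> ?thesis"
    then have "card X \<le> 4 * card {x \<in> X. f x \<in> A \<and> g x \<notin> A}" by simp
    with not A show False by blast
  qed
  have cnt: "4 * card {A \<in> Pow S. f x \<in> A \<and> g x \<notin> A} = 2 ^ card S" if x: "x \<in> X" for x
  proof -
    let ?S = "S - {f x, g x}"
    have "{A \<in> Pow S. f x \<in> A \<and> g x \<notin> A} = insert (f x) ` Pow ?S"
    proof (intro equalityI subsetI)
      fix A assume "A \<in> {A \<in> Pow S. f x \<in> A \<and> g x \<notin> A}"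
      then have "A = insert (f x) (A - {f x})" "A - {f x} \<in> Pow ?S" by auto
      then show "A \<in> insert (f x) ` Pow ?S" by blast
    qed (use assms(3)[OF x] in auto)
    moreover have "inj_on (insert (f x)) (Pow ?S)" by (rule inj_onI) auto
    ultimately have "card {A \<in> Pow S. f x \<in> A \<and> g x \<notin> A} = 2 ^ card ?S"
      using assms(2) by (simp add: card_image card_Pow)
    moreover have "card S = card ?S + 2"
    proof -
      have "card {f x, g x} = 2" using assms(3)[OF x] by simp
      then show ?thesis
        using card_Diff_subset[of "{f x, g x}" S] card_mono[of S "{f x, g x}"] assms(2) assms(3)[OF x]
        by simp
    qed
    ultimately show ?thesis by simp
  qed
  have "(\<Sum>A\<in>Pow S. card {x \<in> X. f x \<in> A \<and> g x \<notin> A}) = (\<Sum>x\<in>X. card {A \<in> Pow S. f x \<in> A \<and> g x \<notin> A})"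
    using sum.swap_restrict[of "Pow S" X "\<lambda>_ _. 1::nat" "\<lambda>A x. f x \<in> A \<and> g x \<notin> A"] assms(1,2) by simp
  then have "(\<Sum>A\<in>Pow S. 4 * card {x \<in> X. f x \<in> A \<and> g x \<notin> A})
      = (\<Sum>x\<in>X. 4 * card {A \<in> Pow S. f x \<in> A \<and> g x \<notin> A})"
    by (simp add: sum_distrib_left[symmetric])
  also have "\<dots> = (\<Sum>x\<in>X. 2 ^ card S)" by (intro sum.cong refl cnt)
  also have "\<dots> = card X * 2 ^ card S" by simp
  also have "\<dots> = (\<Sum>A\<in>Pow S. card X)" using assms(2) by (simp add: card_Pow)
  finally have eq: "(\<Sum>A\<in>Pow S. 4 * card {x \<in> X. f x \<in> A \<and> g x \<notin> A}) = (\<Sum>A\<in>Pow S. card X)" .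
  have "(\<Sum>A\<in>Pow S. 4 * card {x \<in> X. f x \<in> A \<and> g x \<notin> A}) < (\<Sum>A\<in>Pow S. card X)"
    using less assms(2) by (intro sum_strict_mono) blast+
  with eq show False by simp
qed

lemma metric_inst_tri:
  "metric_inst n c \<Longrightarrow> u < n \<Longrightarrow> v < n \<Longrightarrow> w < n \<Longrightarrow> u \<noteq> v \<Longrightarrow> v \<noteq> w \<Longrightarrow> u \<noteq> w
    \<Longrightarrow> c {u, w} \<le> c {u, v} + c {v, w}"
  by (simp add: metric_inst_def)

lemma metric_inst_nonneg: "metric_inst n c \<Longrightarrow> u < n \<Longrightarrow> v < n \<Longrightarrow> u \<noteq> v \<Longrightarrow> 0 \<le> c {u, v}"
  unfolding metric_inst_def Kedges_def by blast

lemma directed_tour_of_cycle: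
  assumes p: "distinct p" "set p = {..<n}" and n: "3 \<le> n" and c: "metric_inst n c"
  shows "\<exists>s. directed_tour {..<n} s c \<and> (\<lambda>x. {x, s x}) ` {..<n} = cyc_edges p"
proof -
  have len: "length p = n" using distinct_card[OF p(1)] p(2) by simp
  obtain s where s: "\<And>x. x \<in> set p \<Longrightarrow> (x, s x) \<in> dcyc p"
    using bchoice[of "set p" "\<lambda>x y. (x, y) \<in> dcyc p"] dcyc_ex_succ[of _ p] by blast
  have s_in: "s x \<in> set p" if "x \<in> set p" for x using s[OF that] dcyc_in_set by metis
  have s_nth: "s (p ! m) = p ! (Suc m mod n)" if "m < n" for m
  proof -
    have "(p ! m, p ! (Suc m mod n)) \<in> dcyc p" using that len unfolding dcyc_conv by auto
    then show ?thesis using dcyc_succ_unique[OF p(1)] s that len by (metis nth_mem)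
  qed
  have "inj_on s (set p)"
    using dcyc_pred_unique[OF p(1)] s unfolding inj_on_def by metis
  moreover from this have "s ` set p = set p"
    using s_in by (intro endo_inj_surj) auto
  ultimately have bij: "bij_betw s {..<n} {..<n}" using p(2) by (simp add: bij_betw_def)
  have conn: "S = {..<n}" if S: "S \<subseteq> {..<n}" "S \<noteq> {}" "s ` S \<subseteq> S" for S
  proof -
    obtain i where i: "i < n" "p ! i \<in> S"
    proof -
      obtain y where "y \<in> S" using S(2) by blast
      moreover from this have "y \<in> set p" using S(1) p(2) by blast
      ultimately show ?thesis using that len by (auto simp: in_set_conv_nth)
    qed
    have all: "p ! ((i + j) mod n) \<in> S" for j
    proof (induction j)
      case (Suc j)
      have "s (p ! ((i + j) mod n)) = p ! (Suc ((i + j) mod n) mod n)"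
        using s_nth n by simp
      then show ?case using Suc S(3) by (auto simp: mod_Suc_eq)
    qed (use i in simp)
    have "y \<in> S" if "y < n" for y
    proof -
      have "y \<in> set p" using that p(2) by simp
      then obtain m where m: "m < n" "y = p ! m" using len by (auto simp: in_set_conv_nth)
      have "(i + (m + n - i)) mod n = m" using i(1) m(1) by simp
      then show ?thesis using all[of "m + n - i"] m by simp
    qed
    then show ?thesis using S(1) by auto
  qed
  have "(\<lambda>x. {x, s x}) ` {..<n} = cyc_edges p"
  proof (intro equalityI subsetI)
    fix e assume "e \<in> (\<lambda>x. {x, s x}) ` {..<n}"
    then show "e \<in> cyc_edges p" using s p(2) by (force simp: cyc_edges_def)
  next
    fix e assume "e \<in> cyc_edges p"
    then obtain x y where xy: "(x, y) \<in> dcyc p" "e = {x, y}" by (auto simp: cyc_edges_def)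
    then have "y = s x" "x \<in> set p" using dcyc_succ_unique[OF p(1)] s dcyc_in_set by metis+
    then show "e \<in> (\<lambda>x. {x, s x}) ` {..<n}" using xy p(2) by auto
  qed
  moreover have "directed_tour {..<n} s c"
    by unfold_locales (use n bij conn metric_inst_tri[OF c] in auto)
  ultimately show ?thesis by blast
qed

text \<open>Place the vertices on a line at their distance from the start, measured along
  \<open>q\<close>, and cut the line into \<open>N\<close> intervals of length
  \<open>Opt / real N\<close>. By the triangle inequality the positions of two vertices differ by at
  least their distance. With \<open>N = 1\<close> this bounds every distance by
  \<open>Opt\<close>.\<close>

lemma ex_clustering:
  assumes q: "distinct q" "set q = {..<n}" and n: "3 \<le> n" and c: "metric_inst n c"
    and Opt: "ccost c q \<le> Opt" "0 < Opt" and N: "1 \<le> N"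
  shows "\<exists>cl. (\<forall>v<n. cl v < N) \<and>
    (\<forall>u<n. \<forall>v<n. u \<noteq> v \<longrightarrow> cl u = cl v \<longrightarrow> c {u, v} \<le> Opt / real N)"
proof -
  have len: "length q = n" using distinct_card[OF q(1)] q(2) by simp
  have qn: "q ! i < n" if "i < n" for i using that q(2) len nth_mem[of i q] by auto
  have qne: "q ! i \<noteq> q ! j" if "i < n" "j < n" "i \<noteq> j" for i j
    using that q(1) len by (simp add: nth_eq_iff_index_eq)
  have nonneg: "0 \<le> c {q ! i, q ! j}" if "i < n" "j < n" "i \<noteq> j" for i j
    using metric_inst_nonneg[OF c] qn qne that by simp
  define pos where "pos i = pcost c (take (Suc i) q)" for i
  have pos_Suc: "pos (Suc i) = pos i + c {q ! i, q ! Suc i}" if "Suc i < n" for i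
  proof -
    have "take (Suc (Suc i)) q = take (Suc i) q @ [q ! Suc i]"
      using that len by (simp add: take_Suc_conv_app_nth)
    moreover have "take (Suc i) q \<noteq> []" "last (take (Suc i) q) = q ! i"
      using that len by (auto simp: take_Suc_conv_app_nth)
    ultimately show ?thesis by (simp add: pos_def pcost_append)
  qed
  have pos_0: "pos 0 = 0" by (cases q) (simp_all add: pos_def)
  have diff: "c {q ! i, q ! j} \<le> pos j - pos i" if "i < j" "j < n" for i j
    using that
  proof (induction j)
    case (Suc j)
    show ?case
    proof (cases "i = j")
      case True
      then show ?thesis using pos_Suc Suc by simp
    next
      case False
      then have "c {q ! i, q ! j} \<le> pos j - pos i" using Suc by simp
      moreover have "c {q ! i, q ! Suc j} \<le> c {q ! i, q ! j} + c {q ! j, q ! Suc j}"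
        using Suc.prems False by (intro metric_inst_tri[OF c] qn qne) auto
      ultimately show ?thesis using pos_Suc Suc by simp
    qed
  qed simp
  have mono: "pos i \<le> pos j" if "i \<le> j" "j < n" for i j
    using diff[of i j] nonneg[of i j] that by (cases "i = j") auto
  have pos_nonneg: "0 \<le> pos i" if "i < n" for i using mono[of 0 i] that pos_0 by simp
  have pos_le: "pos i \<le> Opt" if "i < n" for i
  proof -
    have "pos i \<le> pos (n - 1)" using mono that by simp
    also have "pos (n - 1) = pcost c q" using len n by (simp add: pos_def)
    also have "\<dots> \<le> ccost c q"
    proof -
      have "q \<noteq> []" using len n by auto
      then have "last q = q ! (n - 1)" "hd q = q ! 0" using len by (simp_all add: last_conv_nth hd_conv_nth)
      then show ?thesis using nonneg[of "n - 1" 0] n by (simp add: ccost_def)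
    qed
    finally show ?thesis using Opt by simp
  qed
  obtain ix where ix: "\<And>v. v < n \<Longrightarrow> ix v < n \<and> q ! ix v = v"
  proof -
    have "\<exists>i. i < n \<and> q ! i = v" if "v < n" for v
    proof -
      have "v \<in> set q" using that q(2) by simp
      then show ?thesis using len by (auto simp: in_set_conv_nth)
    qed
    then show ?thesis using that by metis
  qed
  define y where "y v = pos (ix v) * real N / Opt" for v
  have y: "0 \<le> y v" "y v \<le> real N" if "v < n" for v
    using pos_nonneg[of "ix v"] pos_le[of "ix v"] ix[OF that] Opt(2)
      mult_right_mono[of "pos (ix v)" Opt "real N"]
    by (auto simp: y_def pos_divide_le_eq mult.commute)
  \<comment> \<open>\<open>min\<close> puts a vertex at the far end, at position \<open>Opt\<close>
    exactly, into the last interval.\<close>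
  define cl where "cl v = min (N - 1) (nat \<lfloor>y v\<rfloor>)" for v
  have "c {u, v} \<le> Opt / real N" if uv: "u < n" "v < n" "u \<noteq> v" "cl u = cl v" for u v
  proof -
    have "\<bar>y u - y v\<bar> \<le> 1"
    proof (cases "nat \<lfloor>y u\<rfloor> \<le> N - 1 \<and> nat \<lfloor>y v\<rfloor> \<le> N - 1")
      case True
      then have "nat \<lfloor>y u\<rfloor> = nat \<lfloor>y v\<rfloor>" using uv(4) by (simp add: cl_def)
      then have "\<lfloor>y u\<rfloor> = \<lfloor>y v\<rfloor>" using y uv by (simp add: eq_nat_nat_iff)
      then show ?thesis by linarith
    next
      case False
      then have "N - 1 \<le> nat \<lfloor>y u\<rfloor>" "N - 1 \<le> nat \<lfloor>y v\<rfloor>" using uv(4) by (auto simp: cl_def)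
      then have "real N - 1 \<le> y u" "real N - 1 \<le> y v" using N y(1)[OF uv(1)] y(1)[OF uv(2)] by linarith+
      then show ?thesis using y(2)[OF uv(1)] y(2)[OF uv(2)] by linarith
    qed
    moreover have "y u - y v = (pos (ix u) - pos (ix v)) * (real N / Opt)"
      by (simp add: y_def left_diff_distrib diff_divide_distrib)
    ultimately have "\<bar>pos (ix u) - pos (ix v)\<bar> * (real N / Opt) \<le> 1"
      using Opt(2) by (simp add: abs_mult)
    then have *: "\<bar>pos (ix u) - pos (ix v)\<bar> \<le> Opt / real N"
      using Opt(2) N by (simp add: field_simps)
    have "ix u \<noteq> ix v" using ix uv by metis
    then have "c {u, v} \<le> \<bar>pos (ix u) - pos (ix v)\<bar>"
      using diff[of "ix u" "ix v"] diff[of "ix v" "ix u"] ix[OF uv(1)] ix[OF uv(2)]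
      by (cases "ix u < ix v") (auto simp: insert_commute)
    with * show ?thesis by simp
  qed
  moreover have "cl v < N" for v using N by (simp add: cl_def)
  ultimately show ?thesis by blast
qed

lemma long_edges_card_le:
  assumes k: "3 \<le> k" and c: "metric_inst n c" and opt: "k_optimal k n c T"
    and tour: "directed_tour {..<n} s c" "T = (\<lambda>x. {x, s x}) ` {..<n}"
    and cl: "\<And>v. v < n \<Longrightarrow> cl v < N"
      "\<And>u v. u < n \<Longrightarrow> v < n \<Longrightarrow> u \<noteq> v \<Longrightarrow> cl u = cl v \<Longrightarrow> c {u, v} \<le> \<delta>"
    and W: "0 < W" "\<delta> \<le> W / (4 * real k - 4)"
  shows "card {x. x < n \<and> W / rk k < c {x, s x} \<and> c {x, s x} \<le> W} \<le> 4 * ex N (2 * k)"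
proof -
  interpret directed_tour "{..<n}" s c by (rule tour(1))
  define X where "X = {x. x < n \<and> W / rk k < c {x, s x} \<and> c {x, s x} \<le> W}"
  have n: "3 \<le> n" using card_V by simp
  have Wr: "W / rk k = W - W / (4 * real k - 4)"
    using k by (simp add: rk_def field_simps)
  have s_lt: "s x < n" if "x < n" for x using s_in[of x] that by simp
  \<comment> \<open>\<open>\<delta>\<close> is at most half of \<open>W\<close> and
    \<open>W / rk k\<close> at least half, so no edge of the class stays inside a cluster.\<close>
  have "\<delta> < c {x, s x}" if "x \<in> X" for x
  proof -
    have "2 * (W / (4 * real k - 4)) \<le> W" using k W(1) by (simp add: field_simps)
    then show ?thesis using that W Wr by (auto simp: X_def)
  qed
  then have cl_neq: "cl x \<noteq> cl (s x)" if "x \<in> X" for x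
    using that cl(2)[of x "s x"] s_lt[of x] s_neq[of x] by (force simp: X_def)
  have finX: "finite X" by (simp add: X_def)
  obtain A where A: "card X \<le> 4 * card {x \<in> X. cl x \<in> A \<and> cl (s x) \<notin> A}"
    using ex_directed_cut[OF finX, of "{..<N}" cl "\<lambda>x. cl (s x)"] cl(1) cl_neq s_lt
    by (auto simp: X_def)
  define Y where "Y = {x \<in> X. cl x \<in> A \<and> cl (s x) \<notin> A}"
  have Yn: "x < n" if "x \<in> Y" for x using that by (simp add: Y_def X_def)
  have YA: "cl x \<in> A" "cl (s x) \<notin> A" if "x \<in> Y" for x using that by (simp_all add: Y_def)
  \<comment> \<open>Covers both kinds of short cycles: two parallel edges between the same clusters,
    which makes \<open>\<phi>\<close> injective, and cycles of length at least three, which gives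
    the girth.\<close>
  have no_even: False
    if D0: "D0 \<subseteq> Y" "D0 \<noteq> {}" "card D0 < 2 * k"
      and tails: "\<And>a. a \<in> D0 \<Longrightarrow> card {b \<in> D0. cl b = cl a} = 2"
      and heads: "\<And>a. a \<in> D0 \<Longrightarrow> card {b \<in> D0. cl (s b) = cl (s a)} = 2" for D0
  proof -
    obtain t where t: "\<And>a. a \<in> D0 \<Longrightarrow> t a \<in> D0 \<and> t a \<noteq> a \<and> t (t a) = a \<and> cl (t a) = cl a"
      using ex_partner[of D0 cl, OF tails] by blast
    obtain g where g: "\<And>a. a \<in> D0 \<Longrightarrow> g a \<in> D0 \<and> g a \<noteq> a \<and> g (g a) = a \<and> cl (s (g a)) = cl (s a)"
      using ex_partner[of D0 "\<lambda>a. cl (s a)", OF heads] by blast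
    have D0n: "a < n" if "a \<in> D0" for a using that D0(1) Yn by blast
    have D0V: "D0 \<subseteq> {..<n}" using D0n by auto
    \<comment> \<open>Tails lie in clusters of \<open>A\<close> and heads do not, so no vertex is
      both.\<close>
    have D0s: "D0 \<inter> s ` D0 = {}" using YA D0(1) by blast
    have t': "t a \<in> D0 \<and> t a \<noteq> a \<and> t (t a) = a" if "a \<in> D0" for a using t[OF that] by simp
    have g': "g a \<in> D0 \<and> g a \<noteq> a \<and> g (g a) = a" if "a \<in> D0" for a using g[OF that] by simp
    have ct: "c {a, t a} \<le> \<delta>" if a: "a \<in> D0" for a
      using cl(2)[of a "t a"] t[OF a] D0n[OF a] D0n[of "t a"] by simp
    have cg: "c {s a, s (g a)} \<le> \<delta>" if a: "a \<in> D0" for a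
    proof -
      have "s a \<noteq> s (g a)" using s_inj[of a "g a"] g[OF a] D0n[OF a] D0n[of "g a"] by auto
      then show ?thesis
        using cl(2)[of "s a" "s (g a)"] g[OF a] D0n[OF a] D0n[of "g a"] s_lt[of a] s_lt[of "g a"] by simp
    qed
    obtain h D q where h: "1 \<le> h" "card D0 = 2 * h" "D \<subseteq> D0" "card D = h + 1"
      and q: "distinct q" "set q = {..<n}" "tedges ({..<n} - D) \<subseteq> cyc_edges q"
      and cost: "ccost c q \<le> (\<Sum>x\<in>{..<n} - D0. c {x, s x}) + 2 * real h * \<delta> + 2 * (\<Sum>x\<in>D0 - D. c {x, s x})"
      using ex_cheap_move[OF D0V D0(2) D0s t' g' ct cg] by blast
    have hk: "h + 1 \<le> k" using h(2) D0(3) by simp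
    have finD0: "finite D0" using D0V by (rule finite_subset) simp
    have finD: "finite D" using h(3) finD0 by (rule finite_subset)
    have tour': "is_tour n (cyc_edges q)" using q n by (auto simp: is_tour_iff)
    have "T - cyc_edges q \<subseteq> (\<lambda>x. {x, s x}) ` D" using q(3) by (auto simp: tour(2) tedges_def)
    then have "card (T - cyc_edges q) \<le> card ((\<lambda>x. {x, s x}) ` D)" using finD by (intro card_mono) auto
    also have "\<dots> \<le> k" using card_image_le[OF finD, of "\<lambda>x. {x, s x}"] h(4) hk by simp
    finally have "\<not> tour_cost c (cyc_edges q) < tour_cost c T"
      using opt tour' by (auto simp: k_optimal_def)
    moreover have "tour_cost c (cyc_edges q) = ccost c q"
      unfolding tour_cost_def using q n distinct_card[OF q(1)] by (intro sum_cyc_edges) auto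
    moreover have "tour_cost c T = (\<Sum>x<n. c {x, s x})"
      unfolding tour_cost_def tour(2) by (simp add: sum.reindex[OF inj_on_tedge])
    ultimately have "(\<Sum>x<n. c {x, s x}) \<le> ccost c q" by simp
    also note cost
    also have "(\<Sum>x<n. c {x, s x}) = (\<Sum>x\<in>{..<n} - D0. c {x, s x}) + (\<Sum>x\<in>D0. c {x, s x})"
      using D0V by (simp add: sum.subset_diff)
    also have "(\<Sum>x\<in>D0. c {x, s x}) = (\<Sum>x\<in>D0 - D. c {x, s x}) + (\<Sum>x\<in>D. c {x, s x})"
      using h(3) finD0 by (simp add: sum.subset_diff)
    finally have le: "(\<Sum>x\<in>D. c {x, s x}) \<le> 2 * real h * \<delta> + (\<Sum>x\<in>D0 - D. c {x, s x})" by simp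
    have X_D0: "W / rk k < c {x, s x}" "c {x, s x} \<le> W" if "x \<in> D0" for x
      using that D0(1) by (auto simp: Y_def X_def)
    have "(\<Sum>x\<in>D0 - D. c {x, s x}) \<le> real (card (D0 - D)) * W"
      using X_D0 by (intro sum_bounded_above) auto
    also have "card (D0 - D) = h - 1" using h finD by (simp add: card_Diff_subset)
    finally have up: "(\<Sum>x\<in>D0 - D. c {x, s x}) \<le> (real h - 1) * W" using h(1) by (simp add: of_nat_diff)
    have "D \<noteq> {}" using h(4) by auto
    then have "(\<Sum>x\<in>D. W / rk k) < (\<Sum>x\<in>D. c {x, s x})"
      using X_D0 h(3) finD by (intro sum_strict_mono) auto
    then have "(real h + 1) * (W - W / (4 * real k - 4)) < (\<Sum>x\<in>D. c {x, s x})"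
      using h(4) Wr by (simp add: algebra_simps)
    moreover define Z where "Z = W / (4 * real k - 4)"
    ultimately have "(real h + 1) * (W - Z) < 2 * real h * \<delta> + (real h - 1) * W"
      using le up by simp
    also have "2 * real h * \<delta> \<le> 2 * real h * Z"
      using W(2) by (intro mult_left_mono) (auto simp: Z_def)
    \<comment> \<open>The \<open>h + 1\<close> lost edges outnumber the \<open>h - 1\<close>
      restored ones by two, whereas the errors are \<open>2 * h\<close> cluster distances and
      \<open>h + 1\<close> times the width of the class, each at most \<open>Z\<close>. As
      \<open>h + 1 \<le> k\<close>, the errors add up to at most \<open>(4 * k - 4) * Z = W\<close>,
      half of what would be needed.\<close>
    finally have "2 * W < (3 * real h + 1) * Z" by (simp add: algebra_simps)
    also have "\<dots> \<le> (4 * real k - 4) * Z"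
      using hk k W(1) by (intro mult_right_mono) (auto simp: Z_def)
    also have "\<dots> = W" using k by (simp add: Z_def)
    finally show False using W(1) by simp
  qed
  define \<phi> where "\<phi> x = {cl x, cl (s x)}" for x
  have inj: "inj_on \<phi> Y"
  proof (rule inj_onI, rule ccontr)
    fix x y assume xy: "x \<in> Y" "y \<in> Y" "\<phi> x = \<phi> y" "x \<noteq> y"
    then have "cl x = cl y" "cl (s x) = cl (s y)"
      using YA[OF xy(1)] YA[OF xy(2)] by (auto simp: \<phi>_def doubleton_eq_iff)
    then have "{b \<in> {x, y}. cl b = cl a} = {x, y}" "{b \<in> {x, y}. cl (s b) = cl (s a)} = {x, y}"
      if "a \<in> {x, y}" for a using that by auto
    then show False using no_even[of "{x, y}"] xy k by simp
  qed
  have "girth_ge (\<phi> ` Y) (2 * k)"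
    unfolding girth_ge_def
  proof (intro allI impI, rule ccontr)
    fix m assume "has_cycle_len (\<phi> ` Y) m" and m: "\<not> 2 * k \<le> m"
    then obtain vs where vs: "3 \<le> m" "distinct vs" "length vs = m" "cyc_edges vs \<subseteq> \<phi> ` Y"
      by (auto simp: has_cycle_len_iff)
    define D0 where "D0 = {x \<in> Y. \<phi> x \<in> cyc_edges vs}"
    have D0Y: "D0 \<subseteq> Y" by (auto simp: D0_def)
    have img: "\<phi> ` D0 = cyc_edges vs" using vs(4) by (auto simp: D0_def)
    have inj0: "inj_on \<phi> D0" using inj D0Y by (rule inj_on_subset)
    \<comment> \<open>Every cluster on the cycle has degree two. A cluster of \<open>A\<close>
      contains only tails of edges in \<open>Y\<close> and any other cluster only heads, so degree
      two means that exactly two tails, or exactly two heads, share the cluster.\<close>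
    have deg: "card {b \<in> D0. v \<in> \<phi> b} = 2" if v: "v \<in> set vs" for v
    proof -
      have "\<phi> ` {b \<in> D0. v \<in> \<phi> b} = {e \<in> cyc_edges vs. v \<in> e}" using img by auto
      moreover have "inj_on \<phi> {b \<in> D0. v \<in> \<phi> b}" using inj0 by (rule inj_on_subset) auto
      ultimately show ?thesis
        using card_cyc_edges_at[OF vs(2) _ v] vs by (metis card_image)
    qed
    have in_vs: "cl a \<in> set vs" "cl (s a) \<in> set vs" if "a \<in> D0" for a
      using that cyc_edges_subset[of "\<phi> a" vs] by (auto simp: D0_def \<phi>_def)
    show False
    proof (rule no_even[of D0])
      have "card D0 = card (cyc_edges vs)" using img inj0 by (metis card_image)
      also have "\<dots> \<le> card (dcyc vs)" unfolding cyc_edges_def by (intro card_image_le) simp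
      also have "\<dots> \<le> m" using card_length[of "zip vs (rotate1 vs)"] vs(3) by (simp add: dcyc_def)
      finally show "card D0 < 2 * k" using m by simp
      have "cyc_edges vs \<noteq> {}" using vs cyc_edges_cut[of vs] by (cases vs) auto
      then show "D0 \<noteq> {}" using img by auto
    next
      fix a assume a: "a \<in> D0"
      have ne: "cl x \<noteq> cl (s y)" "cl (s y) \<noteq> cl x" if "x \<in> D0" "y \<in> D0" for x y
      proof -
        have "x \<in> Y" "y \<in> Y" using that D0Y by auto
        then show "cl x \<noteq> cl (s y)" "cl (s y) \<noteq> cl x" using YA by metis+
      qed
      have "{b \<in> D0. cl b = cl a} = {b \<in> D0. cl a \<in> \<phi> b}"
        using a ne by (auto simp: \<phi>_def)
      then show "card {b \<in> D0. cl b = cl a} = 2" using deg in_vs(1)[OF a] by simp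
      have "{b \<in> D0. cl (s b) = cl (s a)} = {b \<in> D0. cl (s a) \<in> \<phi> b}"
        using a ne by (auto simp: \<phi>_def)
      then show "card {b \<in> D0. cl (s b) = cl (s a)} = 2" using deg in_vs(2)[OF a] by simp
    qed (rule D0Y)
  qed
  moreover have "\<phi> ` Y \<subseteq> Kedges N"
  proof
    fix e assume "e \<in> \<phi> ` Y"
    then obtain x where x: "x \<in> Y" "e = {cl x, cl (s x)}" by (auto simp: \<phi>_def)
    have "cl x < N" "cl (s x) < N" using cl(1) Yn[OF x(1)] s_lt by auto
    moreover have "cl x \<noteq> cl (s x)" using YA[OF x(1)] by auto
    ultimately show "e \<in> Kedges N" using x(2) by (auto simp: Kedges_def)
  qed
  ultimately have "card (\<phi> ` Y) \<le> ex N (2 * k)" using ex_ge by blast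
  then have "card Y \<le> ex N (2 * k)" using inj by (simp add: card_image)
  then show ?thesis using A by (simp add: X_def Y_def)
qed

section \<open>Length classes and their summation\<close>

lemma rk_gt_1: "3 \<le> k \<Longrightarrow> 1 < rk k"
  by (simp add: rk_def field_simps)

abbreviation verts :: "nat \<Rightarrow> nat \<Rightarrow> nat" where
  "verts k l \<equiv> 4 * (k - 1) * nat \<lceil>rk k ^ l\<rceil>"

lemma rk_power_ge_1: "3 \<le> k \<Longrightarrow> 1 \<le> rk k ^ l"
  using rk_gt_1[of k] by simp

lemma verts_ge:
  assumes "3 \<le> k" shows "(4 * real k - 4) * rk k ^ l \<le> real (verts k l)" "8 \<le> verts k l"
proof -
  have "rk k ^ l \<le> real (nat \<lceil>rk k ^ l\<rceil>)" by (rule real_nat_ceiling_ge)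
  then have le: "(4 * real k - 4) * rk k ^ l \<le> (4 * real k - 4) * real (nat \<lceil>rk k ^ l\<rceil>)"
    using assms by (intro mult_left_mono) auto
  show 1: "(4 * real k - 4) * rk k ^ l \<le> real (verts k l)"
  proof -
    have "real (verts k l) = (4 * real k - 4) * real (nat \<lceil>rk k ^ l\<rceil>)"
      using assms by (simp add: of_nat_diff)
    then show ?thesis using le by presburger
  qed
  have "8 * 1 \<le> (4 * real k - 4) * rk k ^ l"
    using assms rk_power_ge_1[OF assms, of l] by (intro mult_mono) auto
  with 1 show "8 \<le> verts k l" by linarith
qed

lemma term_k_ge: assumes "3 \<le> k" shows "rk k ^ l \<le> real (term_k k l)"
proof -
  have "1 * rk k ^ l \<le> (4 * real k - 4) * rk k ^ l"
    using assms rk_power_ge_1[OF assms, of l] by (intro mult_right_mono) auto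
  also have "\<dots> \<le> real (verts k l)" by (rule verts_ge[OF assms])
  also have "\<dots> \<le> real (4 * (verts k l - 1))" using verts_ge(2)[OF assms, of l] by linarith
  also have "\<dots> \<le> real (term_k k l)"
    using ex_ge_star[of "verts k l" "2 * k"] by (simp add: term_k_def)
  finally show ?thesis by simp
qed

lemma lstar_sum_ge: assumes "3 \<le> k" shows "n \<le> (\<Sum>l\<le>lstar k n. term_k k l)"
  unfolding lstar_def
proof (rule LeastI)
  have "1 \<le> term_k k l" for l
    using term_k_ge[OF assms, of l] rk_power_ge_1[OF assms, of l] by linarith
  then have "(\<Sum>l\<le>n. 1) \<le> (\<Sum>l\<le>n. term_k k l)" by (intro sum_mono)
  then show "n \<le> (\<Sum>l\<le>n. term_k k l)" by simp
qed

lemma tour_ratio_le: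
  assumes k: "3 \<le> k" and c: "metric_inst n c" and Opt: "0 < OPT n c" and T: "k_optimal k n c T"
  shows "tour_cost c T / OPT n c \<le> U k n"
proof -
  have T': "is_tour n T" using T by (simp add: k_optimal_def)
  then obtain p where p: "distinct p" "set p = {..<n}" "T = cyc_edges p" and n: "3 \<le> n"
    by (auto simp: is_tour_iff)
  obtain s where s: "directed_tour {..<n} s c" "(\<lambda>x. {x, s x}) ` {..<n} = T"
    using directed_tour_of_cycle[OF p(1,2) n c] p(3) by blast
  interpret directed_tour "{..<n}" s c by (rule s(1))
  have "OPT n c \<in> tour_cost c ` {T. is_tour n T}"
    unfolding OPT_def using T' by (intro Min_in) (auto simp: finite_tours)
  then obtain q where q: "distinct q" "set q = {..<n}" "tour_cost c (cyc_edges q) = OPT n c"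
    by (auto simp: is_tour_iff)
  have qcost: "ccost c q \<le> OPT n c"
    using q sum_cyc_edges[OF q(1), of c] distinct_card[OF q(1)] n by (simp add: tour_cost_def)
  define r where "r = rk k"
  have r: "1 < r" using rk_gt_1[OF k] by (simp add: r_def)
  define w where "w x = c {x, s x} / OPT n c" for x
  define L where "L = lstar k n"
  define X where "X l = {x. x < n \<and> 1 / r ^ Suc l < w x \<and> w x \<le> 1 / r ^ l}" for l
  have cardX: "card (X l) \<le> term_k k l" for l
  proof -
    have N1: "1 \<le> verts k l" by (rule order_trans[OF _ verts_ge(2)[OF k]]) simp
    obtain cl where cl: "\<And>v. v < n \<Longrightarrow> cl v < verts k l"
        "\<And>u v. u < n \<Longrightarrow> v < n \<Longrightarrow> u \<noteq> v \<Longrightarrow> cl u = cl v \<Longrightarrow> c {u, v} \<le> OPT n c / real (verts k l)"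
      using ex_clustering[OF q(1,2) n c qcost Opt N1] by blast
    \<comment> \<open>Rounding up the number of clusters only makes them smaller.\<close>
    have "OPT n c / real (verts k l) \<le> OPT n c / ((4 * real k - 4) * r ^ l)"
      using verts_ge(1)[OF k, of l] Opt k r unfolding r_def[symmetric]
      by (intro divide_left_mono) (auto intro!: mult_pos_pos simp: verts_ge(2)[OF k])
    then have "OPT n c / real (verts k l) \<le> OPT n c / r ^ l / (4 * real k - 4)"
      by (simp add: mult.commute)
    from long_edges_card_le[OF k c T s(1) s(2)[symmetric] cl _ this]
    have "card {x. x < n \<and> OPT n c / r ^ l / rk k < c {x, s x} \<and> c {x, s x} \<le> OPT n c / r ^ l}
        \<le> 4 * ex (verts k l) (2 * k)" using Opt r by simp
    also have "{x. x < n \<and> OPT n c / r ^ l / rk k < c {x, s x} \<and> c {x, s x} \<le> OPT n c / r ^ l} = X l"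
      using Opt r by (auto simp: X_def w_def r_def[symmetric] field_simps)
    finally show ?thesis by (simp add: term_k_def)
  qed
  \<comment> \<open>A single cluster: no distance exceeds the optimum, so no edge is too long for
    the classes from \<open>l = 0\<close> on.\<close>
  have w_le_1: "w x \<le> 1" if "x < n" for x
  proof -
    have "c {x, s x} \<le> OPT n c / real 1"
      using ex_clustering[OF q(1,2) n c qcost Opt order_refl] that s_in[of x] s_neq[of x] by auto
    then show ?thesis using Opt by (simp add: w_def)
  qed
  \<comment> \<open>The edges too short for the classes up to \<open>L\<close>, among them those of
    length 0.\<close>
  define R where "R = {..<n} - (\<Union>l\<le>L. X l)"
  have disj: "X l \<inter> X l' = {}" if "l < l'" for l l'
  proof -
    have "1 / r ^ l' \<le> 1 / r ^ Suc l"
      using r that by (intro divide_left_mono power_increasing) auto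
    then show ?thesis by (auto simp: X_def)
  qed
  have disj': "X l \<inter> X l' = {}" if "l \<noteq> l'" for l l'
    using disj[of l l'] disj[of l' l] that by (cases "l < l'") auto
  have finX: "finite (X l)" for l by (simp add: X_def)
  have Xn: "(\<Union>l\<le>L. X l) \<subseteq> {..<n}" by (auto simp: X_def)
  have w_R: "w x \<le> 1 / r ^ L" if x: "x \<in> R" for x
  proof (rule ccontr)
    assume not: "\<not> ?thesis"
    have xn: "x < n" using x by (simp add: R_def)
    have "1 / r ^ Suc L < 1 / r ^ L" using r by (intro divide_strict_left_mono) auto
    with not have P: "1 / r ^ Suc L < w x" by simp
    define l where "l = (LEAST l. 1 / r ^ Suc l < w x)"
    have l: "1 / r ^ Suc l < w x" unfolding l_def using P by (rule LeastI)
    have "l \<le> L" unfolding l_def using P by (rule Least_le)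
    moreover have "w x \<le> 1 / r ^ l"
    proof (cases l)
      case (Suc l')
      then show ?thesis using not_less_Least[of l' "\<lambda>l. 1 / r ^ Suc l < w x"] by (simp add: l_def)
    qed (use w_le_1 xn in simp)
    ultimately have "x \<in> (\<Union>l\<le>L. X l)" using l xn by (auto simp: X_def)
    then show False using x by (simp add: R_def)
  qed
  have cardU: "card (\<Union>l\<le>L. X l) = (\<Sum>l\<le>L. card (X l))"
    using disj' finX by (intro card_UN_disjoint) auto
  have cardR: "real (card R) = real n - (\<Sum>l\<le>L. real (card (X l)))"
    using card_Diff_subset[OF _ Xn] card_mono[OF _ Xn] finX by (simp add: R_def cardU of_nat_diff)
  have "real n \<le> (\<Sum>l\<le>L. real (term_k k l))"
    using lstar_sum_ge[OF k, of n] unfolding L_def by (metis of_nat_le_iff of_nat_sum)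
  then have R_le: "real (card R) \<le> (\<Sum>l\<le>L. real (term_k k l) - real (card (X l)))"
    using cardR by (simp add: sum_subtractf)
  have "tour_cost c T / OPT n c = (\<Sum>x<n. w x)"
    unfolding tour_cost_def s(2)[symmetric] w_def
    by (simp add: sum.reindex[OF inj_on_tedge] sum_divide_distrib)
  also have "\<dots> = (\<Sum>x\<in>(\<Union>l\<le>L. X l). w x) + (\<Sum>x\<in>R. w x)"
    unfolding R_def using Xn by (simp add: sum.subset_diff)
  also have "(\<Sum>x\<in>(\<Union>l\<le>L. X l). w x) = (\<Sum>l\<le>L. \<Sum>x\<in>X l. w x)"
    using disj' finX by (intro sum.UNION_disjoint) auto
  also have "\<dots> \<le> (\<Sum>l\<le>L. real (card (X l)) * (1 / r ^ l))"
    by (intro sum_mono sum_bounded_above) (auto simp: X_def)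
  also have "(\<Sum>x\<in>R. w x) \<le> real (card R) * (1 / r ^ L)"
    using w_R by (intro sum_bounded_above)
  also have "\<dots> \<le> (\<Sum>l\<le>L. real (term_k k l) - real (card (X l))) * (1 / r ^ L)"
    using R_le r by (intro mult_right_mono) auto
  \<comment> \<open>By the choice of \<open>L\<close> the edges of \<open>R\<close> fit into the
    free places of the classes up to \<open>L\<close>. A free place in class \<open>l\<close> is
    credited with \<open>1 / r ^ l\<close>, which is at least the length of such an edge.\<close>
  also have "\<dots> \<le> (\<Sum>l\<le>L. (real (term_k k l) - real (card (X l))) * (1 / r ^ l))"
    unfolding sum_distrib_right
  proof (rule sum_mono)
    fix l assume "l \<in> {..L}"
    then have "1 / r ^ L \<le> 1 / r ^ l" using r by (intro divide_left_mono power_increasing) auto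
    then show "(real (term_k k l) - real (card (X l))) * (1 / r ^ L)
        \<le> (real (term_k k l) - real (card (X l))) * (1 / r ^ l)"
      using cardX[of l] by (intro mult_left_mono) auto
  qed
  finally have "tour_cost c T / OPT n c \<le> (\<Sum>l\<le>L. real (card (X l)) * (1 / r ^ l))
      + (\<Sum>l\<le>L. (real (term_k k l) - real (card (X l))) * (1 / r ^ l))" by simp
  also have "\<dots> = U k n"
    unfolding U_def L_def r_def sum.distrib[symmetric] by (simp add: add_divide_distrib[symmetric])
  finally show ?thesis .
qed

lemma alpha_le_U: "3 \<le> k \<Longrightarrow> alpha k n \<le> ereal (U k n)"
  unfolding alpha_def using tour_ratio_le by (intro Sup_least) auto

section \<open>Even edge sets and closed trails\<close>

text \<open>The boundary of an edge set modulo 2. \<open>oddset J = {}\<close> describes the even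
  sets and \<open>oddset J = sym_diff {x} {y}\<close> the joins of \<open>x\<close> and
  \<open>y\<close>, which are even sets if \<open>x = y\<close>.\<close>

definition oddset :: "'a set set \<Rightarrow> 'a set" where
  "oddset J = {v. odd (card {e \<in> J. v \<in> e})}"

lemma odd_card_sym_diff:
  assumes "finite A" "finite B"
  shows "odd (card (sym_diff A B)) \<longleftrightarrow> odd (card A) \<noteq> odd (card B)"
proof -
  have "card (sym_diff A B) = card (A - B) + card (B - A)"
    using assms by (intro card_Un_disjoint) auto
  moreover have "card A = card (A - B) + card (A \<inter> B)"
    using assms by (subst card_Un_disjoint[symmetric]) (auto intro: arg_cong[of _ _ card])
  moreover have "card B = card (B - A) + card (A \<inter> B)"
    using assms by (subst card_Un_disjoint[symmetric]) (auto intro: arg_cong[of _ _ card])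
  ultimately show ?thesis by presburger
qed

lemma oddset_sym_diff:
  assumes "finite A" "finite B"
  shows "oddset (sym_diff A B) = sym_diff (oddset A) (oddset B)"
proof -
  have "{e \<in> sym_diff A B. v \<in> e} = sym_diff {e \<in> A. v \<in> e} {e \<in> B. v \<in> e}" for v by auto
  then have "odd (card {e \<in> sym_diff A B. v \<in> e}) \<longleftrightarrow>
      odd (card {e \<in> A. v \<in> e}) \<noteq> odd (card {e \<in> B. v \<in> e})" for v
    using assms odd_card_sym_diff[of "{e \<in> A. v \<in> e}" "{e \<in> B. v \<in> e}"] by simp
  then show ?thesis unfolding oddset_def by blast
qed

lemma oddset_empty [simp]: "oddset {} = {}"
  by (simp add: oddset_def)

lemma oddset_singleton [simp]: "oddset {e} = e"
proof -
  have "{e' \<in> {e}. v \<in> e'} = (if v \<in> e then {e} else {})" for v by auto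
  then show ?thesis by (simp add: oddset_def)
qed

lemma oddset_subset: "oddset J \<subseteq> \<Union>J"
proof
  fix v assume "v \<in> oddset J"
  then have "card {e \<in> J. v \<in> e} \<noteq> 0" by (auto simp: oddset_def intro: Nat.gr0I)
  then have "{e \<in> J. v \<in> e} \<noteq> {}" by (metis card.empty)
  then show "v \<in> \<Union>J" by blast
qed

lemma card_sym_diff_le: "finite A \<Longrightarrow> finite B \<Longrightarrow> card (sym_diff A B) \<le> card A + card B"
  by (rule order_trans[OF card_Un_le]) (auto intro!: add_mono card_mono)

lemma ccost_1: "xs \<noteq> [] \<Longrightarrow> ccost (\<lambda>_. 1) xs = real (length xs)"
proof -
  have "pcost (\<lambda>_. 1) xs = real (length xs) - 1" if "xs \<noteq> []" for xs :: "'a list"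
    using that by (induction xs rule: induct_list012) auto
  then show "xs \<noteq> [] \<Longrightarrow> ccost (\<lambda>_. 1) xs = real (length xs)" by (simp add: ccost_def)
qed

lemma card_cyc_edges:
  assumes "distinct xs" "3 \<le> length xs" shows "card (cyc_edges xs) = length xs"
proof -
  have "real (card (cyc_edges xs)) = ccost (\<lambda>_. 1) xs"
    using sum_cyc_edges[OF assms, of "\<lambda>_. 1"] by simp
  also have "\<dots> = real (length xs)" using assms by (intro ccost_1) auto
  finally show ?thesis by simp
qed

text \<open>In an even set every covered vertex has degree at least two, so there is a cycle, and
  its edges all belong to \<open>E\<close>.\<close>

lemma even_has_short_cycle:
  assumes "finite E" "E \<noteq> {}" "\<And>e. e \<in> E \<Longrightarrow> card e = 2" "oddset E = {}"
  shows "\<exists>m\<le>card E. has_cycle_len E m"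
proof -
  have "2 \<le> card {e \<in> E. v \<in> e}" if "v \<in> \<Union>E" for v
  proof -
    have "{e \<in> E. v \<in> e} \<noteq> {}" using that by blast
    then have "card {e \<in> E. v \<in> e} \<noteq> 0" using assms(1) by simp
    moreover have "v \<notin> oddset E" using assms(4) by simp
    then have "even (card {e \<in> E. v \<in> e})" by (simp add: oddset_def)
    ultimately show ?thesis by presburger
  qed
  then obtain q where q: "distinct q" "3 \<le> length q" "cyc_edges q \<subseteq> E"
    using ex_cycle_if_min_degree_2[OF assms(1-3)] by blast
  then have "length q \<le> card E" using card_mono[OF assms(1) q(3)] card_cyc_edges[OF q(1,2)] by simp
  then show ?thesis using q by (auto simp: has_cycle_len_iff)
qed

text \<open>A maximal even subset leaves so few edges because distinct subsets of the remaining edges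
  have distinct sets of odd vertices.\<close>

lemma ex_large_even_subset:
  assumes "finite E" "finite S" "\<Union>E \<subseteq> S"
  shows "\<exists>E0\<subseteq>E. oddset E0 = {} \<and> card E \<le> card E0 + card S"
proof -
  have "{} \<subseteq> E \<and> oddset {} = {}" by simp
  moreover have "card J < Suc (card E)" if "J \<subseteq> E \<and> oddset J = {}" for J
    using that assms(1) by (simp add: card_mono less_Suc_eq_le)
  ultimately obtain E0 where E0: "E0 \<subseteq> E" "oddset E0 = {}"
    and mx: "\<And>J. J \<subseteq> E \<Longrightarrow> oddset J = {} \<Longrightarrow> card J \<le> card E0"
    using ex_has_greatest_nat[of "\<lambda>J. J \<subseteq> E \<and> oddset J = {}" "{}" card "Suc (card E)"] by auto
  have fin: "finite J" if "J \<subseteq> E" for J using that assms(1) by (rule finite_subset)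
  have "inj_on oddset (Pow (E - E0))"
  proof (rule inj_onI, rule ccontr)
    fix X Y assume XY: "X \<in> Pow (E - E0)" "Y \<in> Pow (E - E0)" "oddset X = oddset Y" "X \<noteq> Y"
    \<comment> \<open>Two subsets with the same odd vertices differ by an even set, which is
      disjoint from \<open>E0\<close> and could be added to it.\<close>
    define Z where "Z = sym_diff X Y"
    have Z: "Z \<subseteq> E - E0" "Z \<noteq> {}" using XY by (auto simp: Z_def)
    have fXY: "finite X" "finite Y" using XY(1,2) by (auto intro!: fin)
    have oZ: "oddset Z = {}" using oddset_sym_diff[OF fXY] XY(3) by (simp add: Z_def)
    have finZ: "finite Z" "finite E0" using fin Z E0 by auto
    have "sym_diff E0 Z = E0 \<union> Z" using Z by auto
    then have "oddset (E0 \<union> Z) = {}" using oddset_sym_diff[of E0 Z] finZ E0 oZ by simp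
    then have "card (E0 \<union> Z) \<le> card E0" using mx[of "E0 \<union> Z"] Z E0 by auto
    moreover have "card (E0 \<union> Z) = card E0 + card Z" using Z finZ by (intro card_Un_disjoint) auto
    moreover have "card Z > 0" using Z finZ by (simp add: card_gt_0_iff)
    ultimately show False by simp
  qed
  moreover have "oddset ` Pow (E - E0) \<subseteq> Pow S"
  proof
    fix A assume "A \<in> oddset ` Pow (E - E0)"
    then obtain J where "J \<subseteq> E - E0" "A = oddset J" by auto
    then show "A \<in> Pow S" using oddset_subset[of J] assms(3) by blast
  qed
  ultimately have "card (Pow (E - E0)) \<le> card (Pow S)"
    using assms(2) by (intro card_inj_on_le) auto
  then have "(2::nat) ^ card (E - E0) \<le> 2 ^ card S"
    using assms(1,2) by (simp add: card_Pow)
  then have "card (E - E0) \<le> card S" by simp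
  moreover have "card E = card E0 + card (E - E0)"
    using card_Diff_subset[of E0 E] card_mono[of E E0] E0 fin assms(1) by simp
  ultimately show ?thesis using E0 by auto
qed

section \<open>Joins and closed trails\<close>

lemma path_edges_Cons: "path_edges (x # y # zs) = insert {x, y} (path_edges (y # zs))"
  by (simp add: path_edges_def)

lemma path_edges_finite [simp]: "finite (path_edges xs)"
  by (simp add: path_edges_def dpath_def)

lemma card_path_edges_le: "xs \<noteq> [] \<Longrightarrow> card (path_edges xs) \<le> length xs - 1"
proof (induction xs rule: induct_list012)
  case (3 x y zs)
  then show ?case using card_insert_le_m1[of "length (y # zs)" "path_edges (y # zs)" "{x, y}"]
    by (simp add: path_edges_Cons card_insert_if)
qed (auto simp: path_edges_def)

text \<open>The edges of a walk are added modulo 2. Repeated edges may cancel, so only a subset of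
  them remains.\<close>

lemma ex_path_join:
  assumes "xs \<noteq> []" "\<And>e. e \<in> path_edges xs \<Longrightarrow> card e = 2"
  shows "\<exists>J\<subseteq>path_edges xs. oddset J = sym_diff {hd xs} {last xs}"
  using assms
proof (induction xs rule: induct_list012)
  case (3 x y zs)
  obtain J where J: "J \<subseteq> path_edges (y # zs)" "oddset J = sym_diff {y} {last (y # zs)}"
    using 3 by (auto simp: path_edges_Cons)
  have "x \<noteq> y" using 3(4)[of "{x, y}"] by (auto simp: path_edges_Cons)
  then have xy: "{x, y} = sym_diff {x} {y}" by auto
  have "finite J" using J(1) by (rule finite_subset) simp
  then have "oddset (sym_diff {{x, y}} J) = sym_diff (sym_diff {x} {y}) (sym_diff {y} {last (y # zs)})"
    using oddset_sym_diff[of "{{x, y}}" J] J(2) xy by simp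
  also have "\<dots> = sym_diff {x} {last (y # zs)}" by auto
  finally show ?case using J(1) by (intro exI[of _ "sym_diff {{x, y}} J"]) (auto simp: path_edges_Cons)
qed auto

text \<open>The cardinality conditions say that no edge is traversed twice.\<close>

definition trail :: "'a list \<Rightarrow> bool" where
  "trail xs \<longleftrightarrow> xs \<noteq> [] \<and> card (path_edges xs) = length xs - 1 \<and> (\<forall>e\<in>path_edges xs. card e = 2)"

definition closed_trail :: "'a list \<Rightarrow> bool" where
  "closed_trail w \<longleftrightarrow> w \<noteq> [] \<and> card (cyc_edges w) = length w \<and> (\<forall>e\<in>cyc_edges w. card e = 2)"

lemma trail_Cons:
  "trail (x # y # zs) \<longleftrightarrow> trail (y # zs) \<and> {x, y} \<notin> path_edges (y # zs) \<and> x \<noteq> y"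
proof -
  have "card (path_edges (y # zs)) \<le> length zs" using card_path_edges_le[of "y # zs"] by simp
  then show ?thesis
    by (auto simp: trail_def path_edges_Cons card_insert_if insert_absorb)
qed

lemma oddset_trail: "trail xs \<Longrightarrow> oddset (path_edges xs) = sym_diff {hd xs} {last xs}"
proof (induction xs rule: induct_list012)
  case (3 x y zs)
  then have h: "trail (y # zs)" "{x, y} \<notin> path_edges (y # zs)" "x \<noteq> y" by (auto simp: trail_Cons)
  have "path_edges (x # y # zs) = sym_diff {{x, y}} (path_edges (y # zs))"
    using h(2) by (auto simp: path_edges_Cons)
  then have "oddset (path_edges (x # y # zs)) = sym_diff {x, y} (sym_diff {y} {last (y # zs)})"
    using oddset_sym_diff[of "{{x, y}}" "path_edges (y # zs)"] 3(2)[OF h(1)] by simp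
  also have "{x, y} = sym_diff {x} {y}" using h(3) by auto
  also have "sym_diff (sym_diff {x} {y}) (sym_diff {y} {last (y # zs)}) = sym_diff {x} {last (y # zs)}"
    by auto
  finally show ?case by simp
qed (auto simp: trail_def path_edges_def)

lemma cyc_edges_path: "w \<noteq> [] \<Longrightarrow> cyc_edges w = path_edges (w @ [hd w])"
  by (auto simp: cyc_edges_def path_edges_def dcyc_eq dpath_append)

lemma closed_trail_iff: "w \<noteq> [] \<Longrightarrow> closed_trail w \<longleftrightarrow> trail (w @ [hd w])"
  by (simp add: closed_trail_def trail_def cyc_edges_path)

lemma oddset_closed_trail: "closed_trail w \<Longrightarrow> oddset (cyc_edges w) = {}"
proof -
  assume w: "closed_trail w"
  then have ne: "w \<noteq> []" by (simp add: closed_trail_def)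
  then show ?thesis
    using oddset_trail[of "w @ [hd w]"] w by (simp add: closed_trail_iff cyc_edges_path)
qed

lemma ex_closed_trail_at:
  assumes E: "finite E" "\<And>e. e \<in> E \<Longrightarrow> card e = 2" "oddset E = {}" and v: "v \<in> \<Union>E"
  shows "\<exists>w. closed_trail w \<and> cyc_edges w \<subseteq> E \<and> hd w = v"
proof -
  define P where "P xs \<longleftrightarrow> trail xs \<and> path_edges xs \<subseteq> E \<and> last xs = v \<and> 2 \<le> length xs" for xs
  obtain e where e: "e \<in> E" "v \<in> e" using v by blast
  then obtain z where z: "e = {z, v}" "z \<noteq> v"
    using E(2)[OF e(1)] by (auto simp: card_2_iff)
  have "P [z, v]" using e z by (auto simp: P_def trail_Cons path_edges_Cons) (auto simp: trail_def path_edges_def)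
  moreover have "length xs < Suc (Suc (card E))" if "P xs" for xs
    using that E(1) card_mono[of E "path_edges xs"] by (auto simp: P_def trail_def)
  ultimately obtain xs where xs: "P xs" and mx: "\<And>ys. P ys \<Longrightarrow> length ys \<le> length xs"
    using ex_has_greatest_nat[of P _ length] by metis
  obtain a b zs where ab: "xs = a # b # zs"
    using xs by (cases xs; cases "tl xs") (auto simp: P_def)
  have "a = v"
  proof (rule ccontr)
    assume "a \<noteq> v"
    define F where "F = E - path_edges xs"
    have pe: "path_edges xs \<subseteq> E" "trail xs" using xs by (auto simp: P_def)
    have "F = sym_diff E (path_edges xs)" using pe by (auto simp: F_def)
    then have "oddset F = oddset (path_edges xs)"
      using oddset_sym_diff[of E "path_edges xs"] E by simp
    also have "\<dots> = sym_diff {a} {v}" using oddset_trail[OF pe(2)] ab xs by (simp add: P_def)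
    finally have "a \<in> \<Union>F" using \<open>a \<noteq> v\<close> oddset_subset[of F] by blast
    then obtain f where f: "f \<in> F" "a \<in> f" by blast
    then obtain y where y: "f = {y, a}" "y \<noteq> a" using E(2)[of f] by (auto simp: F_def card_2_iff)
    have "P (y # xs)"
      using f y xs ab by (auto simp: P_def trail_Cons path_edges_Cons F_def)
    from mx[OF this] show False by simp
  qed
  \<comment> \<open>A closed trail lists its base point only once; the closing edge is
    implicit.\<close>
  define w where "w = butlast xs"
  have xs_w: "xs = w @ [v]"
    using xs ab append_butlast_last_id[of xs] by (simp add: P_def w_def)
  have w: "w \<noteq> []" "hd w = v" using ab \<open>a = v\<close> by (auto simp: w_def)
  have "closed_trail w" using closed_trail_iff[OF w(1)] w(2) xs xs_w by (simp add: P_def)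
  moreover have "cyc_edges w \<subseteq> E" using cyc_edges_path[OF w(1)] w(2) xs xs_w by (simp add: P_def)
  ultimately show ?thesis using w by blast
qed

lemma ex_maximal_closed_trail:
  assumes E: "finite E" "\<And>e. e \<in> E \<Longrightarrow> card e = 2" "oddset E = {}" "E \<noteq> {}"
  shows "\<exists>w. closed_trail w \<and> cyc_edges w \<subseteq> E \<and> set w \<inter> \<Union>(E - cyc_edges w) = {}"
proof -
  define P where "P w \<longleftrightarrow> closed_trail w \<and> cyc_edges w \<subseteq> E" for w
  obtain e where e: "e \<in> E" using E(4) by blast
  then have "e \<noteq> {}" using E(2) by fastforce
  then obtain v where "v \<in> \<Union>E" using e by blast
  then obtain w0 where "P w0" using ex_closed_trail_at[OF E(1-3)] unfolding P_def by metis
  moreover have "length w < Suc (card E)" if "P w" for w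
    using that E(1) card_mono[of E "cyc_edges w"] by (auto simp: P_def closed_trail_def)
  ultimately obtain w where w: "P w" and mx: "\<And>w'. P w' \<Longrightarrow> length w' \<le> length w"
    using ex_has_greatest_nat[of P _ length] by metis
  have wE: "closed_trail w" "cyc_edges w \<subseteq> E" using w by (auto simp: P_def)
  define F where "F = E - cyc_edges w"
  have "set w \<inter> \<Union>F = {}"
  proof (rule ccontr)
    assume "\<not> ?thesis"
    then obtain v where v: "v \<in> set w" "v \<in> \<Union>F" by blast
    have "F = sym_diff E (cyc_edges w)" using wE by (auto simp: F_def)
    then have "oddset F = {}"
      using oddset_sym_diff[of E "cyc_edges w"] E oddset_closed_trail[OF wE(1)] by simp
    then obtain w' where w': "closed_trail w'" "cyc_edges w' \<subseteq> F" "hd w' = v"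
      using ex_closed_trail_at[of F v] v(2) E by (auto simp: F_def)
    obtain as bs where "w = as @ v # bs" using v(1) by (auto dest: split_list)
    define u where "u = (v # bs) @ as"
    have u: "u \<noteq> []" "hd u = v" "length u = length w" "cyc_edges u = cyc_edges w"
      using dcyc_append_commute[of as "v # bs"] \<open>w = _\<close> by (auto simp: u_def cyc_edges_def)
    have w'ne: "w' \<noteq> []" using w' by (simp add: closed_trail_def)
    have eq: "cyc_edges (u @ w') = cyc_edges w \<union> cyc_edges w'"
      using cyc_edges_append[OF u(1) w'ne] cyc_edges_cut[OF u(1)] cyc_edges_cut[OF w'ne] u(2,4) w'(3)
      by auto
    have "card (cyc_edges w \<union> cyc_edges w') = card (cyc_edges w) + card (cyc_edges w')"
      using w'(2) by (intro card_Un_disjoint) (auto simp: F_def)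
    then have "P (u @ w')"
      using eq u w'(1,2) wE by (auto simp: P_def closed_trail_def F_def)
    then have "length (u @ w') \<le> length w" by (rule mx)
    then show False using u(3) w'ne by simp
  qed
  then show ?thesis using wE by (auto simp: F_def)
qed

lemma Union_cyc_edges: "w \<noteq> [] \<Longrightarrow> \<Union>(cyc_edges w) = set w"
  using dcyc_ex_succ[of _ w] cyc_edges_subset[of _ w] by (force simp: cyc_edges_def)

text \<open>A mediant argument: if \<open>w\<close> has fewer than \<open>\<rho>\<close> edges per
  vertex, then the rest, which lives on other vertices, has more than \<open>\<rho>\<close>, and
  induction applies to it.\<close>

lemma ex_dense_closed_trail:
  assumes "finite E" "\<And>e. e \<in> E \<Longrightarrow> card e = 2" "oddset E = {}" "E \<noteq> {}"
    and "0 \<le> \<rho>" "\<rho> * real (card (\<Union>E)) \<le> real (card E)"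
  shows "\<exists>w. closed_trail w \<and> cyc_edges w \<subseteq> E \<and> \<rho> * real (card (set w)) \<le> real (length w)"
  using assms
proof (induction "card E" arbitrary: E rule: less_induct)
  case less
  obtain w where w: "closed_trail w" "cyc_edges w \<subseteq> E" "set w \<inter> \<Union>(E - cyc_edges w) = {}"
    using ex_maximal_closed_trail[OF less.prems(1-4)] by blast
  show ?case
  proof (cases "\<rho> * real (card (set w)) \<le> real (length w)")
    case True
    then show ?thesis using w by blast
  next
    case False
    define F where "F = E - cyc_edges w"
    have finU: "finite (\<Union>E)"
      using less.prems(1,2) by (metis card.infinite finite_Union zero_neq_numeral)
    have wne: "w \<noteq> []" using w(1) by (simp add: closed_trail_def)
    have wU: "set w \<subseteq> \<Union>E" using Union_cyc_edges[OF wne] w(2) by blast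
    have len: "length w = card (cyc_edges w)" using w(1) by (simp add: closed_trail_def)
    have cF: "card E = card F + length w"
      using w(2) less.prems(1) len card_mono[OF less.prems(1) w(2)] by (simp add: F_def card_Diff_subset)
    have "card (\<Union>F) + card (set w) \<le> card (\<Union>E)"
    proof -
      have "\<Union>F \<subseteq> \<Union>E" by (auto simp: F_def)
      then have "card (\<Union>F \<union> set w) \<le> card (\<Union>E)" using wU finU by (intro card_mono) auto
      moreover have "card (\<Union>F \<union> set w) = card (\<Union>F) + card (set w)"
        using w(3) finite_subset[OF \<open>\<Union>F \<subseteq> \<Union>E\<close> finU] by (intro card_Un_disjoint) (auto simp: F_def)
      ultimately show ?thesis by simp
    qed
    then have "\<rho> * real (card (\<Union>F)) + \<rho> * real (card (set w)) \<le> \<rho> * real (card (\<Union>E))"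
      unfolding distrib_left[symmetric] of_nat_add[symmetric] using less.prems(5)
      by (intro mult_left_mono) auto
    then have F: "\<rho> * real (card (\<Union>F)) < real (card F)"
      using False less.prems(6) cF by simp
    have "F \<noteq> {}" using F less.prems(5) by auto
    moreover have "card F < card E" using cF wne by simp
    moreover have "F = sym_diff E (cyc_edges w)" using w by (auto simp: F_def)
    then have "oddset F = {}"
      using oddset_sym_diff[of E "cyc_edges w"] less.prems oddset_closed_trail[OF w(1)] by simp
    ultimately obtain w' where "closed_trail w'" "cyc_edges w' \<subseteq> F"
        "\<rho> * real (card (set w')) \<le> real (length w')"
      using less.hyps[of F] less.prems F by (auto simp: F_def)
    then show ?thesis by (auto simp: F_def)
  qed
qed

section \<open>The lower bound\<close>

text \<open>For adjacent vertices this agrees with the graph distance; unlike walks, such edge sets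
  can be added modulo 2.\<close>

definition join_dist :: "'a set set \<Rightarrow> 'a \<Rightarrow> 'a \<Rightarrow> nat" where
  "join_dist E x y = (LEAST m. \<exists>J\<subseteq>E. card J = m \<and> oddset J = sym_diff {x} {y})"

text \<open>The instance gets one vertex per visit of the trail, so that a trail with repeated
  vertices becomes a Hamiltonian cycle; by \<open>len_le\<close> there may be surplus
  vertices.\<close>

locale trail_instance =
  fixes w :: "nat list" and n k :: nat
  assumes closed: "closed_trail w" and len_le: "length w \<le> n" and len_ge: "3 \<le> length w"
    and girth: "girth_ge (cyc_edges w) (2 * k)"
begin

abbreviation "E \<equiv> cyc_edges w"

text \<open>Vertex \<open>i\<close> of the instance is a copy of the trail vertex \<open>base i\<close>; copies of one vertex are at
  distance 0, and the surplus vertices are copies of the starting point. The minimum and maximum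
  merely name the endpoints of an edge.\<close>

definition base :: "nat \<Rightarrow> nat" where
  "base i = (if i < length w then w ! i else w ! 0)"

definition cost :: "nat set \<Rightarrow> real" where
  "cost e = real (join_dist E (base (Min e)) (base (Max e)))"

lemma base_in [simp]: "base i \<in> set w"
proof -
  have "w ! 0 \<in> set w" using len_ge by (intro nth_mem) linarith
  then show ?thesis by (simp add: base_def)
qed

lemma base_image: "base ` {..<n} = set w"
proof
  show "set w \<subseteq> base ` {..<n}"
  proof
    fix x assume "x \<in> set w"
    then obtain i where "i < length w" "x = w ! i" by (auto simp: in_set_conv_nth)
    then show "x \<in> base ` {..<n}" using len_le by (auto simp: base_def intro!: image_eqI[of _ _ i])
  qed
qed auto

lemma card_E: "card E = length w" and card_2: "e \<in> E \<Longrightarrow> card e = 2"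
  using closed by (auto simp: closed_trail_def)

lemma finite_sub_E: "J \<subseteq> E \<Longrightarrow> finite J"
  using finite_subset[of J E] by simp

text \<open>Initial pieces of the trail join \<open>hd w\<close> to every vertex; two of them added
  modulo 2 join \<open>x\<close> to \<open>y\<close>. This makes the minimum in
  \<open>join_dist\<close> an attained one.\<close>

lemma ex_join:
  assumes "x \<in> set w" "y \<in> set w"
  shows "\<exists>J\<subseteq>E. oddset J = sym_diff {x} {y}"
proof -
  have *: "\<exists>J\<subseteq>E. oddset J = sym_diff {hd w} {x}" if x: "x \<in> set w" for x
  proof -
    obtain as bs where w: "w = (as @ [x]) @ bs" using split_list[OF x] by auto
    have sub: "path_edges (as @ [x]) \<subseteq> E"
    proof (cases "bs = []")
      case True
      then show ?thesis using w cyc_edges_cut[of w] by auto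
    next
      case False
      then show ?thesis unfolding w using cyc_edges_append[of "as @ [x]" bs] by auto
    qed
    have "hd w = hd (as @ [x])" unfolding w by (cases as) auto
    moreover obtain J where "J \<subseteq> path_edges (as @ [x])" "oddset J = sym_diff {hd (as @ [x])} {last (as @ [x])}"
      using ex_path_join[of "as @ [x]"] sub card_2 by auto
    ultimately show ?thesis using sub by auto
  qed
  obtain J where J: "J \<subseteq> E" "oddset J = sym_diff {hd w} {x}"
    using *[OF assms(1)] by metis
  obtain J' where J': "J' \<subseteq> E" "oddset J' = sym_diff {hd w} {y}"
    using *[OF assms(2)] by metis
  have "finite J" "finite J'" using J(1) J'(1) by (auto intro: finite_sub_E)
  then have "oddset (sym_diff J J') = sym_diff (sym_diff {hd w} {x}) (sym_diff {hd w} {y})"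
    using oddset_sym_diff[of J J'] J J' by simp
  also have "\<dots> = sym_diff {x} {y}" by auto
  finally show ?thesis using J(1) J'(1) by (intro exI[of _ "sym_diff J J'"]) auto
qed

lemma join_dist_attained:
  assumes "x \<in> set w" "y \<in> set w"
  obtains J where "J \<subseteq> E" "card J = join_dist E x y" "oddset J = sym_diff {x} {y}"
proof -
  obtain J where "J \<subseteq> E" "oddset J = sym_diff {x} {y}" using ex_join[OF assms] by blast
  then have "\<exists>m. \<exists>J\<subseteq>E. card J = m \<and> oddset J = sym_diff {x} {y}" by blast
  then have "\<exists>J\<subseteq>E. card J = join_dist E x y \<and> oddset J = sym_diff {x} {y}"
    unfolding join_dist_def by (rule LeastI_ex)
  then show ?thesis using that by blast
qed

lemma join_dist_le: "J \<subseteq> E \<Longrightarrow> oddset J = sym_diff {x} {y} \<Longrightarrow> join_dist E x y \<le> card J"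
  unfolding join_dist_def by (rule Least_le) blast

lemma join_dist_refl: "join_dist E x x = 0"
  using join_dist_le[of "{}" x x] by simp

lemma join_dist_sym: "join_dist E x y = join_dist E y x"
  unfolding join_dist_def by (simp add: Un_commute)

lemma join_dist_eq_0: "x \<in> set w \<Longrightarrow> y \<in> set w \<Longrightarrow> join_dist E x y = 0 \<Longrightarrow> x = y"
proof -
  assume a: "x \<in> set w" "y \<in> set w" "join_dist E x y = 0"
  obtain J where J: "J \<subseteq> E" "card J = join_dist E x y" "oddset J = sym_diff {x} {y}"
    using join_dist_attained[OF a(1,2)] by metis
  have "card J = 0" using J(2) a(3) by simp
  then have "J = {}" using finite_sub_E[OF J(1)] by (metis card_0_eq)
  then have odd: "sym_diff {x} {y} = {}" using J(3) oddset_empty by metis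
  show "x = y"
  proof (rule ccontr)
    assume "x \<noteq> y"
    then have "x \<in> sym_diff {x} {y}" by simp
    with odd show False by (metis empty_iff)
  qed
qed

lemma join_dist_edge:
  assumes "{x, y} \<in> E" shows "join_dist E x y = 1"
proof -
  have "x \<noteq> y" using card_2[OF assms] by auto
  then have "join_dist E x y \<le> card {{x, y}}" using assms by (intro join_dist_le) auto
  moreover have "x \<in> set w" "y \<in> set w" using cyc_edges_subset[OF assms] by auto
  then have "join_dist E x y \<noteq> 0" using join_dist_eq_0 \<open>x \<noteq> y\<close> by blast
  ultimately show ?thesis by simp
qed

lemma join_dist_triangle:
  assumes "x \<in> set w" "y \<in> set w" "z \<in> set w"
  shows "join_dist E x z \<le> join_dist E x y + join_dist E y z"
proof -
  obtain J where J: "J \<subseteq> E" "card J = join_dist E x y" "oddset J = sym_diff {x} {y}"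
    using join_dist_attained[OF assms(1,2)] by metis
  obtain K where K: "K \<subseteq> E" "card K = join_dist E y z" "oddset K = sym_diff {y} {z}"
    using join_dist_attained[OF assms(2,3)] by metis
  have fin: "finite J" "finite K" using J(1) K(1) by (auto intro: finite_sub_E)
  have "oddset (sym_diff J K) = sym_diff (sym_diff {x} {y}) (sym_diff {y} {z})"
    using oddset_sym_diff[OF fin] J K by simp
  also have "\<dots> = sym_diff {x} {z}" by auto
  finally have odd: "oddset (sym_diff J K) = sym_diff {x} {z}" .
  have "sym_diff J K \<subseteq> E" using J(1) K(1) by blast
  then have "join_dist E x z \<le> card (sym_diff J K)" using odd by (rule join_dist_le)
  also have "\<dots> \<le> card J + card K" using fin by (rule card_sym_diff_le)
  finally show ?thesis using J K by simp
qed

lemma cost_doubleton: "cost {u, v} = real (join_dist E (base u) (base v))"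
  using join_dist_sym by (cases "u \<le> v") (auto simp: cost_def max_def min_def)

lemma cost_nonneg: "0 \<le> cost e" by (simp add: cost_def)

lemma cost_triangle: "cost {u, x} \<le> cost {u, v} + cost {v, x}"
  unfolding cost_doubleton of_nat_add[symmetric] of_nat_le_iff by (intro join_dist_triangle) auto

lemma metric: "metric_inst n cost"
  unfolding metric_inst_def using cost_nonneg cost_triangle by blast

section \<open>The tour that follows the trail, and its optimality\<close>

definition tour :: "nat set set" where "tour = cyc_edges [0..<n]"

definition tedge :: "nat \<Rightarrow> nat set" where "tedge i = {i, Suc i mod n}"

lemma n_ge: "3 \<le> n" using len_le len_ge by simp

lemma tour_eq: "tour = tedge ` {..<n}"
proof -
  have "tour = {{[0..<n] ! i, [0..<n] ! (Suc i mod n)} | i. i < n}"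
    unfolding tour_def cyc_edges_conv by simp
  also have "\<dots> = tedge ` {..<n}"
    using n_ge by (auto simp: tedge_def image_iff intro!: exI)
  finally show ?thesis .
qed

lemma is_tour: "is_tour n tour"
  unfolding is_tour_iff tour_def using n_ge by (intro conjI exI[of _ "[0..<n]"]) auto

lemma base_tedge: "base ` tedge i = {base i, base (Suc i mod n)}"
  by (simp add: tedge_def)

text \<open>The last trail edge closes up in either case: the next vertex is a surplus copy of
  \<open>w ! 0\<close> or, if \<open>n = length w\<close>, the vertex 0.\<close>

lemma base_tedge_long: "i < length w \<Longrightarrow> base ` tedge i = {w ! i, w ! (Suc i mod length w)}"
  unfolding base_tedge using len_le len_ge
  by (cases "Suc i = length w"; cases "Suc i = n") (auto simp: base_def)

lemma base_tedge_short: "length w \<le> i \<Longrightarrow> i < n \<Longrightarrow> base ` tedge i = {w ! 0}"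
  unfolding base_tedge using len_le len_ge by (cases "Suc i = n") (auto simp: base_def)

definition long :: "nat set set" where "long = {e \<in> tour. card (base ` e) = 2}"

lemma long_eq: "long = tedge ` {..<length w}"
proof -
  have "card (base ` tedge i) = 2 \<longleftrightarrow> i < length w" if "i < n" for i
  proof (cases "i < length w")
    case True
    then have "base ` tedge i \<in> E" using base_tedge_long by (auto simp: cyc_edges_conv)
    then show ?thesis using True card_2 by simp
  next
    case False
    then show ?thesis using base_tedge_short[of i] that by simp
  qed
  then show ?thesis using len_le unfolding long_def tour_eq by auto
qed

lemma base_long: "(`) base ` long = E"
proof -
  have "(`) base ` long = (\<lambda>i. base ` tedge i) ` {..<length w}"
    unfolding long_eq by (simp add: image_image)
  also have "\<dots> = (\<lambda>i. {w ! i, w ! (Suc i mod length w)}) ` {..<length w}"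
    using base_tedge_long by (intro image_cong) auto
  also have "\<dots> = E" by (auto simp: cyc_edges_conv)
  finally show ?thesis .
qed

text \<open>Only \<open>length w\<close> indices produce the \<open>length w\<close> distinct edges
  of \<open>E\<close>, so nothing gets identified on the way.\<close>

lemma card_long: "card long = length w" and inj_long: "inj_on ((`) base) long"
proof -
  have fin: "finite long" by (simp add: long_eq)
  have "card long \<le> length w" unfolding long_eq using card_image_le[of "{..<length w}" tedge] by simp
  moreover have "length w \<le> card long" using card_image_le[OF fin, of "(`) base"] base_long card_E by simp
  ultimately show "card long = length w" by simp
  then show "inj_on ((`) base) long" using base_long card_E fin by (intro eq_card_imp_inj_on) simp_all
qed

lemma cost_long: "e \<in> long \<Longrightarrow> cost e = 1"
proof -
  assume e: "e \<in> long"
  then obtain i where i: "e = {i, Suc i mod n}" by (auto simp: long_eq tedge_def)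
  have "base ` e \<in> E" using e base_long by blast
  then show "cost e = 1" unfolding i cost_doubleton using join_dist_edge by simp
qed

lemma cost_short: "e \<in> tour - long \<Longrightarrow> cost e = 0"
proof -
  assume e: "e \<in> tour - long"
  then obtain i where i: "i < n" "e = tedge i" "\<not> i < length w" unfolding tour_eq long_eq by blast
  then have "base ` e = {w ! 0}" using base_tedge_short by simp
  then have "base i = base (Suc i mod n)" using i by (auto simp: tedge_def)
  then show "cost e = 0" unfolding i tedge_def cost_doubleton by (simp add: join_dist_refl)
qed

lemma sum_cost_tour:
  assumes "A \<subseteq> tour" shows "sum cost A = real (card (A \<inter> long))"
proof -
  have fin: "finite A" using assms by (rule finite_subset) (simp add: tour_def)
  have "sum cost A = sum cost (A \<inter> long) + sum cost (A - long)"
    using fin by (rule sum.Int_Diff)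
  also have "sum cost (A - long) = 0" using cost_short assms by (intro sum.neutral) auto
  also have "sum cost (A \<inter> long) = (\<Sum>e\<in>A \<inter> long. 1)" using cost_long by (intro sum.cong) auto
  finally show ?thesis by simp
qed

lemma tour_cost: "tour_cost cost tour = real (length w)"
proof -
  have "tour \<inter> long = long" by (auto simp: long_def)
  then show ?thesis using sum_cost_tour[of tour] card_long by (simp add: tour_cost_def)
qed

text \<open>The ends of an edge projected to the trail graph and added modulo 2: they cancel if both
  are copies of the same vertex.\<close>

definition bd :: "nat set \<Rightarrow> nat set" where
  "bd e = (if card (base ` e) = 2 then base ` e else {})"

lemma bd_doubleton: "bd {u, v} = sym_diff {base u} {base v}"
  by (cases "base u = base v") (auto simp: bd_def)

lemma odd_bd:
  assumes "card e = 2" shows "odd (card {u \<in> e. base u = x}) \<longleftrightarrow> x \<in> bd e"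
proof -
  obtain u v where e: "e = {u, v}" "u \<noteq> v" using assms by (meson card_2_iff)
  have "{u' \<in> e. base u' = x} = (if base u = x then {u} else {}) \<union> (if base v = x then {v} else {})"
    unfolding e by auto
  then show ?thesis using e(2) unfolding e bd_doubleton by (auto simp: card_insert_if)
qed

text \<open>Count the ends of tour edges at the copies of \<open>x\<close>: there are two at each
  copy. An edge contributes an odd number of them exactly if \<open>x \<in> bd e\<close>.\<close>

lemma even_bd_tour:
  assumes "is_tour n T" shows "even (card {e \<in> T. x \<in> bd e})"
proof -
  obtain p where p: "distinct p" "set p = {..<n}" "T = cyc_edges p"
    using assms by (auto simp: is_tour_iff)
  have len: "3 \<le> length p" using distinct_card[OF p(1)] p(2) n_ge by simp
  have fin: "finite T" using p by simp
  have c2: "card e = 2" if e: "e \<in> T" for e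
  proof -
    obtain a b where "e = {a, b}" "(a, b) \<in> dcyc p" using e p(3) by (auto simp: cyc_edges_def)
    then show ?thesis using dcyc_neq[OF p(1)] len by auto
  qed
  have "(\<Sum>e\<in>T. card {u \<in> e. base u = x}) = (\<Sum>e\<in>T. card {u \<in> {..<n}. base u = x \<and> u \<in> e})"
  proof (rule sum.cong[OF refl])
    fix e assume "e \<in> T"
    then have "e \<subseteq> {..<n}" using p cyc_edges_subset by blast
    then have "{u \<in> e. base u = x} = {u \<in> {..<n}. base u = x \<and> u \<in> e}" by auto
    then show "card {u \<in> e. base u = x} = card {u \<in> {..<n}. base u = x \<and> u \<in> e}" by simp
  qed
  also have "\<dots> = (\<Sum>e\<in>T. \<Sum>u\<in>{u \<in> {u \<in> {..<n}. base u = x}. u \<in> e}. 1)"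
    by (intro sum.cong refl) (auto intro!: arg_cong[of _ _ card])
  also have "\<dots> = (\<Sum>u\<in>{u \<in> {..<n}. base u = x}. \<Sum>e\<in>{e \<in> T. u \<in> e}. 1)"
    using fin by (intro sum.swap_restrict) auto
  also have "\<dots> = (\<Sum>u\<in>{u \<in> {..<n}. base u = x}. 2)"
    using card_cyc_edges_at[OF p(1) len] p by (intro sum.cong) auto
  finally have "even (\<Sum>e\<in>T. card {u \<in> e. base u = x})" by simp
  then have "even (card {e \<in> T. odd (card {u \<in> e. base u = x})})"
    using fin by (simp add: even_sum_iff)
  moreover have "{e \<in> T. odd (card {u \<in> e. base u = x})} = {e \<in> T. x \<in> bd e}"
    using odd_bd[OF c2] by blast
  ultimately show ?thesis by simp
qed

text \<open>Each edge is replaced by a minimum join of its projected ends. Adding these joins modulo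
  2 preserves parity, and the result has no more edges than all joins together.\<close>

lemma ex_join_set:
  assumes "finite B" "\<And>e. e \<in> B \<Longrightarrow> \<exists>u v. e = {u, v}"
  shows "\<exists>J\<subseteq>E. real (card J) \<le> sum cost B \<and> oddset J = {x. odd (card {e \<in> B. x \<in> bd e})}"
  using assms
proof (induction B rule: finite_induct)
  case empty
  then show ?case by (intro exI[of _ "{}"]) auto
next
  case (insert e B)
  obtain J where J: "J \<subseteq> E" "real (card J) \<le> sum cost B" "oddset J = {x. odd (card {e \<in> B. x \<in> bd e})}"
    using insert by auto
  obtain u v where e: "e = {u, v}" using insert.prems by blast
  obtain K where K: "K \<subseteq> E" "card K = join_dist E (base u) (base v)" "oddset K = sym_diff {base u} {base v}"
    using join_dist_attained[of "base u" "base v"] by auto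
  have fin: "finite J" "finite K" using J(1) K(1) by (auto intro: finite_sub_E)
  have "real (card (sym_diff J K)) \<le> sum cost (insert e B)"
  proof -
    have "real (card (sym_diff J K)) \<le> real (card J) + real (card K)"
      using card_sym_diff_le[OF fin] by (simp only: of_nat_add[symmetric] of_nat_le_iff)
    then show ?thesis using J(2) K(2) insert(1,2) e by (simp add: cost_doubleton)
  qed
  moreover have "oddset (sym_diff J K) = {x. odd (card {e' \<in> insert e B. x \<in> bd e'})}"
  proof -
    have "oddset (sym_diff J K) = sym_diff {x. odd (card {e \<in> B. x \<in> bd e})} (bd e)"
      using oddset_sym_diff[OF fin] J(3) K(3) e bd_doubleton by simp
    moreover have "odd (card {e' \<in> insert e B. x \<in> bd e'}) \<longleftrightarrow>
        (odd (card {e \<in> B. x \<in> bd e}) \<noteq> (x \<in> bd e))" for x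
    proof -
      have "{e' \<in> insert e B. x \<in> bd e'} = (if x \<in> bd e then insert e {e \<in> B. x \<in> bd e} else {e \<in> B. x \<in> bd e})"
        by auto
      then show ?thesis using insert(1,2) by simp
    qed
    ultimately show ?thesis by blast
  qed
  ultimately show ?case using J(1) K(1) by (intro exI[of _ "sym_diff J K"]) auto
qed

text \<open>A cheaper tour reached by a \<open>k\<close>-move would, added to the old one modulo 2, leave a nonempty
  even set of fewer than \<open>2k\<close> trail edges.\<close>

lemma k_optimal: "k_optimal k n cost tour"
  unfolding k_optimal_def
proof (intro conjI allI impI notI)
  show "is_tour n tour" by (rule is_tour)
  fix T assume T: "is_tour n T" "card (tour - T) \<le> k" "tour_cost cost T < tour_cost cost tour"
  define A where "A = tour - T"
  define B where "B = T - tour"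
  obtain p where p: "set p = {..<n}" "T = cyc_edges p" using T(1) by (auto simp: is_tour_iff)
  have fin: "finite T" "finite tour" using p by (auto simp: tour_def)
  have finAB: "finite A" "finite B" using fin by (auto simp: A_def B_def)
  have "sum cost B + sum cost (T \<inter> tour) < sum cost A + sum cost (T \<inter> tour)"
    using T(3) sum.Int_Diff[of T cost tour] sum.Int_Diff[of tour cost T] fin
    by (simp add: tour_cost_def A_def B_def Int_commute)
  then have less: "sum cost B < real (card (A \<inter> long))"
    using sum_cost_tour[of A] by (simp add: A_def)
  have B2: "\<exists>u v. e = {u, v}" if "e \<in> B" for e
    using that p(2) by (auto simp: B_def cyc_edges_def)
  obtain J where J: "J \<subseteq> E" "real (card J) \<le> sum cost B" "oddset J = {x. odd (card {e \<in> B. x \<in> bd e})}"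
    using ex_join_set[OF finAB(2) B2] by metis
  \<comment> \<open>The removed edges of length 1, seen in the trail graph. Those of length 0 have
    empty \<open>bd\<close> and do not affect parity.\<close>
  define K where "K = (`) base ` (A \<inter> long)"
  have KE: "K \<subseteq> E" using base_long by (auto simp: K_def)
  have injA: "inj_on ((`) base) (A \<inter> long)" using inj_long by (rule inj_on_subset) auto
  have cardK: "card K = card (A \<inter> long)" unfolding K_def using injA by (rule card_image)
  have oddK: "oddset K = {x. odd (card {e \<in> A. x \<in> bd e})}"
  proof -
    have "card {e \<in> K. x \<in> e} = card {e \<in> A. x \<in> bd e}" for x
    proof -
      have "{e \<in> K. x \<in> e} = (`) base ` {e \<in> A. x \<in> bd e}"
        by (auto simp: K_def bd_def long_def A_def split: if_splits)
      moreover have "{e \<in> A. x \<in> bd e} \<subseteq> A \<inter> long"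
        by (auto simp: bd_def long_def A_def split: if_splits)
      ultimately show ?thesis using inj_on_subset[OF injA] by (simp add: card_image)
    qed
    then show ?thesis by (simp add: oddset_def)
  qed
  \<comment> \<open>Both tours are even at \<open>x\<close> and share the edges outside
    \<open>A\<close> and \<open>B\<close>, so these two sets have equal parity at
    \<open>x\<close>.\<close>
  have par: "odd (card {e \<in> A. x \<in> bd e}) \<longleftrightarrow> odd (card {e \<in> B. x \<in> bd e})" for x
  proof -
    have "card {e \<in> tour. x \<in> bd e} = card {e \<in> A. x \<in> bd e} + card {e \<in> T \<inter> tour. x \<in> bd e}"
      using fin by (subst card_Un_disjoint[symmetric]) (auto simp: A_def intro!: arg_cong[of _ _ card])
    moreover have "card {e \<in> T. x \<in> bd e} = card {e \<in> B. x \<in> bd e} + card {e \<in> T \<inter> tour. x \<in> bd e}"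
      using fin by (subst card_Un_disjoint[symmetric]) (auto simp: B_def intro!: arg_cong[of _ _ card])
    ultimately show ?thesis using even_bd_tour[OF T(1), of x] even_bd_tour[OF is_tour, of x] by presburger
  qed
  define X where "X = sym_diff K J"
  have finKJ: "finite K" "finite J" using KE J(1) by (auto intro: finite_sub_E)
  \<comment> \<open>This inequality is used twice: it makes the even set \<open>X\<close> nonempty
    and keeps its size below \<open>2 * card K\<close>.\<close>
  have "card J < card K" using less J(2) cardK by linarith
  then have "K \<noteq> J" by auto
  then have "X \<noteq> {}" by (auto simp: X_def)
  have "oddset X = {}" using oddset_sym_diff[OF finKJ] oddK J(3) par by (simp add: X_def)
  moreover have XE: "X \<subseteq> E" using KE J(1) by (auto simp: X_def)
  ultimately obtain m where m: "m \<le> card X" "has_cycle_len X m"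
    using even_has_short_cycle[of X] \<open>X \<noteq> {}\<close> card_2 finite_sub_E[OF XE] XE by blast
  have "has_cycle_len E m" using m(2) XE unfolding has_cycle_len_iff by blast
  then have "2 * k \<le> card X" using girth m(1) unfolding girth_ge_def by fastforce
  also have "\<dots> \<le> card K + card J" unfolding X_def by (rule card_sym_diff_le[OF finKJ])
  also have "\<dots> < 2 * card K" using \<open>card J < card K\<close> by simp
  also have "card K \<le> card A" unfolding cardK using finAB by (intro card_mono) auto
  finally show False using T(2) by (simp add: A_def)
qed

text \<open>Insert the vertices one by one, each next to a copy of its base or to its predecessor on the
  trail; only the latter costs anything, namely at most 2.\<close>

lemma ex_cheap_tour:
  assumes "1 \<le> m" "m \<le> n"
  shows "\<exists>p. distinct p \<and> set p = {..<m} \<and> ccost cost p \<le> 2 * real (card (base ` {..<m}))"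
  using assms
proof (induction m rule: nat_induct_at_least)
  case base
  have "ccost cost [0] = 0" using cost_doubleton[of 0 0] by (simp add: ccost_def join_dist_refl)
  then show ?case by (intro exI[of _ "[0]"]) auto
next
  case (Suc m)
  then obtain p where p: "distinct p" "set p = {..<m}" "ccost cost p \<le> 2 * real (card (base ` {..<m}))"
    by auto
  have "\<exists>u<m. 2 * cost {u, m} \<le> 2 * real (card (base ` {..<Suc m})) - 2 * real (card (base ` {..<m}))"
  proof (cases "base m \<in> base ` {..<m}")
    case True
    then obtain u where u: "u < m" "base u = base m" by auto
    then have "cost {u, m} = 0" by (simp add: cost_doubleton join_dist_refl)
    moreover have "base ` {..<Suc m} = base ` {..<m}" using True by (auto simp: lessThan_Suc)
    ultimately show ?thesis using u by auto
  next
    case False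
    \<comment> \<open>A surplus vertex would be a copy of vertex 0, which is already on the
      cycle.\<close>
    have "m < length w"
    proof (rule ccontr)
      assume "\<not> m < length w"
      then have "base m = base 0" using len_ge by (auto simp: base_def)
      then show False using False Suc.hyps by auto
    qed
    then have "{base (m - 1), base m} \<in> E"
      using Suc.hyps by (auto simp: cyc_edges_conv base_def intro!: exI[of _ "m - 1"])
    then have "cost {m - 1, m} = 1" by (simp add: cost_doubleton join_dist_edge)
    moreover have "card (base ` {..<Suc m}) = Suc (card (base ` {..<m}))"
      using False by (simp add: lessThan_Suc)
    ultimately show ?thesis using Suc.hyps by (intro exI[of _ "m - 1"]) auto
  qed
  then obtain u where u: "u < m"
      "2 * cost {u, m} \<le> 2 * real (card (base ` {..<Suc m})) - 2 * real (card (base ` {..<m}))" by blast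
  then have "u \<in> set p" using p(2) by simp
  then obtain as bs where "p = (as @ [u]) @ bs" by (auto dest: split_list)
  define q where "q = bs @ (as @ [u])"
  have q: "q \<noteq> []" "last q = u" "distinct q" "set q = {..<m}" "ccost cost q = ccost cost p"
    using p ccost_append_commute[of cost bs "as @ [u]"] \<open>p = _\<close> by (auto simp: q_def)
  have "ccost cost (q @ [m]) = pcost cost q + cost {u, m} + cost {m, hd q}"
    using ccost_append[of q "[m]" cost] q by simp
  \<comment> \<open>Putting \<open>m\<close> after \<open>u\<close> replaces the edge from
    \<open>u\<close> to \<open>hd q\<close> by two edges, a detour of at most
    \<open>2 * cost {u, m}\<close>.\<close>
  also have "cost {m, hd q} \<le> cost {m, u} + cost {u, hd q}" by (rule cost_triangle)
  finally have "ccost cost (q @ [m]) \<le> ccost cost q + 2 * cost {u, m}"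
    using q(2) by (simp add: ccost_def insert_commute)
  then have "ccost cost (q @ [m]) \<le> 2 * real (card (base ` {..<Suc m}))" using u p(3) q(5) by simp
  moreover have "distinct (q @ [m])" "set (q @ [m]) = {..<Suc m}" using q(3,4) by (auto simp: lessThan_Suc)
  ultimately show ?case by blast
qed

lemma tour_cost_cycle:
  assumes "distinct p" "set p = {..<n}" shows "tour_cost c (cyc_edges p) = ccost c p"
  using assms sum_cyc_edges[of p c] distinct_card[of p] n_ge by (simp add: tour_cost_def)

lemma OPT_le: "OPT n cost \<le> 2 * real (card (set w))"
proof -
  obtain p where p: "distinct p" "set p = {..<n}" "ccost cost p \<le> 2 * real (card (base ` {..<n}))"
    using ex_cheap_tour[of n] n_ge by auto
  have "is_tour n (cyc_edges p)" using p n_ge by (auto simp: is_tour_iff)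
  then have "OPT n cost \<le> tour_cost cost (cyc_edges p)"
    unfolding OPT_def by (intro Min_le) (auto simp: finite_tours)
  also have "\<dots> \<le> 2 * real (card (set w))" using tour_cost_cycle[OF p(1,2)] p(3) base_image by simp
  finally show ?thesis .
qed

text \<open>A tour of cost at most \<open>1 / 2\<close> would force all distances down to
  \<open>1 / 2\<close>, but neighbours on the trail are at distance 1. The bound is
  \<open>1 / 2\<close> instead of 0 because \<open>ex_clustering\<close> asks for a positive
  one.\<close>

lemma OPT_pos: "0 < OPT n cost"
proof (rule ccontr)
  assume not: "\<not> ?thesis"
  have "OPT n cost \<in> tour_cost cost ` {T. is_tour n T}"
    unfolding OPT_def using is_tour by (intro Min_in) (auto simp: finite_tours)
  then obtain q where q: "distinct q" "set q = {..<n}" "tour_cost cost (cyc_edges q) = OPT n cost"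
    by (auto simp: is_tour_iff)
  have "ccost cost q \<le> 1 / 2" using tour_cost_cycle[OF q(1,2)] q(3) not by simp
  from ex_clustering[OF q(1,2) n_ge metric this _ order_refl]
  have "cost {0, 1} \<le> 1 / 2" using n_ge by auto
  moreover have "tedge 0 \<in> long" using len_ge unfolding long_eq by (intro imageI) auto
  then have "cost {0, 1} = 1" using cost_long n_ge by (auto simp: tedge_def)
  ultimately show False by simp
qed

lemma alpha_ge: "ereal (real (length w) / (2 * real (card (set w)))) \<le> alpha k n"
proof -
  have "real (length w) / (2 * real (card (set w))) \<le> tour_cost cost tour / OPT n cost"
    unfolding tour_cost using OPT_le OPT_pos by (intro divide_left_mono) (auto intro!: mult_pos_pos)
  also have "ereal (tour_cost cost tour / OPT n cost) \<le> alpha k n"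
    unfolding alpha_def using metric OPT_pos k_optimal by (intro Sup_upper) blast
  finally show ?thesis by simp
qed

end

section \<open>From extremal graphs to the logarithmic gap\<close>

lemma closed_trail_length_ge:
  assumes "closed_trail w" shows "3 \<le> length w"
proof (rule ccontr)
  assume "\<not> ?thesis"
  moreover have "w \<noteq> []" using assms by (simp add: closed_trail_def)
  ultimately consider x where "w = [x]" | x y where "w = [x, y]"
    by (cases w; cases "tl w"; cases "tl (tl w)") auto
  then show False
  proof cases
    case 1
    then show False using assms by (simp add: closed_trail_def cyc_edges_def dcyc_eq)
  next
    case 2
    then have "cyc_edges w = {{x, y}}" by (auto simp: cyc_edges_def dcyc_eq insert_commute)
    then show False using assms 2 by (simp add: closed_trail_def)
  qed
qed

lemma girth_ge_mono: "girth_ge G g \<Longrightarrow> F \<subseteq> G \<Longrightarrow> girth_ge F g"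
  unfolding girth_ge_def has_cycle_len_iff by blast

text \<open>Under constant costs all tours have equal length. This covers sparse extremal graphs and
  shows that \<open>alpha k n\<close> is not the supremum of the empty set.\<close>

lemma one_le_alpha:
  assumes n: "3 \<le> n" shows "1 \<le> alpha k n"
proof -
  let ?c = "\<lambda>_. 1 :: real"
  have cost: "tour_cost ?c T = real n" if T: "is_tour n T" for T
  proof -
    obtain p where p: "distinct p" "set p = {..<n}" "T = cyc_edges p"
      using T by (auto simp: is_tour_iff)
    have "length p = n" using distinct_card[OF p(1)] p(2) by simp
    then show ?thesis using card_cyc_edges[OF p(1)] n p(3) by (simp add: tour_cost_def)
  qed
  define T where "T = cyc_edges [0..<n]"
  have T: "is_tour n T"
    unfolding is_tour_iff T_def using n by (intro conjI exI[of _ "[0..<n]"]) auto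
  have "tour_cost ?c ` {T. is_tour n T} = {real n}"
  proof
    show "tour_cost ?c ` {T. is_tour n T} \<subseteq> {real n}" using cost by auto
    show "{real n} \<subseteq> tour_cost ?c ` {T. is_tour n T}"
      using imageI[of T "{T. is_tour n T}" "tour_cost ?c"] T cost[OF T] by simp
  qed
  then have opt: "OPT n ?c = real n" by (simp add: OPT_def)
  have "metric_inst n ?c" by (simp add: metric_inst_def)
  moreover have "0 < OPT n ?c" using opt n by simp
  moreover have "k_optimal k n ?c T" using T cost by (simp add: k_optimal_def)
  ultimately have "ereal (tour_cost ?c T / OPT n ?c) \<le> alpha k n"
    unfolding alpha_def by (intro Sup_upper) blast
  then show ?thesis using opt cost[OF T] n by (simp add: one_ereal_def)
qed

text \<open>If \<open>ex N (2 * k)\<close> is at most \<open>4 * N\<close>, the trivial ratio 1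
  suffices. Otherwise an even subgraph keeps all but \<open>N\<close> of the edges, which is more
  than half of them; the other factor 2 is that of \<open>OPT_le\<close>.\<close>

lemma ex_ratio_le_alpha:
  assumes N: "1 \<le> N" and n: "3 \<le> n" "ex N (2 * k) \<le> n"
  shows "ereal (real (ex N (2 * k)) / (4 * real N)) \<le> alpha k n"
proof (cases "real (ex N (2 * k)) / (4 * real N) \<le> 1")
  case True
  then have "ereal (real (ex N (2 * k)) / (4 * real N)) \<le> 1" by (simp add: one_ereal_def)
  then show ?thesis using one_le_alpha[OF n(1)] order_trans by blast
next
  case False
  obtain G where G: "G \<subseteq> Kedges N" "girth_ge G (2 * k)" "card G = ex N (2 * k)"
    using ex_attained by blast
  have finG: "finite G" using G(1) finite_Kedges by (rule finite_subset)
  have UG: "\<Union>G \<subseteq> {..<N}" using G(1) by (auto simp: Kedges_def)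
  obtain F where F: "F \<subseteq> G" "oddset F = {}" "card G \<le> card F + card {..<N}"
    using ex_large_even_subset[OF finG _ UG] by auto
  define \<rho> where "\<rho> = (real (ex N (2 * k)) - real N) / real N"
  have big: "4 * real N < real (ex N (2 * k))" using False N by (simp add: field_simps)
  have \<rho>0: "0 \<le> \<rho>" using big by (simp add: \<rho>_def)
  have cF: "real (ex N (2 * k)) - real N \<le> real (card F)" using F(3) G(3) by simp
  have "card (\<Union>F) \<le> card {..<N}" using F(1) UG by (intro card_mono) auto
  then have "\<rho> * real (card (\<Union>F)) \<le> \<rho> * real N" using \<rho>0 by (intro mult_left_mono) auto
  also have "\<dots> = real (ex N (2 * k)) - real N" using N by (simp add: \<rho>_def)
  also note cF
  finally have dens: "\<rho> * real (card (\<Union>F)) \<le> real (card F)" .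
  have "F \<noteq> {}" using cF big by auto
  moreover have finF: "finite F" using F(1) finG by (rule finite_subset)
  moreover have "card e = 2" if "e \<in> F" for e using that F(1) G(1) Kedges_card by blast
  ultimately obtain w where w: "closed_trail w" "cyc_edges w \<subseteq> F"
      "\<rho> * real (card (set w)) \<le> real (length w)"
    using ex_dense_closed_trail[of F \<rho>] F(2) \<rho>0 dens by blast
  have "length w = card (cyc_edges w)" using w(1) by (simp add: closed_trail_def)
  also have "\<dots> \<le> card F" using w(2) finF by (intro card_mono)
  also have "\<dots> \<le> card G" using F(1) finG by (intro card_mono)
  finally have len: "length w \<le> n" using G(3) n(2) by simp
  interpret trail_instance w n k
    using w(1) len closed_trail_length_ge[OF w(1)] girth_ge_mono[OF G(2)] w(2) F(1)
    by unfold_locales auto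
  have "set w \<noteq> {}" using closed_trail_length_ge[OF w(1)] by auto
  then have pos: "0 < real (card (set w))" by (simp add: card_gt_0_iff)
  have "real (ex N (2 * k)) / (4 * real N) \<le> \<rho> / 2"
    using big N by (simp add: \<rho>_def field_simps)
  also have "\<dots> \<le> real (length w) / (2 * real (card (set w)))"
    using w(3) pos by (simp add: field_simps)
  finally have "ereal (real (ex N (2 * k)) / (4 * real N)) \<le>
      ereal (real (length w) / (2 * real (card (set w))))" by simp
  then show ?thesis using alpha_ge order_trans by blast
qed

lemma girth_ge_image:
  assumes f: "inj_on f S" and E: "\<Union>E \<subseteq> S" and g: "girth_ge E g"
  shows "girth_ge ((`) f ` E) g"
  unfolding girth_ge_def
proof (intro allI impI)
  fix m assume "has_cycle_len ((`) f ` E) m"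
  then obtain vs where vs: "3 \<le> m" "distinct vs" "length vs = m" "cyc_edges vs \<subseteq> (`) f ` E"
    by (auto simp: has_cycle_len_iff)
  define h where "h = inv_into S f"
  have "vs \<noteq> []" using vs by auto
  then have "set vs \<subseteq> f ` S" using Union_cyc_edges[of vs] vs(4) E by blast
  then have inj: "inj_on h (set vs)" unfolding h_def by (rule inj_on_inv_into)
  have "cyc_edges (map h vs) = (`) h ` cyc_edges vs"
  proof -
    have "dcyc (map h vs) = (\<lambda>(x, y). (h x, h y)) ` dcyc vs"
      by (simp add: dcyc_def rotate1_map zip_map_map)
    then show ?thesis by (simp add: cyc_edges_def image_image case_prod_beta)
  qed
  also have "\<dots> \<subseteq> (`) h ` (`) f ` E" using vs(4) by (rule image_mono)
  also have "\<dots> = E"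
  proof -
    have "h ` f ` e = e" if "e \<in> E" for e
      unfolding h_def using f E that by (intro inv_into_image_cancel) auto
    then show ?thesis by (simp add: image_image)
  qed
  finally have "has_cycle_len E m"
    unfolding has_cycle_len_iff using vs inj by (intro conjI exI[of _ "map h vs"]) (auto simp: distinct_map)
  then show "g \<le> m" using g by (simp add: girth_ge_def)
qed

lemma card_le_ex:
  assumes S: "finite S" "card S \<le> N" and E: "\<Union>E \<subseteq> S" "\<And>e. e \<in> E \<Longrightarrow> card e = 2"
    and g: "girth_ge E g"
  shows "card E \<le> ex N g"
proof -
  have "\<exists>f. f ` S \<subseteq> {..<N} \<and> inj_on f S"
    using S by (intro card_le_inj) auto
  then obtain f where f: "f ` S \<subseteq> {..<N}" "inj_on f S" by blast
  have "(`) f ` E \<subseteq> Kedges N"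
  proof
    fix e' assume "e' \<in> (`) f ` E"
    then obtain e where e: "e \<in> E" "e' = f ` e" by blast
    obtain x y where xy: "e = {x, y}" "x \<noteq> y" using E(2)[OF e(1)] by (meson card_2_iff)
    have S': "x \<in> S" "y \<in> S" using xy e(1) E(1) by auto
    then have "f x \<noteq> f y" using f(2) xy(2) by (meson inj_onD)
    then show "e' \<in> Kedges N" using S' f(1) e(2) xy(1) unfolding Kedges_def by auto
  qed
  then have "card ((`) f ` E) \<le> ex N g" using girth_ge_image[OF f(2) E(1) g] by (rule ex_ge)
  moreover have "inj_on ((`) f) E"
    using inj_on_subset[OF inj_on_image_Pow[OF f(2)], of E] E(1) by blast
  ultimately show ?thesis by (simp add: card_image)
qed

text \<open>Split the vertices into four blocks of size \<open>a\<close>: each edge lies in the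
  union of two blocks, and there are 16 ordered pairs of blocks. The purpose is to control the last
  summand of \<open>U\<close>, whose extremal graph may have too many edges for a trail on
  \<open>n\<close> vertices.\<close>

lemma ex_double_le:
  assumes "1 \<le> a" "N' \<le> 4 * a" shows "ex N' g \<le> 16 * ex (2 * a) g"
proof -
  obtain G where G: "G \<subseteq> Kedges N'" "girth_ge G g" "card G = ex N' g" using ex_attained by blast
  define S where "S i = {i * a..<i * a + a}" for i
  define H where "H ij = {e \<in> G. e \<subseteq> S (fst ij) \<union> S (snd ij)}" for ij
  have "G \<subseteq> (\<Union>ij\<in>{..<4} \<times> {..<4}. H ij)"
  proof
    fix e assume e: "e \<in> G"
    then obtain u v where uv: "e = {u, v}" "u < N'" "v < N'" using G(1) by (auto simp: Kedges_def)
    have S: "x div a < 4 \<and> x \<in> S (x div a)" if "x < N'" for x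
    proof -
      have "x < 4 * a" using that assms(2) by simp
      moreover have "x div a * a \<le> x" by simp
      moreover have "x < x div a * a + a" using assms(1) mod_less_divisor[of a x] div_mult_mod_eq[of x a] by linarith
      ultimately show ?thesis using assms(1) by (auto simp: S_def less_mult_imp_div_less)
    qed
    then have "e \<in> H (u div a, v div a)" using uv e by (auto simp: H_def)
    then show "e \<in> (\<Union>ij\<in>{..<4} \<times> {..<4}. H ij)" using S uv by blast
  qed
  then have "card G \<le> card (\<Union>ij\<in>{..<4::nat} \<times> {..<4::nat}. H ij)"
    using finite_subset[OF G(1) finite_Kedges] by (intro card_mono) (auto simp: H_def)
  also have "\<dots> \<le> (\<Sum>ij\<in>{..<4} \<times> {..<4}. card (H ij))" by (intro card_UN_le) auto
  also have "\<dots> \<le> (\<Sum>ij\<in>{..<4::nat} \<times> {..<4::nat}. ex (2 * a) g)"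
  proof (intro sum_mono)
    fix ij :: "nat \<times> nat"
    show "card (H ij) \<le> ex (2 * a) g"
    proof (rule card_le_ex)
      show "finite (S (fst ij) \<union> S (snd ij))" by (simp add: S_def)
      show "card (S (fst ij) \<union> S (snd ij)) \<le> 2 * a"
        by (rule order_trans[OF card_Un_le]) (simp add: S_def)
      show "\<Union>(H ij) \<subseteq> S (fst ij) \<union> S (snd ij)" by (auto simp: H_def)
      show "card e = 2" if "e \<in> H ij" for e using that G(1) Kedges_card by (auto simp: H_def)
      show "girth_ge (H ij) g" using G(2) by (rule girth_ge_mono) (auto simp: H_def)
    qed
  qed
  finally show ?thesis using G(3) by simp
qed

lemma term_k_Suc_le:
  assumes k: "3 \<le> k" shows "term_k k (Suc l) \<le> 16 * term_k k l"
proof -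
  define a where "a = 2 * (k - 1) * nat \<lceil>rk k ^ l\<rceil>"
  \<comment> \<open>So the number of vertices at most doubles from one level to the next, even after
    rounding up.\<close>
  have r: "rk k \<le> 2" using k by (simp add: rk_def field_simps)
  have r1: "1 \<le> rk k ^ l" by (rule rk_power_ge_1[OF k])
  have "rk k ^ Suc l \<le> 2 * rk k ^ l" using r r1 by (simp add: mult_right_mono)
  also have "\<dots> \<le> 2 * real (nat \<lceil>rk k ^ l\<rceil>)" using real_nat_ceiling_ge[of "rk k ^ l"] by simp
  finally have "rk k ^ Suc l \<le> of_int (int (2 * nat \<lceil>rk k ^ l\<rceil>))" by (simp only: of_nat_mult of_nat_numeral of_int_of_nat_eq)
  then have "nat \<lceil>rk k ^ Suc l\<rceil> \<le> 2 * nat \<lceil>rk k ^ l\<rceil>"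
    unfolding nat_le_iff ceiling_le_iff .
  then have "verts k (Suc l) \<le> 4 * (k - 1) * (2 * nat \<lceil>rk k ^ l\<rceil>)" by (intro mult_left_mono) auto
  then have "verts k (Suc l) \<le> 4 * a" by (simp add: a_def)
  moreover have a: "verts k l = 2 * a" by (simp add: a_def)
  moreover have "1 \<le> a" using verts_ge(2)[OF k, of l] unfolding a by linarith
  ultimately show ?thesis using ex_double_le[of a "verts k (Suc l)" "2 * k"]
    unfolding term_k_def a by linarith
qed

lemma term_ratio_le_alpha:
  assumes k: "3 \<le> k" and n: "3 \<le> n" "term_k k l \<le> n"
  shows "ereal (real (term_k k l) / rk k ^ l / (128 * real k)) \<le> alpha k n"
proof -
  define M where "M = real (ex (verts k l) (2 * k))"
  have r1: "1 \<le> rk k ^ l" by (rule rk_power_ge_1[OF k])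
  have v8: "8 \<le> verts k l" by (rule verts_ge(2)[OF k])
  \<comment> \<open>Rounding up at most doubles a power that is at least 1. So four times the vertex
    number is at most \<open>32 * real k * rk k ^ l\<close>, and the 4 in \<open>term_k\<close>
    turns 32 into 128.\<close>
  have "real (nat \<lceil>rk k ^ l\<rceil>) \<le> 2 * rk k ^ l" using r1 by linarith
  then have "real (4 * (k - 1)) * real (nat \<lceil>rk k ^ l\<rceil>) \<le> real (4 * k) * (2 * rk k ^ l)"
    by (intro mult_mono) auto
  then have v: "4 * real (verts k l) \<le> 32 * real k * rk k ^ l" by simp
  have "real (term_k k l) / rk k ^ l / (128 * real k) = M / (32 * real k * rk k ^ l)"
    by (simp add: term_k_def M_def)
  also have "\<dots> \<le> M / (4 * real (verts k l))"
  proof (rule divide_left_mono[OF v])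
    show "0 \<le> M" by (simp add: M_def)
    have "0 < real (verts k l)" using v8 by linarith
    then show "0 < 32 * real k * rk k ^ l * (4 * real (verts k l))"
      using k r1 by (intro mult_pos_pos) auto
  qed
  finally have "ereal (real (term_k k l) / rk k ^ l / (128 * real k)) \<le> ereal (M / (4 * real (verts k l)))"
    by simp
  also have "\<dots> \<le> alpha k n"
  proof -
    have "1 \<le> verts k l" by (rule order_trans[OF _ v8]) simp
    moreover have "ex (verts k l) (2 * k) \<le> n" using n(2) unfolding term_k_def by linarith
    ultimately show ?thesis unfolding M_def using n(1) by (intro ex_ratio_le_alpha)
  qed
  finally show ?thesis .
qed

text \<open>The \<open>m + 1\<close> summands before the last belong to graphs with at most
  \<open>n\<close> edges, so each is at most a constant times \<open>a\<close>. The last one is at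
  most 16 times its predecessor, whence \<open>m + 17\<close>, and \<open>m\<close> is at most the
  logarithm of \<open>n\<close> to base \<open>rk k\<close>.\<close>

lemma U_le_alpha_log:
  assumes k: "3 \<le> k" and n: "3 \<le> n" "term_k k 0 < n" and a: "alpha k n = ereal a"
  shows "U k n \<le> 128 * real k * (17 + 1 / ln (rk k)) * ln (real n) * a"
proof -
  define r where "r = rk k"
  have r: "1 < r" using rk_gt_1[OF k] by (simp add: r_def)
  define f where "f l = real (term_k k l) / r ^ l" for l
  define C where "C = 128 * real k"
  have C: "0 < C" using k by (simp add: C_def)
  have a1: "1 \<le> a" using one_le_alpha[OF n(1), of k] a by (simp add: one_ereal_def)
  have ratio: "f l \<le> C * a" if "term_k k l \<le> n" for l
  proof -
    have "f l / C \<le> a"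
      using term_ratio_le_alpha[OF k n(1) that] unfolding a f_def C_def r_def by simp
    then show ?thesis using C by (simp add: pos_divide_le_eq mult.commute)
  qed
  \<comment> \<open>This is what \<open>term_k k 0 < n\<close> is for: the last summand has a
    predecessor to be compared with.\<close>
  have "lstar k n \<noteq> 0"
  proof
    assume "lstar k n = 0"
    then show False using lstar_sum_ge[OF k, of n] n(2) by simp
  qed
  then obtain m where m: "lstar k n = Suc m" by (cases "lstar k n") auto
  have sum_less: "(\<Sum>l\<le>m. term_k k l) < n"
    using not_less_Least[of m "\<lambda>j. n \<le> (\<Sum>l\<le>j. term_k k l)"] m by (simp add: lstar_def)
  have small: "term_k k l \<le> n" if "l \<le> m" for l
  proof -
    have "term_k k l \<le> (\<Sum>l\<le>m. term_k k l)" using that by (intro member_le_sum) auto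
    then show ?thesis using sum_less by simp
  qed
  have "f (Suc m) \<le> 16 * f m"
  proof -
    have "real (term_k k (Suc m)) \<le> 16 * real (term_k k m)"
      using term_k_Suc_le[OF k, of m] by (metis of_nat_le_iff of_nat_mult of_nat_numeral)
    moreover have "r ^ m \<le> r ^ Suc m" using r by (intro power_increasing) auto
    ultimately have "f (Suc m) \<le> 16 * real (term_k k m) / r ^ m"
      unfolding f_def using r by (intro frac_le) auto
    then show ?thesis by (simp add: f_def)
  qed
  also have "\<dots> \<le> 16 * (C * a)" using ratio[OF small] by simp
  finally have last: "f (Suc m) \<le> 16 * (C * a)" .
  have "U k n = (\<Sum>l\<le>m. f l) + f (Suc m)" unfolding U_def m f_def r_def by simp
  also have "(\<Sum>l\<le>m. f l) \<le> (\<Sum>l\<le>m. C * a)" using ratio small by (intro sum_mono) auto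
  also have "\<dots> = (real m + 1) * (C * a)" by simp
  finally have "U k n \<le> (real m + 17) * (C * a)" using last by (simp add: algebra_simps)
  also have "\<dots> \<le> ((17 + 1 / ln r) * ln (real n)) * (C * a)"
  proof (rule mult_right_mono)
    have "r ^ m \<le> real n"
      using term_k_ge[OF k, of m] small[of m] unfolding r_def by (metis of_nat_le_iff order_refl order_trans)
    then have "ln (r ^ m) \<le> ln (real n)" using r n by (subst ln_le_cancel_iff) auto
    then have "real m * ln r \<le> ln (real n)" using r by (simp add: ln_realpow)
    then have "real m \<le> ln (real n) / ln r" using r by (simp add: pos_le_divide_eq)
    \<comment> \<open>As \<open>n\<close> exceeds \<open>exp 1\<close>, the constant 17 can be
      absorbed into the logarithm.\<close>
    moreover have "1 \<le> ln (real n)"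
    proof -
      have "exp 1 \<le> (3::real)" by (rule exp_le)
      then have "exp 1 \<le> real n" using n(1) by linarith
      then show ?thesis using n(1) by (subst ln_ge_iff) auto
    qed
    ultimately show "real m + 17 \<le> (17 + 1 / ln r) * ln (real n)" by (simp add: algebra_simps)
  qed (use C a1 in auto)
  finally show ?thesis by (simp add: C_def r_def mult_ac)
qed

lemma alpha_ge_U_div_log:
  assumes k: "3 \<le> k"
  shows "\<exists>c>0. \<exists>N. \<forall>n\<ge>N. ereal (c * U k n / ln (real n)) \<le> alpha k n"
proof -
  define K where "K = 128 * real k * (17 + 1 / ln (rk k))"
  have K: "0 < K"
  proof -
    have "0 < 1 / ln (rk k)" using rk_gt_1[OF k] by simp
    then have "0 < 17 + 1 / ln (rk k)" by linarith
    then show ?thesis using k unfolding K_def by (intro mult_pos_pos) auto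
  qed
  have "ereal (1 / K * U k n / ln (real n)) \<le> alpha k n" if n: "max 3 (Suc (term_k k 0)) \<le> n" for n
  proof -
    have n': "3 \<le> n" "term_k k 0 < n" using n by auto
    \<comment> \<open>The upper bound already proved makes \<open>alpha k n\<close> finite, so that
      real arithmetic applies.\<close>
    have "alpha k n \<noteq> \<infinity>" using alpha_le_U[OF k, of n] by auto
    moreover have "alpha k n \<noteq> -\<infinity>" using one_le_alpha[OF n'(1), of k] by auto
    ultimately obtain a where a: "alpha k n = ereal a" by (cases "alpha k n") auto
    have ln: "0 < ln (real n)" using n'(1) by (intro ln_gt_zero) simp
    have "U k n \<le> K * ln (real n) * a" using U_le_alpha_log[OF k n' a] by (simp add: K_def)
    then have "1 / K * U k n / ln (real n) \<le> a" using K ln by (simp add: field_simps)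
    then show ?thesis using a by simp
  qed
  then show ?thesis using K by (intro exI[of _ "1 / K"]) auto
qed

theorem theorem5p4:
  fixes k :: nat
  assumes "k \<ge> 3"
  shows "(\<forall>n. n > 0 \<longrightarrow> alpha k n \<le> ereal (U k n)) \<and>
         (\<exists>c::real. c > 0 \<and> (\<exists>N. \<forall>n\<ge>N. alpha k n \<ge> ereal (c * U k n / ln (real n))))"
  using alpha_le_U[OF assms] alpha_ge_U_div_log[OF assms] by blast

end
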